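(* Let $0\le\varepsilon<\frac1{\|g\|_{C^1}}$. For $f\in B_K\cap F_N$ and $e\in F_N$, the Fréchet derivative $D_f\tilde{\mathcal L}_{\varepsilon,N}\in L(F_N,F_N)$ has the representation $$D_f\tilde{\mathcal L}_{\varepsilon,N}(e)=\Pi_N\mathcal L_{T_{\varepsilon,f}}e+\Pi_N[\mathcal J(f)](e),$$ where for $h\in F_N$ $$[\mathcal J(h)](e):=\partial_f(\mathcal L_{T_{\varepsilon,f}}h)(e)=-\varepsilon\,\mathcal L_{I_f}\left[\left(\frac{\mathcal L_T(h)\cdot G(e)}{|I_f'|}\right)'\right].$$ Furthermore, the following Taylor expansion holds for $e\in F_N$ (as $\|e\|_{W^{1,1}}\to0$): $$\|\tilde{\mathcal L}_{\varepsilon,N}(f+e)-\tilde{\mathcal L}_{\varepsilon,N}(f)-D_f\tilde{\mathcal L}_{\varepsilon,N}(e)\|_{W^{1,1}}=(1+\|f\|_{W^{3,1}})\,o(\|e\|_{W^{1,1}}).$$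
   Context: Function spaces. $\mathbb S^1$ is the circle. $W^{i,1}=W^{i,1}(\mathbb S^1)$ is the Sobolev space (of real functions) with norm $\|f\|_{W^{i,1}}=\|f\|_{L^1}+\sum_{j=1}^i\|f^{(j)}\|_{L^1}$, and $W^{0,1}:=L^1$. $\mathcal D_1=\{f\in L^1: f\ge0,\ \int_{\mathbb S^1}f=1\}$. Dynamics. $T:\mathbb S^1\to\mathbb S^1$ is a $C^5$ uniformly expanding map, $g:\mathbb S^1\times\mathbb S^1\to\mathbb R$ is $C^5$, and $\|g\|_{C^k}$ is its usual $C^k$ norm. $G(e)(x)=\int_{\mathbb S^1}g(x,y)e(y)\,dy$. For $\varepsilon\ge0$ put $I_f(x)=I_{\varepsilon,f}(x)=x+\varepsilon G(f)(x)$ (mod 1) and $T_{\varepsilon,f}=I_{\varepsilon,f}\circ T$. For a map $S$, $\mathcal L_S:L^1\to L^1$ is its transfer operator: $\int\varphi\circ S\cdot\psi\,dx=\int\varphi\cdot\mathcal L_S\psi\,dx$ for $\psi\in L^1$, $\varphi\in L^\infty$. The (nonlinear) self-consistent transfer operator is $\tilde{\mathcal L}_\varepsilon(h)=\mathcal L_{T_{\varepsilon,h}}h$ (defined on probability densities; at $f+e$ with $e$ small it is defined by the same formula). $\partial_f(\mathcal L_{T_{\varepsilon,f}}h)(e)$ denotes the derivative, in direction $e$, of $f\mapsto\mathcal L_{T_{\varepsilon,f}}h$ with $h$ held fixed. A prime denotes the derivative in $x$. Standing constants. Fix a small $\varepsilon_0^*>0$, $\lambda\in(0,1)$ and $C_0>0$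 such that all the maps $T_{\varepsilon,f}$ with $\varepsilon\in[0,\varepsilon_0^*]$, $f\in\mathcal D_1$ satisfy $\sup_x 1/|T_{\varepsilon,f}'(x)|\le\lambda$ and $\|T_{\varepsilon,f}\|_{C^5}<C_0$ (all values of $\varepsilon$ considered lie in $[0,\varepsilon_0^*]$). There is then a constant $C_{LY}>0$, fixed throughout, with $\|\mathcal L_{T_{\varepsilon,f_n}\circ\cdots\circ T_{\varepsilon,f_1}}h\|_{W^{i,1}}\le\lambda^{in}\|h\|_{W^{i,1}}+C_{LY}\|h\|_{W^{i-1,1}}$ for all such maps, $h\in W^{i,1}$, $i=1,2,3,4$, $n\in\mathbb N$. Fix $K\ge C_{LY}/(1-\lambda^2)$ and let $B_K=\{h\in\mathcal D_1\cap W^{2,1}:\|h\|_{W^{2,1}}\le K\}$. Discretisation. $N\in\mathbb N$. With $e_k(x)=e^{2\pi ikx}$, the Fejér kernel is $K_N=\sum_{|k|\le N-1}(1-|k|/N)e_k$, $\Pi_Nf(x)=\int_{\mathbb S^1}K_N(x-y)f(y)\,dy$, $F_N=\mathrm{span}\{e_k:k=-N+1,\ldots,N\}$ (real-valued elements being meant when they are arguments of the nonlinear operator), and $\tilde{\mathcal L}_{\varepsilon,N}:=\Pi_N\tilde{\mathcal L}_\varepsilon$. $L(F_N,F_N)$ is the space of linear maps $F_N\to F_N$. *)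

theory Defs
  imports "HOL-Analysis.Analysis" "HOL-Library.Landau_Symbols"
begin

text \<open>
  The circle is \<open>\<real>/\<int>\<close>. Functions on it are 1-periodic functions on \<^typ>\<open>real\<close>, integrals over
  it are Lebesgue integrals over a period, and a map of the circle is given by a lift
  \<open>S :: real \<Rightarrow> real\<close>, i.e. \<open>S (x + 1) = S x + d\<close> with an integer \<open>d\<close>, so that ``mod 1'' disappears.
  Elements of \<open>L\<^sup>1\<close> are represented by functions, not by classes; objects that are
  determined only almost everywhere (weak derivatives, transfer operators) are picked by
  \<open>SOME\<close>, and enter only through integrals.

  The value type \<open>'a\<close> below is \<^typ>\<open>real\<close> for the function spaces and for the arguments of the
  nonlinear operator, and \<^typ>\<open>complex\<close> where the complex span of the characters is involved.
\<close>

definition periodic :: "(real \<Rightarrow> 'a) \<Rightarrow> bool" where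
  "periodic u \<longleftrightarrow> (\<forall>x. u (x + 1) = u x)"

definition cint :: "(real \<Rightarrow> 'a::{banach, second_countable_topology}) \<Rightarrow> 'a" where
  "cint u = (LINT x:{0..1}|lborel. u x)"

definition L1 :: "(real \<Rightarrow> 'a::{banach, second_countable_topology}) set" where
  "L1 = {u. periodic u \<and> set_integrable lborel {0..1} u}"

definition L1_norm :: "(real \<Rightarrow> 'a::{banach, second_countable_topology}) \<Rightarrow> real" where
  "L1_norm u = cint (\<lambda>x. norm (u x))"

definition Linf :: "(real \<Rightarrow> real) set" where
  "Linf = {\<phi>. periodic \<phi> \<and> \<phi> \<in> borel_measurable borel \<and> (\<exists>C. AE x in lborel. \<bar>\<phi> x\<bar> \<le> C)}"

definition densities :: "(real \<Rightarrow> real) set" where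
  "densities = {f \<in> L1. (AE x in lborel. 0 \<le> f x) \<and> cint f = 1}"

definition Ck :: "nat \<Rightarrow> (real \<Rightarrow> real) \<Rightarrow> bool" where
  "Ck k \<phi> \<longleftrightarrow> (\<forall>j<k. \<forall>x. (deriv ^^ j) \<phi> differentiable (at x)) \<and> continuous_on UNIV ((deriv ^^ k) \<phi>)"

definition is_weak_deriv ::
    "(real \<Rightarrow> 'a::{banach, second_countable_topology}) \<Rightarrow> (real \<Rightarrow> 'a) \<Rightarrow> bool" where
  "is_weak_deriv u v \<longleftrightarrow> u \<in> L1 \<and> v \<in> L1 \<and>
     (\<forall>\<phi>. periodic \<phi> \<and> (\<forall>k. Ck k \<phi>) \<longrightarrow>
        cint (\<lambda>x. deriv \<phi> x *\<^sub>R u x) = - cint (\<lambda>x. \<phi> x *\<^sub>R v x))"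

definition weak_deriv ::
    "(real \<Rightarrow> 'a::{banach, second_countable_topology}) \<Rightarrow> real \<Rightarrow> 'a" where
  "weak_deriv u = (SOME v. is_weak_deriv u v)"

text \<open>\<open>sobolev i\<close> is \<open>W\<^bsup>i,1\<^esup>\<close>; the norm is meaningful on \<open>sobolev i\<close> only.\<close>

primrec sobolev :: "nat \<Rightarrow> (real \<Rightarrow> 'a::{banach, second_countable_topology}) set" where
  "sobolev 0 = L1"
| "sobolev (Suc i) = {u \<in> L1. \<exists>v \<in> sobolev i. is_weak_deriv u v}"

definition sobolev_norm :: "nat \<Rightarrow> (real \<Rightarrow> 'a::{banach, second_countable_topology}) \<Rightarrow> real" where
  "sobolev_norm i u = (\<Sum>j\<le>i. L1_norm ((weak_deriv ^^ j) u))"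

definition circle_map :: "(real \<Rightarrow> real) \<Rightarrow> bool" where
  "circle_map S \<longleftrightarrow> (\<exists>d::int. \<forall>x. S (x + 1) = S x + of_int d)"

definition expanding_map :: "(real \<Rightarrow> real) \<Rightarrow> bool" where
  "expanding_map S \<longleftrightarrow> circle_map S \<and> Ck 5 S \<and> (\<exists>\<sigma>>1. \<forall>x. \<sigma> \<le> \<bar>deriv S x\<bar>)"

text \<open>A lift is unbounded, so order zero uses the representative in \<open>[0,1)\<close> of the value mod 1.\<close>

definition map_Ck_norm :: "nat \<Rightarrow> (real \<Rightarrow> real) \<Rightarrow> real" where
  "map_Ck_norm k S =
     Max (insert (SUP x. frac (S x)) ((\<lambda>j. SUP x. \<bar>(deriv ^^ j) S x\<bar>) ` {1..k}))"

definition pd1 :: "(real \<Rightarrow> real \<Rightarrow> real) \<Rightarrow> real \<Rightarrow> real \<Rightarrow> real" where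
  "pd1 g = (\<lambda>x y. deriv (\<lambda>s. g s y) x)"

definition pd2 :: "(real \<Rightarrow> real \<Rightarrow> real) \<Rightarrow> real \<Rightarrow> real \<Rightarrow> real" where
  "pd2 g = (\<lambda>x y. deriv (\<lambda>s. g x s) y)"

primrec Ck2 :: "nat \<Rightarrow> (real \<Rightarrow> real \<Rightarrow> real) \<Rightarrow> bool" where
  "Ck2 0 g \<longleftrightarrow> continuous_on UNIV (\<lambda>(x, y). g x y)"
| "Ck2 (Suc k) g \<longleftrightarrow> continuous_on UNIV (\<lambda>(x, y). g x y) \<and>
     (\<forall>x y. (\<lambda>s. g s y) differentiable (at x) \<and> (\<lambda>s. g x s) differentiable (at y)) \<and>
     Ck2 k (pd1 g) \<and> Ck2 k (pd2 g)"

definition Ck2_norm :: "nat \<Rightarrow> (real \<Rightarrow> real \<Rightarrow> real) \<Rightarrow> real" where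
  "Ck2_norm k g =
     Max ((\<lambda>(a, b). SUP (x, y). \<bar>(pd1 ^^ a) ((pd2 ^^ b) g) x y\<bar>) ` {(a, b). a + b \<le> k})"

definition is_transfer ::
    "(real \<Rightarrow> real) \<Rightarrow> (real \<Rightarrow> 'a::{banach, second_countable_topology}) \<Rightarrow> (real \<Rightarrow> 'a) \<Rightarrow> bool" where
  "is_transfer S \<psi> w \<longleftrightarrow> w \<in> L1 \<and>
     (\<forall>\<phi>\<in>Linf. cint (\<lambda>x. \<phi> (S x) *\<^sub>R \<psi> x) = cint (\<lambda>x. \<phi> x *\<^sub>R w x))"

definition transfer ::
    "(real \<Rightarrow> real) \<Rightarrow> (real \<Rightarrow> 'a::{banach, second_countable_topology}) \<Rightarrow> real \<Rightarrow> 'a" where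
  "transfer S \<psi> = (SOME w. is_transfer S \<psi> w)"

definition G_op ::
    "(real \<Rightarrow> real \<Rightarrow> real) \<Rightarrow> (real \<Rightarrow> 'a::{banach, second_countable_topology}) \<Rightarrow> real \<Rightarrow> 'a" where
  "G_op g e x = cint (\<lambda>y. g x y *\<^sub>R e y)"

definition I_map :: "(real \<Rightarrow> real \<Rightarrow> real) \<Rightarrow> real \<Rightarrow> (real \<Rightarrow> real) \<Rightarrow> real \<Rightarrow> real" where
  "I_map g \<epsilon> f x = x + \<epsilon> * G_op g f x"

definition T_map ::
    "(real \<Rightarrow> real) \<Rightarrow> (real \<Rightarrow> real \<Rightarrow> real) \<Rightarrow> real \<Rightarrow> (real \<Rightarrow> real) \<Rightarrow> real \<Rightarrow> real" where
  "T_map T g \<epsilon> f = I_map g \<epsilon> f \<circ> T"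

definition self_op ::
    "(real \<Rightarrow> real) \<Rightarrow> (real \<Rightarrow> real \<Rightarrow> real) \<Rightarrow> real \<Rightarrow> (real \<Rightarrow> real) \<Rightarrow> real \<Rightarrow> real" where
  "self_op T g \<epsilon> h = transfer (T_map T g \<epsilon> h) h"

text \<open>For \<open>fs = [f\<^sub>1, \<dots>, f\<^sub>n]\<close> this is \<open>T\<^bsub>\<epsilon>,f\<^sub>n\<^esub> \<circ> \<dots> \<circ> T\<^bsub>\<epsilon>,f\<^sub>1\<^esub>\<close>.\<close>

definition T_seq ::
    "(real \<Rightarrow> real) \<Rightarrow> (real \<Rightarrow> real \<Rightarrow> real) \<Rightarrow> real \<Rightarrow> (real \<Rightarrow> real) list \<Rightarrow> real \<Rightarrow> real" where
  "T_seq T g \<epsilon> fs = fold (\<lambda>f S. T_map T g \<epsilon> f \<circ> S) fs id"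

definition B_K :: "real \<Rightarrow> (real \<Rightarrow> real) set" where
  "B_K K = {h \<in> densities \<inter> sobolev 2. sobolev_norm 2 h \<le> K}"

abbreviation cplx :: "(real \<Rightarrow> real) \<Rightarrow> real \<Rightarrow> complex" where
  "cplx u \<equiv> \<lambda>x. complex_of_real (u x)"

definition character :: "int \<Rightarrow> real \<Rightarrow> complex" where
  "character k x = exp (2 * of_real pi * \<i> * of_int k * of_real x)"

definition fejer :: "nat \<Rightarrow> real \<Rightarrow> complex" where
  "fejer N x = (\<Sum>k | \<bar>k\<bar> \<le> int N - 1. of_real (1 - real_of_int \<bar>k\<bar> / real N) * character k x)"

definition Pi_op :: "nat \<Rightarrow> (real \<Rightarrow> complex) \<Rightarrow> real \<Rightarrow> complex" where
  "Pi_op N u x = cint (\<lambda>y. fejer N (x - y) * u y)"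

definition F_space :: "nat \<Rightarrow> (real \<Rightarrow> complex) set" where
  "F_space N = {u. \<exists>c. u = (\<lambda>x. \<Sum>k = - int N + 1..int N. c k * character k x)}"

definition F_real :: "nat \<Rightarrow> (real \<Rightarrow> real) set" where
  "F_real N = {u. cplx u \<in> F_space N}"

definition lin_F :: "nat \<Rightarrow> ((real \<Rightarrow> complex) \<Rightarrow> (real \<Rightarrow> complex)) set" where
  "lin_F N = {D. (\<forall>u\<in>F_space N. D u \<in> F_space N) \<and>
     (\<forall>u\<in>F_space N. \<forall>v\<in>F_space N. D (\<lambda>x. u x + v x) = (\<lambda>x. D u x + D v x)) \<and>
     (\<forall>c. \<forall>u\<in>F_space N. D (\<lambda>x. c * u x) = (\<lambda>x. c * D u x))}"

definition self_op_N ::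
    "(real \<Rightarrow> real) \<Rightarrow> (real \<Rightarrow> real \<Rightarrow> real) \<Rightarrow> real \<Rightarrow> nat \<Rightarrow> (real \<Rightarrow> real) \<Rightarrow> real \<Rightarrow> complex" where
  "self_op_N T g \<epsilon> N h = Pi_op N (cplx (self_op T g \<epsilon> h))"

text \<open>
  Frechet differentiability at \<open>f\<close> of a map \<open>\<Phi>\<close> from (a neighbourhood of \<open>f\<close> in) the real-valued
  elements of \<open>F_space N\<close> to \<open>F_space N\<close>; the increments are real-valued, the derivative is a linear
  map on \<open>F_space N\<close>. As \<open>F_space N\<close> is finite-dimensional, the choice of norm is immaterial and
  linear maps are bounded.
\<close>

definition has_frechet_F ::
    "nat \<Rightarrow> ((real \<Rightarrow> real) \<Rightarrow> (real \<Rightarrow> complex)) \<Rightarrow> (real \<Rightarrow> real) \<Rightarrow>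
     ((real \<Rightarrow> complex) \<Rightarrow> (real \<Rightarrow> complex)) \<Rightarrow> bool" where
  "has_frechet_F N \<Phi> f D \<longleftrightarrow> D \<in> lin_F N \<and>
     (\<forall>\<eta>>0. \<exists>\<delta>>0. \<forall>e\<in>F_real N. sobolev_norm 1 e < \<delta> \<longrightarrow>
        \<Phi> (\<lambda>x. f x + e x) \<in> F_space N \<and>
        sobolev_norm 1 (\<lambda>x. \<Phi> (\<lambda>x. f x + e x) x - \<Phi> f x - D (cplx e) x) \<le> \<eta> * sobolev_norm 1 e)"

text \<open>
  \<open>v\<close> is the derivative at \<open>f\<close> in direction \<open>e\<close>, with respect to \<open>W\<^bsup>1,1\<^esup>\<close>-convergence, of
  the function-valued map \<open>\<Phi>\<close>.
\<close>

definition has_dir_deriv ::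
    "((real \<Rightarrow> real) \<Rightarrow> (real \<Rightarrow> complex)) \<Rightarrow> (real \<Rightarrow> real) \<Rightarrow> (real \<Rightarrow> real) \<Rightarrow> (real \<Rightarrow> complex) \<Rightarrow> bool" where
  "has_dir_deriv \<Phi> f e v \<longleftrightarrow>
     (let R = (\<lambda>t x. (\<Phi> (\<lambda>x. f x + t * e x) x - \<Phi> f x) /\<^sub>R t - v x)
      in (\<forall>\<^sub>F t in at 0. R t \<in> sobolev 1) \<and> ((\<lambda>t. sobolev_norm 1 (R t)) \<longlongrightarrow> 0) (at 0))"

text \<open>The base point \<open>f\<close>, at which the derivative is taken, is an explicit argument.\<close>

definition J_op ::
    "(real \<Rightarrow> real) \<Rightarrow> (real \<Rightarrow> real \<Rightarrow> real) \<Rightarrow> real \<Rightarrow> (real \<Rightarrow> real) \<Rightarrow>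
     (real \<Rightarrow> complex) \<Rightarrow> (real \<Rightarrow> complex) \<Rightarrow> real \<Rightarrow> complex" where
  "J_op T g \<epsilon> f h e = (\<lambda>x. - of_real \<epsilon> *
     transfer (I_map g \<epsilon> f)
       (weak_deriv (\<lambda>y. transfer T h y * G_op g e y / of_real \<bar>deriv (I_map g \<epsilon> f) y\<bar>)) x)"

end

theory Submission
  imports Defs
begin

text \<open>
  \<open>\<Pi>\<^sub>N\<close> is convolution with a trigonometric polynomial, so \<open>\<Pi>\<^sub>N u\<close> depends on finitely many Fourier
  coefficients of \<open>u\<close> only. Let \<open>\<L>\<^bsub>\<epsilon>,f\<^esub>\<close> be the transfer operator of \<open>T\<^bsub>\<epsilon>,f\<^esub>\<close>. By duality
  the \<open>k\<close>-th coefficient of \<open>\<L>\<^bsub>\<epsilon>,f\<^esub> \<psi>\<close> is \<open>\<integral> e\<^bsub>-k\<^esub>(T\<^bsub>\<epsilon>,f\<^esub> x) \<psi>(x) dx\<close>: the density \<open>f\<close> enters only through the argument of a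
  smooth function. Since \<open>T\<^bsub>\<epsilon>,f+e\<^esub> = T\<^bsub>\<epsilon>,f\<^esub> + \<epsilon> G(e) \<circ> T\<close>, Taylor's formula for \<open>e\<^bsub>-k\<^esub>\<close> gives the derivative
  of each coefficient, with a remainder bounded by a multiple of \<open>\<parallel>e\<parallel>\<^sup>2\<close> in \<open>L\<^sup>1\<close>; the multiple is the same
  for all densities, because they all have norm one (\<open>remainder_coef\<close>, \<open>quadratic_remainder\<close>).
  The first-order terms are the coefficients of \<open>\<Pi>\<^sub>N \<L> e\<close> and, after an integration by parts against
  \<open>e\<^bsub>-k\<^esub> \<circ> I\<^sub>f\<close>, of \<open>\<Pi>\<^sub>N [\<J>(f)](e)\<close> (\<open>fcoef_J_op\<close>).

  That \<open>\<J>(h)(e)\<close> is the derivative of \<open>f \<mapsto> \<L>\<^bsub>\<epsilon>,f\<^esub> h\<close> in the norm of \<open>W\<^bsup>1,1\<^esup>\<close>, before any projection, needs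
  pointwise formulas. The transfer operator of a covering sums over preimages, weighted by the inverse
  derivative (\<open>is_transfer_branch_sum\<close>). Hence \<open>w = \<L>\<^sub>T h\<close> has a representative of class \<open>C\<^sup>2\<close>, and
  \<open>\<L>\<^bsub>\<epsilon>,f+te\<^esub> h\<close> is \<open>(w / I\<^sub>t') \<circ> I\<^sub>t\<^sup>-\<^sup>1\<close> with \<open>I\<^sub>t = I\<^bsub>f+te\<^esub>\<close>; the bound \<open>\<epsilon> \<parallel>g\<parallel> < 1\<close> in the \<open>C\<^sup>1\<close> norm keeps \<open>I\<^sub>t'\<close> away from
  zero. This function and its derivative in the space variable are differentiable in \<open>t\<close> with bounded
  derivatives, so that dominated convergence applies to their difference quotients
  (\<open>L1_diff_quotient\<close>, \<open>W11_derivative\<close>), and the limit is the formula for \<open>\<J>(h)(e)\<close>.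

  Weak derivatives and transferred densities are chosen arbitrarily within their classes. They are
  identified almost everywhere with the explicit functions by \<open>weak_deriv_unique_AE\<close> and
  \<open>transfer_unique_AE\<close>; the former rests on the density of smooth test functions
  (\<open>smooth_test_functions_separate\<close>).
\<close>

section \<open>Integration over the circle\<close>

abbreviation circ :: "real measure" where
  "circ \<equiv> restrict_space lborel {0..1}"

lemma cint_circ: "cint u = integral\<^sup>L circ u"
  by (simp add: cint_def set_lebesgue_integral_def integral_restrict_space)

lemma L1_circ: "u \<in> L1 \<longleftrightarrow> periodic u \<and> integrable circ u"
  by (simp add: L1_def set_integrable_def integrable_restrict_space)

lemma space_circ: "space circ = {0..1}"
  by (simp add: space_restrict_space)

lemma measure_circ: "measure circ {0..1} = 1"
  by (simp add: measure_restrict_space)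

lemma finite_measure_circ: "finite_measure circ"
  by (rule finite_measureI) (simp add: emeasure_restrict_space space_restrict_space)

interpretation circ: finite_measure circ by (rule finite_measure_circ)

lemma AE_circI: "AE x in lborel. P x \<Longrightarrow> AE x in circ. P x"
  by (subst AE_restrict_space_iff) (auto elim: eventually_mono)

lemma measurable_circI: "u \<in> borel_measurable borel \<Longrightarrow> u \<in> borel_measurable circ"
  by (rule measurable_restrict_space1) simp

lemma measurable_circ_continuous:
  fixes u :: "real \<Rightarrow> 'a::{banach, second_countable_topology}"
  shows "continuous_on UNIV u \<Longrightarrow> u \<in> borel_measurable circ"
  by (intro measurable_circI borel_measurable_continuous_onI)

lemma integrable_circ_continuous:
  fixes u :: "real \<Rightarrow> 'a::{banach, second_countable_topology}"
  assumes "continuous_on UNIV u" shows "integrable circ u"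
proof -
  have "set_integrable lborel {0..1} u"
    by (rule borel_integrable_atLeastAtMost') (rule continuous_on_subset[OF assms subset_UNIV])
  then show ?thesis by (simp add: set_integrable_def integrable_restrict_space)
qed

lemma cint_integral:
  fixes u :: "real \<Rightarrow> 'a::euclidean_space"
  assumes "continuous_on UNIV u" shows "cint u = integral {0..1} u"
  unfolding cint_def
  by (rule set_borel_integral_eq_integral, rule borel_integrable_atLeastAtMost')
     (rule continuous_on_subset[OF assms subset_UNIV])

lemma integrable_circ_bounded_scaleR:
  fixes u :: "real \<Rightarrow> 'a::{banach, second_countable_topology}"
  assumes "integrable circ u" "\<phi> \<in> borel_measurable circ" "AE x in circ. \<bar>\<phi> x\<bar> \<le> C"
  shows "integrable circ (\<lambda>x. \<phi> x *\<^sub>R u x)"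
proof (rule Bochner_Integration.integrable_bound)
  show "integrable circ (\<lambda>x. C * norm (u x))" using assms(1) by simp
  show "(\<lambda>x. \<phi> x *\<^sub>R u x) \<in> borel_measurable circ"
    using assms by (intro borel_measurable_scaleR) auto
  show "AE x in circ. norm (\<phi> x *\<^sub>R u x) \<le> norm (C * norm (u x))"
    using assms(3)
  proof eventually_elim
    case (elim x)
    have "\<bar>\<phi> x\<bar> * norm (u x) \<le> C * norm (u x)" using elim by (intro mult_right_mono) auto
    then show ?case by simp
  qed
qed

lemma periodic_shift_int: "periodic u \<Longrightarrow> u (x + of_int n) = u x"
proof -
  assume p: "periodic u"
  have nat: "u (x + real k) = u x" for k x
  proof (induction k)
    case (Suc k)
    have "u (x + real (Suc k)) = u ((x + real k) + 1)" by (simp add: algebra_simps)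
    then show ?case using p Suc by (simp add: periodic_def)
  qed simp
  show "u (x + of_int n) = u x"
  proof (cases "n \<ge> 0")
    case True then show ?thesis using nat[of x "nat n"] by simp
  next
    case False
    then have "u (x + of_int n + real (nat (-n))) = u (x + of_int n)" by (intro nat)
    then show ?thesis using False by simp
  qed
qed

lemma periodic_frac: "periodic u \<Longrightarrow> u (frac x) = u x"
  using periodic_shift_int[of u x "- \<lfloor>x\<rfloor>"] by (simp add: frac_def)

lemma periodic_bounded:
  fixes u :: "real \<Rightarrow> 'a::real_normed_vector"
  assumes "periodic u" "continuous_on UNIV u"
  obtains B where "B > 0" "\<And>x. norm (u x) \<le> B"
proof -
  have "compact (u ` {0..1})"
    by (intro compact_continuous_image continuous_on_subset[OF assms(2)]) auto
  then obtain B where B: "B > 0" "\<forall>z\<in>u ` {0..1}. norm z \<le> B"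
    using bounded_pos compact_imp_bounded by blast
  have "norm (u x) \<le> B" for x
  proof -
    have "frac x \<in> {0..1}" by (simp add: frac_ge_0 less_imp_le frac_lt_1)
    then show ?thesis using B(2) periodic_frac[OF assms(1), of x] by (metis imageI)
  qed
  with B(1) that show ?thesis by blast
qed

lemma L1_continuous:
  fixes u :: "real \<Rightarrow> 'a::{banach, second_countable_topology}"
  shows "periodic u \<Longrightarrow> continuous_on UNIV u \<Longrightarrow> u \<in> L1"
  by (simp add: L1_circ integrable_circ_continuous)

lemma cint_cong_AE:
  fixes u v :: "real \<Rightarrow> 'a::{banach, second_countable_topology}"
  assumes "AE x in circ. u x = v x" "u \<in> borel_measurable circ" "v \<in> borel_measurable circ"
  shows "cint u = cint v"
  unfolding cint_circ using assms by (intro integral_cong_AE) auto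

lemma cint_FTC:
  fixes u :: "real \<Rightarrow> 'a::euclidean_space"
  assumes "\<And>x. (u has_vector_derivative u' x) (at x)" "continuous_on UNIV u'"
  shows "cint u' = u 1 - u 0"
proof -
  have "(u' has_integral u 1 - u 0) {0..1}"
    by (rule fundamental_theorem_of_calculus) (auto intro: has_vector_derivative_at_within assms)
  then show ?thesis using cint_integral[OF assms(2)] by (simp add: integral_unique)
qed

lemma L1_norm_nonneg: "0 \<le> L1_norm u"
  unfolding L1_norm_def cint_circ by simp

lemma sobolev_norm_nonneg: "0 \<le> sobolev_norm k u"
  unfolding sobolev_norm_def by (intro sum_nonneg L1_norm_nonneg)

lemma L1_norm_le_sobolev: "L1_norm u \<le> sobolev_norm k u"
proof -
  have "L1_norm ((weak_deriv ^^ 0) u) \<le> sobolev_norm k u"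
    unfolding sobolev_norm_def by (rule member_le_sum) (auto simp: L1_norm_nonneg)
  then show ?thesis by simp
qed

section \<open>Smooth test functions separate integrable functions\<close>

lemma AE_circ_eq_0I:
  fixes v :: "real \<Rightarrow> 'a::{banach, second_countable_topology}"
  assumes v: "integrable circ v"
    and 0: "\<And>A. A \<in> sets borel \<Longrightarrow> cint (\<lambda>x. indicator A x *\<^sub>R v x) = 0"
  shows "AE x in circ. v x = 0"
proof (rule circ.density_unique_banach[OF v])
  fix A assume "A \<in> sets circ"
  then have "A \<in> sets borel"
    by (auto simp: sets_restrict_space)
  from 0[OF this] show "set_lebesgue_integral circ A v = set_lebesgue_integral circ A (\<lambda>_. 0)"
    by (simp add: cint_circ set_lebesgue_integral_def)
qed simp

lemma AE_circ_not_1: "AE x in circ. x \<noteq> 1"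
  by (rule AE_circI) (rule AE_lborel_singleton)

lemma character_deriv:
  "(character k has_vector_derivative 2 * of_real pi * \<i> * of_int k * character k x) (at x)"
proof -
  let ?c = "2 * of_real pi * \<i> * of_int k :: complex"
  have "((\<lambda>z. exp (?c * z)) has_field_derivative ?c * exp (?c * of_real x)) (at (of_real x))"
    by (auto intro!: derivative_eq_intros)
  from has_vector_derivative_real_field[OF this] show ?thesis
    by (simp add: character_def[abs_def])
qed

lemma continuous_character: "continuous_on A (character k)"
  unfolding character_def[abs_def] by (intro continuous_intros)

lemma character_cis: "character k x = cis (2 * pi * k * x)"
  by (simp add: character_def cis_conv_exp mult_ac)

lemma norm_character: "norm (character k x) = 1"
  by (simp add: character_cis)

lemma character_add: "character k (x + y) = character k x * character k y"
  by (simp add: character_cis cis_mult distrib_left)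

lemma character_shift: "character k (x + of_int n) = character k x"
proof -
  have "character k (of_int n) = cis (2 * pi * of_int (k * n))" by (simp add: character_cis mult_ac)
  also have "\<dots> = 1" by (rule cis_multiple_2pi) simp
  finally show ?thesis by (simp add: character_add)
qed

lemma periodic_character: "periodic (character k)"
  using character_shift[of k _ 1] by (simp add: periodic_def)

abbreviation circle_pt :: "real \<Rightarrow> complex" where "circle_pt \<equiv> character 1"

text \<open>
  Real polynomials in the point of the unit circle are test functions for which smoothness is cheap: by
  induction on the polynomial, the derivative of such a function is of the same form. By
  Stone-Weierstrass they are also dense.
\<close>

lemma polynomial_circle_pt_deriv:
  assumes "real_polynomial_function p"
  shows "\<exists>q. real_polynomial_function q \<and> (\<forall>x. ((\<lambda>x. p (circle_pt x)) has_real_derivative q (circle_pt x)) (at x))"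
  using assms
proof (induction rule: real_polynomial_function.induct)
  case (linear f)
  interpret bounded_linear f by fact
  have "((\<lambda>x. f (circle_pt x)) has_real_derivative f (2 * of_real pi * \<i> * of_int 1 * circle_pt x)) (at x)" for x
    using bounded_linear.has_vector_derivative[OF linear.hyps character_deriv[of 1]]
    by (simp add: has_real_derivative_iff_has_vector_derivative)
  moreover have "bounded_linear (\<lambda>z. f (2 * of_real pi * \<i> * of_int 1 * z))"
    by (intro bounded_linear_compose[OF linear.hyps] bounded_linear_intros)
  ultimately show ?case
    by (intro exI[of _ "\<lambda>z. f (2 * of_real pi * \<i> * of_int 1 * z)"]) (auto intro: real_polynomial_function.intros)
next
  case (const c)
  then show ?case by (intro exI[of _ "\<lambda>_. 0"]) (auto intro: real_polynomial_function.intros)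
next
  case (add f g)
  then obtain f' g' where "real_polynomial_function f'" "real_polynomial_function g'"
    "\<forall>x. ((\<lambda>x. f (circle_pt x)) has_real_derivative f' (circle_pt x)) (at x)"
    "\<forall>x. ((\<lambda>x. g (circle_pt x)) has_real_derivative g' (circle_pt x)) (at x)" by blast
  then show ?case
    by (intro exI[of _ "\<lambda>z. f' z + g' z"]) (auto intro: real_polynomial_function.intros derivative_intros)
next
  case (mult f g)
  then obtain f' g' where "real_polynomial_function f'" "real_polynomial_function g'"
    "\<forall>x. ((\<lambda>x. f (circle_pt x)) has_real_derivative f' (circle_pt x)) (at x)"
    "\<forall>x. ((\<lambda>x. g (circle_pt x)) has_real_derivative g' (circle_pt x)) (at x)" by blast
  with mult.hyps show ?case
    by (intro exI[of _ "\<lambda>z. f' z * g z + g' z * f z"] conjI allI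
        real_polynomial_function.intros(3,4))
       (auto intro!: derivative_eq_intros)
qed

lemma polynomial_circle_pt_smooth:
  assumes "real_polynomial_function p"
  shows "periodic (\<lambda>x. p (circle_pt x))" "Ck k (\<lambda>x. p (circle_pt x))"
proof -
  show "periodic (\<lambda>x. p (circle_pt x))" using character_shift[of 1 _ 1] by (simp add: periodic_def)
  have it: "\<exists>q. real_polynomial_function q \<and> (deriv ^^ j) (\<lambda>x. p (circle_pt x)) = (\<lambda>x. q (circle_pt x))" for j
  proof (induction j)
    case 0 then show ?case using assms by auto
  next
    case (Suc j)
    then obtain q where q: "real_polynomial_function q" "(deriv ^^ j) (\<lambda>x. p (circle_pt x)) = (\<lambda>x. q (circle_pt x))"
      by blast
    from polynomial_circle_pt_deriv[OF q(1)] obtain r where r: "real_polynomial_function r"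
      "\<forall>x. ((\<lambda>x. q (circle_pt x)) has_real_derivative r (circle_pt x)) (at x)" by blast
    then have "deriv (\<lambda>x. q (circle_pt x)) = (\<lambda>x. r (circle_pt x))" by (auto intro!: DERIV_imp_deriv)
    then show ?case using q r by auto
  qed
  have d: "(\<lambda>x. q (circle_pt x)) differentiable (at x)" if "real_polynomial_function q" for q x
    using polynomial_circle_pt_deriv[OF that] real_differentiable_def by blast
  have "continuous_on UNIV (\<lambda>x. q (circle_pt x))" if "real_polynomial_function q" for q
    using d[OF that] by (meson differentiable_imp_continuous_within continuous_at_imp_continuous_on)
  then show "Ck k (\<lambda>x. p (circle_pt x))" unfolding Ck_def using it d by metis
qed

text \<open>
  By Stone-Weierstrass \<open>v\<close> is orthogonal to every continuous function of the point of the unit circle, in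
  the limit to indicators of closed subsets of the circle, hence to indicators of all Borel subsets, since
  closed sets are closed under intersection and generate the Borel sets. Borel subsets of \<open>[0,1)\<close> are of
  this kind, because the angle is a measurable inverse of the parametrisation.
\<close>

lemma smooth_test_functions_separate:
  fixes v :: "real \<Rightarrow> 'a::{banach, second_countable_topology}"
  assumes v: "integrable circ v"
    and 0: "\<And>\<phi>. periodic \<phi> \<Longrightarrow> (\<forall>k. Ck k \<phi>) \<Longrightarrow> cint (\<lambda>x. \<phi> x *\<^sub>R v x) = 0"
  shows "AE x in circ. v x = 0"
proof -
  have pt_meas[measurable]: "circle_pt \<in> borel_measurable circ"
    by (rule measurable_circ_continuous[OF continuous_character])
  have pt_sphere: "circle_pt x \<in> sphere 0 1" for x by (simp add: norm_character)
  have intg: "integrable circ (\<lambda>x. f (circle_pt x) *\<^sub>R v x)"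
    if "f \<in> borel_measurable borel" "\<And>z. z \<in> sphere 0 1 \<Longrightarrow> \<bar>f z\<bar> \<le> C" for f :: "complex \<Rightarrow> real" and C
    using v that pt_sphere
    by (intro integrable_circ_bounded_scaleR[where C=C] measurable_compose[OF pt_meas]) auto
  have cont: "cint (\<lambda>x. f (circle_pt x) *\<^sub>R v x) = 0" if f: "continuous_on UNIV f" for f :: "complex \<Rightarrow> real"
  proof -
    have "norm (cint (\<lambda>x. f (circle_pt x) *\<^sub>R v x)) \<le> e * L1_norm v" if "e > 0" for e
    proof -
      obtain p where p: "real_polynomial_function p" "\<And>z. z \<in> sphere 0 1 \<Longrightarrow> \<bar>f z - p z\<bar> < e"
        using Stone_Weierstrass_real_polynomial_function[OF compact_sphere continuous_on_subset[OF f subset_UNIV] \<open>e > 0\<close>]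
        by metis
      have pc: "continuous_on UNIV p"
        using continuous_real_polymonial_function[OF p(1)] by (simp add: continuous_on_eq_continuous_at)
      have fb: "\<exists>C. \<forall>z\<in>sphere 0 1. \<bar>h z\<bar> \<le> C" if "continuous_on UNIV h" for h :: "complex \<Rightarrow> real"
        using compact_imp_bounded[OF compact_continuous_image[OF continuous_on_subset[OF that subset_UNIV] compact_sphere[of 0 1]]]
        by (force simp: bounded_iff)
      obtain C1 C2 where "\<forall>z\<in>sphere 0 1. \<bar>f z\<bar> \<le> C1" "\<forall>z\<in>sphere 0 1. \<bar>p z\<bar> \<le> C2"
        using fb[OF f] fb[OF pc] by blast
      then have i: "integrable circ (\<lambda>x. f (circle_pt x) *\<^sub>R v x)" "integrable circ (\<lambda>x. p (circle_pt x) *\<^sub>R v x)"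
        using intg f pc borel_measurable_continuous_onI by blast+
      have "cint (\<lambda>x. p (circle_pt x) *\<^sub>R v x) = 0"
        using 0 polynomial_circle_pt_smooth[OF p(1)] by blast
      then have "cint (\<lambda>x. f (circle_pt x) *\<^sub>R v x) = cint (\<lambda>x. (f (circle_pt x) - p (circle_pt x)) *\<^sub>R v x)"
        using i unfolding cint_circ by (simp add: scaleR_left_diff_distrib)
      also have "norm \<dots> \<le> integral\<^sup>L circ (\<lambda>x. e * norm (v x))"
        unfolding cint_circ
      proof (rule order_trans[OF integral_norm_bound], rule integral_mono)
        show "integrable circ (\<lambda>x. norm ((f (circle_pt x) - p (circle_pt x)) *\<^sub>R v x))"
          using i by (intro integrable_norm) (simp add: scaleR_left_diff_distrib)
        show "integrable circ (\<lambda>x. e * norm (v x))" using v by simp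
        fix x show "norm ((f (circle_pt x) - p (circle_pt x)) *\<^sub>R v x) \<le> e * norm (v x)"
          using p(2)[OF pt_sphere, of x] by (auto intro!: mult_right_mono)
      qed
      also have "\<dots> = e * L1_norm v" by (simp add: L1_norm_def cint_circ)
      finally show ?thesis .
    qed
    note * = this
    have "norm (cint (\<lambda>x. f (circle_pt x) *\<^sub>R v x)) \<le> 0"
    proof (rule field_le_epsilon)
      fix d :: real assume d: "d > 0"
      have pos: "L1_norm v + 1 > 0" using L1_norm_nonneg[of v] by simp
      have "d / (L1_norm v + 1) * L1_norm v \<le> d"
        using d pos by (simp add: field_simps)
      then show "norm (cint (\<lambda>x. f (circle_pt x) *\<^sub>R v x)) \<le> 0 + d"
        using *[of "d / (L1_norm v + 1)"] d pos by simp
    qed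
    then show ?thesis by simp
  qed
  have closed: "cint (\<lambda>x. indicator B (circle_pt x) *\<^sub>R v x) = 0" if B: "closed B" for B
  proof (cases "B = {}")
    case False
    \<comment> \<open>continuous functions that decrease to the indicator of \<open>B\<close>\<close>
    define f where "f n z = max 0 (1 - real n * infdist z B)" for n z
    have lim: "(\<lambda>n. integral\<^sup>L circ (\<lambda>x. f n (circle_pt x) *\<^sub>R v x))
      \<longlonglongrightarrow> integral\<^sup>L circ (\<lambda>x. indicator B (circle_pt x) *\<^sub>R v x)"
    proof (rule integral_dominated_convergence[where w="\<lambda>x. norm (v x)"])
      show "(\<lambda>x. indicator B (circle_pt x) *\<^sub>R v x) \<in> borel_measurable circ"
        using v B by (intro borel_measurable_scaleR measurable_compose[OF pt_meas]) auto
      have "f n \<in> borel_measurable borel" for n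
        unfolding f_def by (intro borel_measurable_continuous_onI continuous_intros)
      then show "\<And>n. (\<lambda>x. f n (circle_pt x) *\<^sub>R v x) \<in> borel_measurable circ"
        using v by (intro borel_measurable_scaleR measurable_compose[OF pt_meas]) auto
      show "integrable circ (\<lambda>x. norm (v x))" using v by simp
      have "(\<lambda>n. f n z) \<longlonglongrightarrow> indicator B z" for z
      proof (cases "z \<in> B")
        case True then show ?thesis by (simp add: f_def infdist_zero)
      next
        case False
        then have "infdist z B > 0"
          using B \<open>B \<noteq> {}\<close> by (simp add: infdist_pos_not_in_closed)
        moreover obtain m where "1 / infdist z B < real m" using reals_Archimedean2 by blast
        ultimately have "f n z = 0" if "n \<ge> m" for n
        proof -
          have "1 < real m * infdist z B" using \<open>infdist z B > 0\<close> \<open>1 / infdist z B < real m\<close> by (simp add: field_simps)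
          also have "\<dots> \<le> real n * infdist z B" using that \<open>infdist z B > 0\<close> by simp
          finally show ?thesis by (simp add: f_def)
        qed
        then have "eventually (\<lambda>n. f n z = 0) sequentially" by (auto simp: eventually_sequentially)
        then show ?thesis using False by (simp add: tendsto_eventually)
      qed
      then show "AE x in circ. (\<lambda>n. f n (circle_pt x) *\<^sub>R v x) \<longlonglongrightarrow> indicator B (circle_pt x) *\<^sub>R v x"
        by (intro AE_I2 tendsto_intros)
      have "\<bar>f n z\<bar> \<le> 1" for n z by (auto simp: f_def infdist_nonneg)
      then show "\<And>n. AE x in circ. norm (f n (circle_pt x) *\<^sub>R v x) \<le> norm (v x)"
        by (intro AE_I2) (simp add: mult_left_le_one_le)
    qed
    have "integral\<^sup>L circ (\<lambda>x. f n (circle_pt x) *\<^sub>R v x) = 0" for n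
    proof -
      have "continuous_on UNIV (f n)" unfolding f_def by (intro continuous_intros)
      from cont[OF this] show ?thesis by (simp add: cint_circ)
    qed
    with lim have "(\<lambda>n. 0) \<longlonglongrightarrow> integral\<^sup>L circ (\<lambda>x. indicator B (circle_pt x) *\<^sub>R v x)"
      by (simp only:)
    then show ?thesis by (simp add: cint_circ LIMSEQ_const_iff)
  qed (simp add: cint_circ)
  have borel: "cint (\<lambda>x. indicator B (circle_pt x) *\<^sub>R v x) = 0" if "B \<in> sets borel" for B
  proof -
    have "Int_stable (Collect closed)" "Collect closed \<subseteq> Pow UNIV"
      "B \<in> sigma_sets UNIV (Collect closed)"
      using that by (auto simp: Int_stable_def borel_eq_closed)
    then show ?thesis
    proof (induct B rule: sigma_sets_induct_disjoint)
      case (basic A) then show ?case using closed by simp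
    next
      case empty then show ?case by (simp add: cint_circ)
    next
      case (compl A)
      then have m: "A \<in> sets borel" by (simp add: borel_eq_closed)
      have "integrable circ (\<lambda>x. indicator A (circle_pt x) *\<^sub>R v x)"
        using m by (intro intg[where C=1]) (auto simp: indicator_def)
      moreover have "(\<lambda>x. indicator (UNIV - A) (circle_pt x) *\<^sub>R v x) =
        (\<lambda>x. indicator UNIV (circle_pt x) *\<^sub>R v x - indicator A (circle_pt x) *\<^sub>R v x)"
        by (auto simp: indicator_def)
      ultimately show ?case using compl closed[of UNIV] v by (simp add: cint_circ)
    next
      case (union A)
      then have m: "\<And>i. A i \<in> sets borel" by (auto simp: borel_eq_closed)
      let ?X = "\<lambda>i. (circle_pt -` A i) \<inter> space circ"
      have X: "?X i \<in> sets circ" for i using m measurable_sets[OF pt_meas] by auto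
      have "set_integrable circ (\<Union>i. ?X i) v"
        unfolding set_integrable_def
      proof (rule integrable_circ_bounded_scaleR[OF v])
        show "indicator (\<Union>i. ?X i) \<in> borel_measurable circ"
          using X by (intro borel_measurable_indicator sets.countable_UN) auto
        show "AE x in circ. \<bar>indicator (\<Union>i. ?X i) x :: real\<bar> \<le> 1"
          by (intro AE_I2) (simp add: indicator_def)
      qed
      then have "set_lebesgue_integral circ (\<Union>i. ?X i) v = (\<Sum>i. set_lebesgue_integral circ (?X i) v)"
        using X union(1) by (intro lebesgue_integral_countable_add) (auto simp: disjoint_family_on_def)
      moreover have "set_lebesgue_integral circ (?X i) v = 0" for i
        using union(3)[of i] unfolding set_lebesgue_integral_def cint_circ
        by (subst Bochner_Integration.integral_cong[OF refl, of circ _ "\<lambda>x. indicator (A i) (circle_pt x) *\<^sub>R v x"])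
           (auto simp: indicator_def)
      moreover have "set_lebesgue_integral circ (\<Union>i. ?X i) v = cint (\<lambda>x. indicator (\<Union>i. A i) (circle_pt x) *\<^sub>R v x)"
        unfolding set_lebesgue_integral_def cint_circ
        by (rule Bochner_Integration.integral_cong) (auto simp: indicator_def)
      ultimately show ?case by simp
    qed
  qed
  show ?thesis
  proof (rule AE_circ_eq_0I[OF v])
    fix A :: "real set" assume A: "A \<in> sets borel"
    \<comment> \<open>the inverse of the parametrisation on \<open>[0,1)\<close>; the endpoint \<open>1\<close> is a null set\<close>
    define \<theta> where "\<theta> z = (if z \<in> \<real>\<^sub>\<ge>\<^sub>0 then 0 else Arg2pi z / (2 * pi))" for z
    have "\<theta> \<in> borel_measurable borel"
      unfolding \<theta>_def
      by (intro borel_measurable_continuous_on_if continuous_intros continuous_at_imp_continuous_on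
          ballI continuous_at_Arg2pi) (auto simp: borel_closed)
    then have B: "\<theta> -` A \<in> sets borel" using measurable_sets[of \<theta> borel borel A] A by simp
    have \<theta>: "\<theta> (circle_pt x) = x" if "x \<in> {0..1}" "x \<noteq> 1" for x
    proof (cases "circle_pt x \<in> \<real>\<^sub>\<ge>\<^sub>0")
      case True
      have "Arg2pi (circle_pt x) = 2 * pi * x"
        by (rule Arg2pi_unique[of 1]) (use that in \<open>auto simp: character_def mult_ac\<close>)
      moreover have "Arg2pi (circle_pt x) = 0" using True
        by (metis Arg2pi_eq_0 nonneg_Reals_cmod_eq_Re complex_nonneg_Reals_iff complex_is_Real_iff)
      ultimately show ?thesis using True by (simp add: \<theta>_def)
    next
      case False
      have "Arg2pi (circle_pt x) = 2 * pi * x"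
        by (rule Arg2pi_unique[of 1]) (use that in \<open>auto simp: character_def mult_ac\<close>)
      then show ?thesis using False by (simp add: \<theta>_def)
    qed
    have "cint (\<lambda>x. indicator A x *\<^sub>R v x) = cint (\<lambda>x. indicator (\<theta> -` A) (circle_pt x) *\<^sub>R v x)"
    proof (rule cint_cong_AE)
      show "AE x in circ. indicator A x *\<^sub>R v x = indicator (\<theta> -` A) (circle_pt x) *\<^sub>R v x"
        using AE_circ_not_1 AE_space[of circ]
        by eventually_elim (auto simp: space_circ \<theta> indicator_def)
      show "(\<lambda>x. indicator A x *\<^sub>R v x) \<in> borel_measurable circ"
        using A v by (intro borel_measurable_scaleR measurable_circI[of "indicator A"]) auto
      show "(\<lambda>x. indicator (\<theta> -` A) (circle_pt x) *\<^sub>R v x) \<in> borel_measurable circ"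
        using B v by (intro borel_measurable_scaleR measurable_compose[OF pt_meas]) auto
    qed
    also have "\<dots> = 0" by (rule borel[OF B])
    finally show "cint (\<lambda>x. indicator A x *\<^sub>R v x) = 0" .
  qed
qed

section \<open>Weak derivatives of functions of class C1\<close>

lemma Ck_smoothD:
  assumes "\<forall>k. Ck k \<phi>"
  shows "continuous_on UNIV \<phi>" "continuous_on UNIV (deriv \<phi>)"
    "(\<phi> has_real_derivative deriv \<phi> x) (at x)"
proof -
  show "continuous_on UNIV \<phi>" using assms[rule_format, of 0] by (simp add: Ck_def)
  show "continuous_on UNIV (deriv \<phi>)" using assms[rule_format, of 1] by (simp add: Ck_def)
  have "\<phi> differentiable (at x)" using assms[rule_format, of 1] by (simp add: Ck_def)
  then show "(\<phi> has_real_derivative deriv \<phi> x) (at x)"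
    using DERIV_deriv_iff_real_differentiable by blast
qed

lemma continuous_on_UNIV_deriv:
  "(\<And>x. (u has_vector_derivative u' x) (at x)) \<Longrightarrow> continuous_on UNIV u"
  by (meson continuous_at_imp_continuous_on has_vector_derivative_continuous)

lemma periodic_vector_derivative:
  assumes "periodic u" "\<And>x. (u has_vector_derivative u' x) (at x)"
  shows "periodic u'"
  unfolding periodic_def
proof
  fix x :: real
  have "((\<lambda>x. x + 1) has_vector_derivative 1) (at x)"
    by (auto intro!: derivative_eq_intros)
  from vector_diff_chain_at[OF this assms(2)[of "x + 1"]]
  have "(u has_vector_derivative u' (x + 1)) (at x)"
    using assms(1) by (simp add: o_def periodic_def)
  then show "u' (x + 1) = u' x"
    using assms(2) vector_derivative_unique_at by blast
qed

lemma integrable_circ_continuous_scaleR: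
  fixes u :: "real \<Rightarrow> 'a::{banach, second_countable_topology}"
  assumes "integrable circ u" "continuous_on UNIV \<phi>"
  shows "integrable circ (\<lambda>x. \<phi> x *\<^sub>R u x)"
proof -
  have "compact (\<phi> ` {0..1})"
    by (intro compact_continuous_image continuous_on_subset[OF assms(2)]) auto
  then obtain C where "\<forall>z\<in>\<phi> ` {0..1}. norm z \<le> C"
    using bounded_pos compact_imp_bounded by blast
  then have "AE x in circ. \<bar>\<phi> x\<bar> \<le> C"
    by (intro AE_I2) (auto simp: space_circ)
  then show ?thesis
    by (intro integrable_circ_bounded_scaleR[where C=C] assms measurable_circ_continuous)
qed

lemma weak_deriv_unique_AE:
  assumes "is_weak_deriv u v" "is_weak_deriv u w"
  shows "AE x in circ. v x = w x"
proof -
  have i: "integrable circ v" "integrable circ w"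
    using assms by (auto simp: is_weak_deriv_def L1_circ)
  have "AE x in circ. v x - w x = 0"
  proof (rule smooth_test_functions_separate)
    show "integrable circ (\<lambda>x. v x - w x)" using i by simp
    fix \<phi> :: "real \<Rightarrow> real" assume p: "periodic \<phi>" and c: "\<forall>k. Ck k \<phi>"
    have "cint (\<lambda>x. deriv \<phi> x *\<^sub>R u x) = - cint (\<lambda>x. \<phi> x *\<^sub>R v x)"
      "cint (\<lambda>x. deriv \<phi> x *\<^sub>R u x) = - cint (\<lambda>x. \<phi> x *\<^sub>R w x)"
      using assms p c unfolding is_weak_deriv_def by blast+
    then have "cint (\<lambda>x. \<phi> x *\<^sub>R v x) = cint (\<lambda>x. \<phi> x *\<^sub>R w x)" by simp
    moreover have "integrable circ (\<lambda>x. \<phi> x *\<^sub>R v x)" "integrable circ (\<lambda>x. \<phi> x *\<^sub>R w x)"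
      using i Ck_smoothD(1)[OF c] by (auto intro: integrable_circ_continuous_scaleR)
    ultimately show "cint (\<lambda>x. \<phi> x *\<^sub>R (v x - w x)) = 0"
      by (simp add: cint_circ scaleR_right_diff_distrib)
  qed
  then show ?thesis by simp
qed

text \<open>
  Integration by parts; the boundary terms at \<open>0\<close> and \<open>1\<close> cancel by periodicity.
\<close>

lemma is_weak_deriv_C1:
  fixes u \<u> :: "real \<Rightarrow> 'a::euclidean_space"
  assumes u: "u \<in> L1" and ae: "AE x in circ. u x = \<u> x" and per: "periodic \<u>"
    and d: "\<And>x. (\<u> has_vector_derivative \<u>' x) (at x)" and c: "continuous_on UNIV \<u>'"
  shows "is_weak_deriv u \<u>'"
  unfolding is_weak_deriv_def
proof (intro conjI allI impI)
  show "u \<in> L1" by fact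
  show "\<u>' \<in> L1" by (rule L1_continuous[OF periodic_vector_derivative[OF per d] c])
  fix \<phi> :: "real \<Rightarrow> real" assume "periodic \<phi> \<and> (\<forall>k. Ck k \<phi>)"
  then have p: "periodic \<phi>" and ck: "\<forall>k. Ck k \<phi>" by auto
  note \<phi> = Ck_smoothD[OF ck]
  have cu: "continuous_on UNIV \<u>" by (rule continuous_on_UNIV_deriv[OF d])
  have "cint (\<lambda>x. deriv \<phi> x *\<^sub>R u x) = cint (\<lambda>x. deriv \<phi> x *\<^sub>R \<u> x)"
  proof (rule cint_cong_AE)
    show "AE x in circ. deriv \<phi> x *\<^sub>R u x = deriv \<phi> x *\<^sub>R \<u> x"
      using ae by eventually_elim simp
    show "(\<lambda>x. deriv \<phi> x *\<^sub>R u x) \<in> borel_measurable circ"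
      using u \<phi>(2) by (intro borel_measurable_scaleR measurable_circ_continuous[of "deriv \<phi>"]) (auto simp: L1_circ)
    show "(\<lambda>x. deriv \<phi> x *\<^sub>R \<u> x) \<in> borel_measurable circ"
      using cu \<phi>(2) by (intro borel_measurable_scaleR measurable_circ_continuous)
  qed
  moreover have "cint (\<lambda>x. \<phi> x *\<^sub>R \<u>' x + deriv \<phi> x *\<^sub>R \<u> x) = \<phi> 1 *\<^sub>R \<u> 1 - \<phi> 0 *\<^sub>R \<u> 0"
    by (rule cint_FTC) (auto intro!: has_vector_derivative_scaleR \<phi> d continuous_intros c cu)
  moreover have "\<phi> 1 = \<phi> 0" "\<u> 1 = \<u> 0"
    using p per unfolding periodic_def by (metis add_0)+
  moreover have "integrable circ (\<lambda>x. \<phi> x *\<^sub>R \<u>' x)" "integrable circ (\<lambda>x. deriv \<phi> x *\<^sub>R \<u> x)"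
    using \<phi> c cu by (auto intro!: integrable_circ_continuous continuous_intros)
  ultimately show "cint (\<lambda>x. deriv \<phi> x *\<^sub>R u x) = - cint (\<lambda>x. \<phi> x *\<^sub>R \<u>' x)"
    by (simp add: cint_circ add_eq_0_iff2)
qed

lemma weak_deriv_C1:
  fixes u \<u> :: "real \<Rightarrow> 'a::euclidean_space"
  assumes "u \<in> L1" "AE x in circ. u x = \<u> x" "periodic \<u>"
    "\<And>x. (\<u> has_vector_derivative \<u>' x) (at x)" "continuous_on UNIV \<u>'"
  shows "AE x in circ. weak_deriv u x = \<u>' x" "weak_deriv u \<in> L1"
proof -
  have w: "is_weak_deriv u \<u>'" by (rule is_weak_deriv_C1) (use assms in auto)
  then have w': "is_weak_deriv u (weak_deriv u)" unfolding weak_deriv_def by (rule someI[of "is_weak_deriv u"])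
  then show "weak_deriv u \<in> L1" by (simp add: is_weak_deriv_def)
  show "AE x in circ. weak_deriv u x = \<u>' x" by (rule weak_deriv_unique_AE[OF w' w])
qed

lemma L1_norm_cong_AE:
  assumes "u \<in> L1" "v \<in> L1" "AE x in circ. u x = v x"
  shows "L1_norm u = L1_norm v"
  unfolding L1_norm_def
proof (rule cint_cong_AE)
  show "AE x in circ. norm (u x) = norm (v x)" using assms(3) by eventually_elim simp
qed (use assms in \<open>auto simp: L1_circ intro!: borel_measurable_norm\<close>)

text \<open>
  The norm of \<open>W\<^bsup>1,1\<^esup>\<close>, although defined through a chosen weak derivative, can be computed from any
  representative of class \<open>C\<^sup>1\<close>.
\<close>

lemma sobolev_1_C1:
  fixes u \<u> :: "real \<Rightarrow> 'a::euclidean_space"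
  assumes u: "u \<in> L1" and ae: "AE x in circ. u x = \<u> x" and per: "periodic \<u>"
    and d: "\<And>x. (\<u> has_vector_derivative \<u>' x) (at x)" and c: "continuous_on UNIV \<u>'"
  shows "u \<in> sobolev 1" "sobolev_norm 1 u = L1_norm \<u> + L1_norm \<u>'"
proof -
  have "is_weak_deriv u \<u>'" by (rule is_weak_deriv_C1) (use assms in auto)
  then show "u \<in> sobolev 1" by (auto simp: is_weak_deriv_def)
  have "\<u> \<in> L1" by (rule L1_continuous[OF per continuous_on_UNIV_deriv[OF d]])
  moreover have "\<u>' \<in> L1" by (rule L1_continuous[OF periodic_vector_derivative[OF per d] c])
  moreover have "weak_deriv u \<in> L1" "AE x in circ. weak_deriv u x = \<u>' x"
    using weak_deriv_C1[OF u ae per d c] by auto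
  ultimately have "L1_norm u = L1_norm \<u>" "L1_norm (weak_deriv u) = L1_norm \<u>'"
    using u ae by (auto intro!: L1_norm_cong_AE)
  then show "sobolev_norm 1 u = L1_norm \<u> + L1_norm \<u>'" by (simp add: sobolev_norm_def)
qed

section \<open>Transfer operators: uniqueness and duality\<close>

lemma Linf_bounded_circ:
  assumes "\<phi> \<in> Linf"
  obtains C where "\<phi> \<in> borel_measurable circ" "AE x in circ. \<bar>\<phi> x\<bar> \<le> C"
  using assms unfolding Linf_def by (auto intro: AE_circI measurable_circI)

lemma Linf_continuous:
  assumes "periodic \<phi>" "continuous_on UNIV \<phi>" shows "\<phi> \<in> Linf"
proof -
  obtain B where "\<And>x. norm (\<phi> x) \<le> B" using periodic_bounded[OF assms] by blast
  then have "AE x in lborel. \<bar>\<phi> x\<bar> \<le> B" by (intro AE_I2) simp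
  then show ?thesis using assms by (auto simp: Linf_def borel_measurable_continuous_onI)
qed

text \<open>
  The indicator of a Borel set \<open>A \<subseteq> [0,1)\<close>, extended periodically, belongs to \<open>Linf\<close>.
\<close>

lemma transfer_unique_AE:
  assumes "is_transfer S \<psi> v" "is_transfer S \<psi> w"
  shows "AE x in circ. v x = w x"
proof -
  have i: "integrable circ v" "integrable circ w"
    using assms by (auto simp: is_transfer_def L1_circ)
  have "AE x in circ. v x - w x = 0"
  proof (rule AE_circ_eq_0I)
    show "integrable circ (\<lambda>x. v x - w x)" using i by simp
    fix A :: "real set" assume A: "A \<in> sets borel"
    define \<phi> :: "real \<Rightarrow> real" where "\<phi> x = indicator A (frac x)" for x
    have "\<phi> \<in> borel_measurable borel"
      unfolding \<phi>_def frac_def using A by measurable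
    moreover have "periodic \<phi>" by (simp add: \<phi>_def periodic_def frac_1_eq)
    moreover have "AE x in lborel. \<bar>\<phi> x\<bar> \<le> 1" by (intro AE_I2) (simp add: \<phi>_def indicator_def)
    ultimately have \<phi>: "\<phi> \<in> Linf" by (auto simp: Linf_def)
    from Linf_bounded_circ[OF this] obtain C where
      C: "\<phi> \<in> borel_measurable circ" "AE x in circ. \<bar>\<phi> x\<bar> \<le> C" .
    have "cint (\<lambda>x. indicator A x *\<^sub>R (v x - w x)) = cint (\<lambda>x. \<phi> x *\<^sub>R (v x - w x))"
    proof (rule cint_cong_AE)
      show "AE x in circ. indicator A x *\<^sub>R (v x - w x) = \<phi> x *\<^sub>R (v x - w x)"
        using AE_circ_not_1 AE_space[of circ]
        by eventually_elim (simp add: \<phi>_def space_circ frac_eq)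
    qed (use A i C in \<open>auto intro!: borel_measurable_scaleR borel_measurable_diff measurable_circI[of "indicator A"]\<close>)
    also have "\<dots> = cint (\<lambda>x. \<phi> x *\<^sub>R v x) - cint (\<lambda>x. \<phi> x *\<^sub>R w x)"
      using integrable_circ_bounded_scaleR[OF i(1) C] integrable_circ_bounded_scaleR[OF i(2) C]
      by (simp add: cint_circ scaleR_right_diff_distrib)
    also have "\<dots> = 0" using assms \<phi> by (simp add: is_transfer_def)
    finally show "cint (\<lambda>x. indicator A x *\<^sub>R (v x - w x)) = 0" .
  qed
  then show ?thesis by simp
qed

lemma transfer_is_transfer:
  assumes "is_transfer S \<psi> w"
  shows "is_transfer S \<psi> (transfer S \<psi>)" "AE x in circ. transfer S \<psi> x = w x"
    "transfer S \<psi> \<in> L1"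
proof -
  show *: "is_transfer S \<psi> (transfer S \<psi>)" unfolding transfer_def by (rule someI[of "is_transfer S \<psi>", OF assms])
  show "AE x in circ. transfer S \<psi> x = w x" by (rule transfer_unique_AE[OF * assms])
  show "transfer S \<psi> \<in> L1" using * by (simp add: is_transfer_def)
qed

text \<open>
  The operator is applied to weak derivatives, which are known only almost everywhere.
\<close>

lemma is_transfer_cong_AE:
  assumes "is_transfer S \<psi> w" "AE x in circ. \<psi> x = \<psi>' x"
    "\<psi> \<in> borel_measurable circ" "\<psi>' \<in> borel_measurable circ" "continuous_on UNIV S"
  shows "is_transfer S \<psi>' w"
proof -
  have "cint (\<lambda>x. \<phi> (S x) *\<^sub>R \<psi>' x) = cint (\<lambda>x. \<phi> (S x) *\<^sub>R \<psi> x)" if "\<phi> \<in> Linf" for \<phi>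
  proof (rule cint_cong_AE)
    show "AE x in circ. \<phi> (S x) *\<^sub>R \<psi>' x = \<phi> (S x) *\<^sub>R \<psi> x"
      using assms(2) by eventually_elim simp
    have "(\<lambda>x. \<phi> (S x)) \<in> borel_measurable circ"
      using that measurable_compose[OF measurable_circ_continuous[OF assms(5)], of \<phi> borel]
      by (simp add: Linf_def)
    then show "(\<lambda>x. \<phi> (S x) *\<^sub>R \<psi>' x) \<in> borel_measurable circ"
      "(\<lambda>x. \<phi> (S x) *\<^sub>R \<psi> x) \<in> borel_measurable circ"
      using assms by (auto intro: borel_measurable_scaleR)
  qed
  then show ?thesis using assms(1) unfolding is_transfer_def by auto
qed

lemma cint_of_real:
  fixes u :: "real \<Rightarrow> real"
  shows "cint (cplx u) = of_real (cint u)"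
  by (simp add: cint_circ)

lemma is_transfer_cplx:
  assumes "is_transfer S \<psi> w" shows "is_transfer S (cplx \<psi>) (cplx w)"
proof -
  have "cplx w \<in> L1" using assms by (auto simp: is_transfer_def L1_circ periodic_def)
  moreover have "cint (\<lambda>x. \<phi> (S x) *\<^sub>R cplx \<psi> x) = cint (\<lambda>x. \<phi> x *\<^sub>R cplx w x)" if "\<phi> \<in> Linf" for \<phi>
  proof -
    have "cint (cplx (\<lambda>x. \<phi> (S x) *\<^sub>R \<psi> x)) = cint (cplx (\<lambda>x. \<phi> x *\<^sub>R w x))"
      using assms that unfolding cint_of_real is_transfer_def by simp
    then show ?thesis by (simp add: scaleR_conv_of_real)
  qed
  ultimately show ?thesis by (simp add: is_transfer_def)
qed

text \<open>
  The defining identity tests with real functions; Fourier coefficients require complex ones.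
\<close>

lemma transfer_duality:
  fixes \<psi> w \<kappa> :: "real \<Rightarrow> complex"
  assumes tr: "is_transfer S \<psi> w" and \<psi>: "integrable circ \<psi>" and S: "continuous_on UNIV S"
    and \<kappa>: "periodic \<kappa>" "continuous_on UNIV \<kappa>"
  shows "cint (\<lambda>x. \<kappa> (S x) * \<psi> x) = cint (\<lambda>x. \<kappa> x * w x)"
proof -
  have w: "integrable circ w" using tr by (simp add: is_transfer_def L1_circ)
  have c: "continuous_on UNIV (\<lambda>x. Re (\<kappa> x))" "continuous_on UNIV (\<lambda>x. Im (\<kappa> x))"
    using \<kappa> by (auto intro!: continuous_intros)
  then have L: "(\<lambda>x. Re (\<kappa> x)) \<in> Linf" "(\<lambda>x. Im (\<kappa> x)) \<in> Linf"
    using \<kappa> by (auto intro!: Linf_continuous simp: periodic_def)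
  have cS: "continuous_on UNIV (\<lambda>x. Re (\<kappa> (S x)))" "continuous_on UNIV (\<lambda>x. Im (\<kappa> (S x)))"
    using continuous_on_compose2[OF c(1) S] continuous_on_compose2[OF c(2) S] by auto
  have split: "cint (\<lambda>x. \<beta> x * v x) = cint (\<lambda>x. Re (\<beta> x) *\<^sub>R v x) + \<i> * cint (\<lambda>x. Im (\<beta> x) *\<^sub>R v x)"
    if "continuous_on UNIV (\<lambda>x. Re (\<beta> x))" "continuous_on UNIV (\<lambda>x. Im (\<beta> x))" "integrable circ v"
    for \<beta> v :: "real \<Rightarrow> complex"
  proof -
    have "(\<lambda>x. \<beta> x * v x) = (\<lambda>x. Re (\<beta> x) *\<^sub>R v x + \<i> * (Im (\<beta> x) *\<^sub>R v x))"
      by (simp add: fun_eq_iff complex_eq_iff algebra_simps)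
    moreover have "integrable circ (\<lambda>x. Re (\<beta> x) *\<^sub>R v x)" "integrable circ (\<lambda>x. Im (\<beta> x) *\<^sub>R v x)"
      using that by (auto intro: integrable_circ_continuous_scaleR)
    ultimately show ?thesis
      by (simp only: cint_circ Bochner_Integration.integral_add integrable_mult_right integral_mult_right_zero)
  qed
  have "cint (\<lambda>x. \<phi> (S x) *\<^sub>R \<psi> x) = cint (\<lambda>x. \<phi> x *\<^sub>R w x)" if "\<phi> \<in> Linf" for \<phi>
    using tr that by (simp add: is_transfer_def)
  from this[OF L(1)] this[OF L(2)] show ?thesis
    using split[OF cS \<psi>] split[OF c w] by simp
qed

section \<open>Transfer operators of circle coverings\<close>

lemma set_integrable_Linf_continuous:
  fixes h :: "real \<Rightarrow> 'a::{banach, second_countable_topology}"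
  assumes \<phi>: "\<phi> \<in> Linf" and h: "continuous_on UNIV h"
  shows "set_integrable lborel {a..b} (\<lambda>x. \<phi> x *\<^sub>R h x)"
proof -
  obtain C where C: "AE x in lborel. \<bar>\<phi> x\<bar> \<le> C" and m: "\<phi> \<in> borel_measurable borel"
    using \<phi> by (auto simp: Linf_def)
  have i: "integrable lborel (\<lambda>x. C * norm (indicator {a..b} x *\<^sub>R h x))"
    using borel_integrable_atLeastAtMost'[OF continuous_on_subset[OF h subset_UNIV]]
    unfolding set_integrable_def by (intro integrable_mult_right integrable_norm)
  show ?thesis unfolding set_integrable_def
  proof (rule Bochner_Integration.integrable_bound[OF i])
    show "(\<lambda>x. indicator {a..b} x *\<^sub>R \<phi> x *\<^sub>R h x) \<in> borel_measurable lborel"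
      using m borel_measurable_continuous_onI[OF h] by simp
    show "AE x in lborel. norm (indicator {a..b} x *\<^sub>R \<phi> x *\<^sub>R h x)
        \<le> norm (C * norm (indicator {a..b} x *\<^sub>R h x))"
      using C
    proof eventually_elim
      case (elim x)
      have "\<bar>\<phi> x\<bar> * norm (h x) \<le> C * norm (h x)" using elim by (intro mult_right_mono) auto
      then show ?case by (auto simp: indicator_def)
    qed
  qed
qed

lemma integral_period_shift:
  fixes u :: "real \<Rightarrow> 'a::euclidean_space"
  assumes p: "periodic u" and i: "\<And>a b. u integrable_on {a..b}"
  shows "integral {p..p+1} u = integral {0..1} u"
proof -
  define n r where "n = \<lfloor>p\<rfloor>" and "r = frac p"
  have r: "0 \<le> r" "r < 1" "p = r + of_int n"
    by (auto simp: r_def n_def frac_lt_1) (simp add: frac_def)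
  have "integral {p..p+1} u = integral {p - of_int n..p + 1 - of_int n} (\<lambda>x. u (x + of_int n))"
    by (rule integral_shift_real_ivl[symmetric])
  also have "\<dots> = integral {r..r+1} u" using r(3) by (simp add: periodic_shift_int[OF p])
  also have "\<dots> = integral {r..1} u + integral {1..r+1} u"
    by (rule Henstock_Kurzweil_Integration.integral_combine[symmetric]) (use r i in auto)
  also have "integral {1..r+1} u = integral {1-1..r+1-1} (\<lambda>x. u (x + 1))"
    by (rule integral_shift_real_ivl[symmetric])
  also have "\<dots> = integral {0..r} u" using p by (simp add: periodic_def)
  also have "integral {r..1} u + integral {0..r} u = integral {0..1} u"
    using Henstock_Kurzweil_Integration.integral_combine[of 0 r 1 u] r i by (simp add: add.commute)
  finally show ?thesis .
qed

lemma integral_unit_pieces: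
  fixes u :: "real \<Rightarrow> 'a::euclidean_space"
  assumes i: "\<And>a b. u integrable_on {a..b}"
  shows "integral {p..p + real m} u = integral {p..p+1} (\<lambda>y. \<Sum>j<m. u (y + real j))"
proof (induction m)
  case (Suc m)
  have sh: "(\<lambda>y. u (y + real j)) integrable_on {p..p+1}" for j
    using integrable_shift_real_ivl[OF i[of "p + real j" "p + 1 + real j"], of "real j"] by simp
  have "integral {p..p + real (Suc m)} u
      = integral {p..p + real m} u + integral {p + real m..p + real m + 1} u"
    using Henstock_Kurzweil_Integration.integral_combine[of p "p + real m" "p + real m + 1" u] i
    by (simp add: add_ac)
  also have "integral {p + real m..p + real m + 1} u = integral {p..p+1} (\<lambda>y. u (y + real m))"
    using integral_shift_real_ivl[of "p + real m" "real m" "p + real m + 1" u] by simp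
  also have "integral {p..p + real m} u + integral {p..p+1} (\<lambda>y. u (y + real m))
     = integral {p..p+1} (\<lambda>y. (\<Sum>j<m. u (y + real j)) + u (y + real m))"
    unfolding Suc
    by (rule Henstock_Kurzweil_Integration.integral_add[symmetric])
       (auto intro!: integrable_sum sh)
  finally show ?case by simp
qed simp

text \<open>
  Lifts of coverings of the circle of degree \<open>d\<close>. The lower bound on the derivative makes the lift a
  diffeomorphism of the line, increasing or decreasing according to the sign of \<open>d\<close>.
\<close>

locale circle_cover =
  fixes S S1 :: "real \<Rightarrow> real" and d :: int and c :: real
  assumes lift: "S (x + 1) = S x + of_int d"
    and S_deriv: "(S has_real_derivative S1 x) (at x)"
    and cont_deriv: "continuous_on UNIV S1"
    and c_pos: "0 < c" and c_le: "c \<le> \<bar>S1 x\<bar>"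
begin

lemma deriv_nz [simp]: "S1 x \<noteq> 0"
  using c_pos c_le[of x] by auto

lemma continuous_S: "continuous_on A S"
  using S_deriv by (meson DERIV_isCont continuous_at_imp_continuous_on)

lemma expand: "c * \<bar>x - y\<bar> \<le> \<bar>S x - S y\<bar>"
proof -
  have *: "c * \<bar>x - y\<bar> \<le> \<bar>S x - S y\<bar>" if "x < y" for x y
  proof -
    from MVT2[OF that, of S S1] S_deriv obtain z where "S y - S x = (y - x) * S1 z"
      by blast
    then have "\<bar>S x - S y\<bar> = \<bar>x - y\<bar> * \<bar>S1 z\<bar>" by (metis abs_minus_commute abs_mult)
    then show ?thesis using c_le[of z] by (simp add: mult.commute[of "\<bar>x - y\<bar>"] mult_right_mono)
  qed
  show ?thesis using *[of x y] *[of y x] by (cases x y rule: linorder_cases) (auto simp: abs_minus_commute)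
qed

lemma inj_S: "inj S"
proof (rule injI)
  fix x y assume "S x = S y"
  then have "c * \<bar>x - y\<bar> \<le> 0" using expand[of x y] by simp
  then show "x = y" using c_pos by (simp add: mult_le_0_iff)
qed

lemma d_nz: "d \<noteq> 0"
  using lift[of 0] injD[OF inj_S, of 1 0] by auto

lemma lift_int: "S (x + of_int n) = S x + of_int (n * d)"
proof -
  have "periodic (\<lambda>x. S x - of_int d * x)" using lift by (simp add: periodic_def algebra_simps)
  from periodic_shift_int[OF this, of x n] show ?thesis by (simp add: algebra_simps)
qed

lemma surj_S: "surj S"
proof -
  have "y \<in> range S" for y
  proof -
    define m :: int where "m = \<lceil>\<bar>y - S 0\<bar>\<rceil>"
    have m: "\<bar>y - S 0\<bar> \<le> of_int m" "0 \<le> m" by (auto simp: m_def)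
    have "S (of_int (m * sgn d)) = S 0 + of_int (m * \<bar>d\<bar>)"
      "S (of_int (- m * sgn d)) = S 0 - of_int (m * \<bar>d\<bar>)"
      using lift_int[of 0 "m * sgn d"] lift_int[of 0 "- m * sgn d"]
      by (simp_all add: mult.assoc abs_sgn mult.commute[of d])
    moreover have "of_int m \<le> (of_int (m * \<bar>d\<bar>) :: real)"
    proof -
      have "m * 1 \<le> m * \<bar>d\<bar>" using d_nz m(2) by (intro mult_left_mono) auto
      then show ?thesis by linarith
    qed
    ultimately have "S (of_int (- m * sgn d)) \<le> y" "y \<le> S (of_int (m * sgn d))"
      using m by linarith+
    moreover have "connected (range S)" by (intro connected_continuous_image continuous_S) simp
    ultimately show ?thesis
      by (meson connected_contains_Icc atLeastAtMost_iff rangeI subsetD)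
  qed
  then show ?thesis by auto
qed

definition \<tau> :: "real \<Rightarrow> real" where "\<tau> = inv S"

lemma S_\<tau> [simp]: "S (\<tau> y) = y"
  by (simp add: \<tau>_def surj_f_inv_f[OF surj_S])

lemma \<tau>_S [simp]: "\<tau> (S x) = x"
  by (simp add: \<tau>_def inv_f_f[OF inj_S])

lemma \<tau>_lipschitz: "\<bar>\<tau> y - \<tau> z\<bar> \<le> \<bar>y - z\<bar> / c"
  using expand[of "\<tau> y" "\<tau> z"] c_pos by (simp add: field_simps)

lemma continuous_\<tau>: "continuous_on A \<tau>"
proof (rule lipschitz_on_continuous_on)
  show "(1 / c)-lipschitz_on A \<tau>"
    using \<tau>_lipschitz c_pos by (intro lipschitz_onI) (auto simp: dist_real_def)
qed

lemma deriv_\<tau>: "(\<tau> has_real_derivative 1 / S1 (\<tau> y)) (at y)"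
proof -
  have "isCont \<tau> y" using continuous_\<tau>[of UNIV] by (simp add: continuous_on_eq_continuous_at)
  then have "(\<tau> has_real_derivative inverse (S1 (\<tau> y))) (at y)"
    by (intro DERIV_inverse_function[where f=S and a="y-1" and b="y+1"]) (auto simp: S_deriv)
  then show ?thesis by (simp add: inverse_eq_divide)
qed

lemma \<tau>_eqI: "S x = y \<Longrightarrow> \<tau> y = x" by auto

lemma \<tau>_shift: "\<tau> (y + of_int d) = \<tau> y + 1"
  by (rule \<tau>_eqI) (simp add: lift)

lemma deriv_periodic: "periodic S1"
proof -
  have "((\<lambda>x. S (x + 1)) has_real_derivative S1 (x + 1)) (at x)" for x
    by (rule DERIV_shift[THEN iffD1, OF S_deriv])
  then have "((\<lambda>x. S x + of_int d) has_real_derivative S1 (x + 1)) (at x)" for x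
    by (simp add: lift)
  moreover have "((\<lambda>x. S x + of_int d) has_real_derivative S1 x) (at x)" for x
    using S_deriv by (auto intro!: derivative_eq_intros)
  ultimately show ?thesis unfolding periodic_def using DERIV_unique by blast
qed

text \<open>
  Modulo one, the preimages of \<open>y\<close> under the covering are the points \<open>\<tau> (y + j)\<close> with \<open>j < \<bar>d\<bar>\<close>.
\<close>

definition branch_sum :: "(real \<Rightarrow> 'a::real_normed_vector) \<Rightarrow> real \<Rightarrow> 'a" where
  "branch_sum k y = (\<Sum>j<nat \<bar>d\<bar>. k (\<tau> (y + real j)))"

lemma continuous_branch_sum: "continuous_on UNIV k \<Longrightarrow> continuous_on UNIV (branch_sum k)"
  unfolding branch_sum_def[abs_def]
proof (intro continuous_on_sum)
  fix j assume k: "continuous_on UNIV k"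
  have "continuous_on UNIV (\<lambda>y. \<tau> (y + real j))"
    by (rule continuous_on_compose2[OF continuous_\<tau>[of UNIV]]) (auto intro!: continuous_intros)
  then show "continuous_on UNIV (\<lambda>y. k (\<tau> (y + real j)))"
    by (rule continuous_on_compose2[OF k]) auto
qed

text \<open>
  Moving \<open>y\<close> once around the circle permutes the preimages cyclically: the branch with \<open>j = \<bar>d\<bar>\<close> differs from
  the one with \<open>j = 0\<close> by an integer.
\<close>

lemma periodic_branch_sum:
  assumes "periodic k" shows "periodic (branch_sum k)"
proof -
  have "branch_sum k (y + 1) = branch_sum k y" for y
  proof -
    define F where "F j = k (\<tau> (y + real j))" for j
    have "\<tau> (y + \<bar>of_int d\<bar>) = \<tau> y + of_int (sgn d)"
      using \<tau>_shift[of y] \<tau>_shift[of "y - of_int d"] d_nz by (cases "d > 0") auto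
    then have Fm: "F (nat \<bar>d\<bar>) = F 0"
      by (simp add: F_def periodic_shift_int[OF assms])
    have "(\<Sum>j<nat \<bar>d\<bar>. F (Suc j)) + F 0 = (\<Sum>j<nat \<bar>d\<bar>. F j) + F (nat \<bar>d\<bar>)"
      by (metis sum.lessThan_Suc sum.lessThan_Suc_shift add.commute)
    then have "(\<Sum>j<nat \<bar>d\<bar>. F (Suc j)) = (\<Sum>j<nat \<bar>d\<bar>. F j)" using Fm by simp
    then show ?thesis by (simp add: branch_sum_def F_def add_ac)
  qed
  then show ?thesis by (simp add: periodic_def)
qed

lemma deriv_branch_sum:
  assumes "\<And>x. (k has_vector_derivative k' x) (at x)"
  shows "(branch_sum k has_vector_derivative branch_sum (\<lambda>x. (1 / S1 x) *\<^sub>R k' x) y) (at y)"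
  unfolding branch_sum_def[abs_def]
proof (rule has_vector_derivative_sum)
  fix j
  have "((\<lambda>y. \<tau> (y + real j)) has_vector_derivative 1 / S1 (\<tau> (y + real j))) (at y)"
    using DERIV_shift[THEN iffD1, OF deriv_\<tau>] by (simp add: has_real_derivative_iff_has_vector_derivative)
  from vector_diff_chain_at[OF this assms]
  show "((\<lambda>y. k (\<tau> (y + real j))) has_vector_derivative
      (1 / S1 (\<tau> (y + real j))) *\<^sub>R k' (\<tau> (y + real j))) (at y)" by (simp add: o_def)
qed

text \<open>
  The substitution \<open>x = \<tau> y\<close> turns the period \<open>[0,1]\<close> into an interval of length \<open>\<bar>d\<bar>\<close>. Cut into \<open>\<bar>d\<bar>\<close> unit
  intervals and translated to a single one, the integrand becomes the sum over the preimages.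
\<close>

lemma cint_substitution:
  fixes k :: "real \<Rightarrow> 'a::euclidean_space"
  assumes \<phi>: "\<phi> \<in> Linf" and k: "periodic k" "continuous_on UNIV k"
  shows "cint (\<lambda>x. \<phi> (S x) *\<^sub>R (\<bar>S1 x\<bar> *\<^sub>R k x)) = cint (\<lambda>y. \<phi> y *\<^sub>R branch_sum k y)"
proof -
  define F where "F x = \<phi> (S x) *\<^sub>R (\<bar>S1 x\<bar> *\<^sub>R k x)" for x
  define \<Theta> where "\<Theta> y = \<phi> y *\<^sub>R k (\<tau> y)" for y
  define m where "m = nat \<bar>d\<bar>"
  define p where "p = min (S 0) (S 1)"
  have m: "real m = \<bar>of_int d\<bar>" by (simp add: m_def)
  have k\<tau>: "continuous_on UNIV (\<lambda>y. k (\<tau> y))"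
    by (rule continuous_on_compose2[OF k(2) continuous_\<tau>]) auto
  have \<Theta>i: "set_integrable lborel {a..b} \<Theta>" for a b
    unfolding \<Theta>_def by (rule set_integrable_Linf_continuous[OF \<phi> k\<tau>])
  then have \<Theta>I: "\<Theta> integrable_on {a..b}" for a b
    using set_borel_integral_eq_integral(1) by blast
  have \<Theta>a: "\<Theta> absolutely_integrable_on {a..b}" for a b
    using \<Theta>i[of a b] borel_measurable_integrable[OF \<Theta>i[of a b, unfolded set_integrable_def]]
    by (simp add: set_integrable_def integrable_completion)
  have "closed_segment (S 0) (S 1) = {p..p + real m}"
    using lift[of 0] m by (auto simp: closed_segment_eq_real_ivl p_def min_def)
  moreover have "S ` {0..1} = closed_segment (S 0) (S 1)"
    using continuous_injective_image_segment_1[of 0 1 S] continuous_S inj_S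
    by (auto simp: closed_segment_eq_real_ivl inj_on_def)
  ultimately have img: "\<tau> ` {p..p + real m} = {0..1}"
  proof -
    assume "closed_segment (S 0) (S 1) = {p..p + real m}" "S ` {0..1} = closed_segment (S 0) (S 1)"
    then have "{p..p + real m} = S ` {0..1}" by simp
    then show ?thesis by (simp add: image_image)
  qed
  have "inj_on \<tau> {p..p + real m}" by (metis S_\<tau> inj_onI)
  moreover have "(\<tau> has_field_derivative 1 / S1 (\<tau> y)) (at y within {p..p + real m})" for y
    using deriv_\<tau> has_field_derivative_at_within by blast
  moreover have eq: "\<bar>1 / S1 (\<tau> y)\<bar> *\<^sub>R F (\<tau> y) = \<Theta> y" for y
    by (simp add: F_def \<Theta>_def mult.commute)
  ultimately have F: "F absolutely_integrable_on {0..1}" "integral {0..1} F = integral {p..p + real m} \<Theta>"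
    using has_absolute_integral_change_of_variables_real[of "{p..p + real m}" \<tau> "\<lambda>y. 1 / S1 (\<tau> y)" F
        "integral {p..p + real m} \<Theta>"] \<Theta>a
    unfolding img eq by auto
  have Fm: "F \<in> borel_measurable borel"
    unfolding F_def
  proof (intro borel_measurable_scaleR)
    show "(\<lambda>x. \<phi> (S x)) \<in> borel_measurable borel"
      using measurable_compose[OF borel_measurable_continuous_onI[OF continuous_S], of \<phi> borel] \<phi>
      by (simp add: Linf_def)
  qed (use k cont_deriv in \<open>auto intro!: borel_measurable_continuous_onI continuous_intros\<close>)
  have "set_integrable lborel {0..1} F"
    using F(1) Fm integrable_completion[of "\<lambda>x. indicator {0..1} x *\<^sub>R F x" lborel]
    by (simp add: set_integrable_def)
  then have "cint F = integral {0..1} F"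
    unfolding cint_def by (rule set_borel_integral_eq_integral(2))
  also have "\<dots> = integral {p..p+1} (\<lambda>y. \<Sum>j<m. \<Theta> (y + real j))"
    using F(2) integral_unit_pieces[OF \<Theta>I] by simp
  also have "(\<lambda>y. \<Sum>j<m. \<Theta> (y + real j)) = (\<lambda>y. \<phi> y *\<^sub>R branch_sum k y)"
  proof
    fix y
    have "\<phi> (y + real j) = \<phi> y" for j
      using \<phi> periodic_shift_int[of \<phi> y "int j"] by (simp add: Linf_def)
    then show "(\<Sum>j<m. \<Theta> (y + real j)) = \<phi> y *\<^sub>R branch_sum k y"
      by (simp add: \<Theta>_def branch_sum_def m_def scaleR_sum_right)
  qed
  also have "integral {p..p+1} \<dots> = integral {0..1} (\<lambda>y. \<phi> y *\<^sub>R branch_sum k y)"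
  proof (rule integral_period_shift)
    show "periodic (\<lambda>y. \<phi> y *\<^sub>R branch_sum k y)"
      using \<phi> periodic_branch_sum[OF k(1)] by (simp add: Linf_def periodic_def)
    show "(\<lambda>y. \<phi> y *\<^sub>R branch_sum k y) integrable_on {a..b}" for a b
      using set_borel_integral_eq_integral(1)[OF set_integrable_Linf_continuous[OF \<phi> continuous_branch_sum[OF k(2)]]] .
  qed
  also have "\<dots> = cint (\<lambda>y. \<phi> y *\<^sub>R branch_sum k y)"
    unfolding cint_def
    by (rule set_borel_integral_eq_integral(2)[symmetric])
       (rule set_integrable_Linf_continuous[OF \<phi> continuous_branch_sum[OF k(2)]])
  finally show ?thesis by (simp add: F_def)
qed

lemma is_transfer_branch_sum:
  fixes \<psi> :: "real \<Rightarrow> 'a::euclidean_space"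
  assumes \<psi>: "periodic \<psi>" "continuous_on UNIV \<psi>"
  shows "is_transfer S \<psi> (branch_sum (\<lambda>x. (1 / \<bar>S1 x\<bar>) *\<^sub>R \<psi> x))"
proof -
  have k: "periodic (\<lambda>x. (1 / \<bar>S1 x\<bar>) *\<^sub>R \<psi> x)" "continuous_on UNIV (\<lambda>x. (1 / \<bar>S1 x\<bar>) *\<^sub>R \<psi> x)"
    using \<psi> deriv_periodic cont_deriv by (auto simp: periodic_def intro!: continuous_intros)
  show ?thesis
    unfolding is_transfer_def
    using cint_substitution[OF _ k] L1_continuous[OF periodic_branch_sum[OF k(1)] continuous_branch_sum[OF k(2)]]
    by simp
qed

end

section \<open>Trigonometric polynomials and the Fejer projection\<close>

definition fcoef :: "(real \<Rightarrow> complex) \<Rightarrow> int \<Rightarrow> complex" where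
  "fcoef u k = cint (\<lambda>y. character (- k) y * u y)"

definition trig_poly :: "int set \<Rightarrow> (int \<Rightarrow> complex) \<Rightarrow> real \<Rightarrow> complex" where
  "trig_poly A c x = (\<Sum>k\<in>A. c k * character k x)"

lemma trig_poly_deriv:
  "(trig_poly A c has_vector_derivative
     trig_poly A (\<lambda>k. c k * (2 * of_real pi * \<i> * of_int k)) x) (at x)"
  unfolding trig_poly_def[abs_def]
proof (rule has_vector_derivative_sum)
  fix k
  have "((\<lambda>x. c k * character k x) has_vector_derivative
      c k * (2 * of_real pi * \<i> * of_int k * character k x)) (at x)"
    by (rule has_vector_derivative_mult_right[OF character_deriv])
  then show "((\<lambda>x. c k * character k x) has_vector_derivative
      c k * (2 * of_real pi * \<i> * of_int k) * character k x) (at x)"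
    by (simp add: mult.assoc)
qed

lemma trig_poly_periodic: "periodic (trig_poly A c)"
  using periodic_character by (simp add: periodic_def trig_poly_def)

lemma continuous_trig_poly: "continuous_on X (trig_poly A c)"
  unfolding trig_poly_def[abs_def] by (intro continuous_intros continuous_character)

lemma cint_norm_le:
  fixes u :: "real \<Rightarrow> 'a::{banach, second_countable_topology}"
  assumes "\<And>x. norm (u x) \<le> B" "0 \<le> B"
  shows "norm (cint u) \<le> B"
proof (cases "integrable circ u")
  case True
  have "norm (cint u) \<le> integral\<^sup>L circ (\<lambda>x. norm (u x))"
    unfolding cint_circ by (rule integral_norm_bound)
  also have "\<dots> \<le> integral\<^sup>L circ (\<lambda>x. B)"
    using True assms by (intro integral_mono) auto
  also have "\<dots> = B" by (simp add: space_circ measure_circ)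
  finally show ?thesis .
next
  case False then show ?thesis using assms(2) by (simp add: cint_circ not_integrable_integral_eq)
qed

lemma L1_norm_trig_poly: "L1_norm (trig_poly A c) \<le> (\<Sum>k\<in>A. norm (c k))"
proof -
  have "norm (trig_poly A c x) \<le> (\<Sum>k\<in>A. norm (c k))" for x
    unfolding trig_poly_def
    by (rule order_trans[OF norm_sum]) (simp add: norm_mult norm_character)
  then have "norm (L1_norm (trig_poly A c)) \<le> (\<Sum>k\<in>A. norm (c k))"
    unfolding L1_norm_def by (intro cint_norm_le) (auto intro: sum_nonneg)
  then show ?thesis by simp
qed

lemma sobolev_norm_trig_poly:
  "sobolev_norm 1 (trig_poly A c) \<le> (\<Sum>k\<in>A. (1 + 2 * pi * \<bar>real_of_int k\<bar>) * norm (c k))"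
proof -
  have "sobolev_norm 1 (trig_poly A c) = L1_norm (trig_poly A c) +
      L1_norm (trig_poly A (\<lambda>k. c k * (2 * of_real pi * \<i> * of_int k)))"
    by (rule sobolev_1_C1) (auto intro: L1_continuous trig_poly_periodic continuous_trig_poly trig_poly_deriv)
  also have "\<dots> \<le> (\<Sum>k\<in>A. norm (c k)) + (\<Sum>k\<in>A. norm (c k * (2 * of_real pi * \<i> * of_int k)))"
    by (intro add_mono L1_norm_trig_poly)
  also have "\<dots> = (\<Sum>k\<in>A. (1 + 2 * pi * \<bar>real_of_int k\<bar>) * norm (c k))"
    by (simp add: sum.distrib[symmetric] norm_mult algebra_simps)
  finally show ?thesis .
qed

lemma F_space_trig_poly: "u \<in> F_space N \<longleftrightarrow> (\<exists>c. u = trig_poly {- int N + 1..int N} c)"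
  by (simp add: F_space_def trig_poly_def[abs_def])

lemma F_spaceD:
  assumes "u \<in> F_space N"
  shows "periodic u" "continuous_on UNIV u" "integrable circ u"
proof -
  obtain c where u: "u = trig_poly {- int N + 1..int N} c" using assms F_space_trig_poly by blast
  show "periodic u" "continuous_on UNIV u" unfolding u by (rule trig_poly_periodic continuous_trig_poly)+
  then show "integrable circ u" by (intro integrable_circ_continuous)
qed

lemma F_space_deriv:
  assumes "u \<in> F_space N"
  obtains u' where "u' \<in> F_space N" "\<And>x. (u has_vector_derivative u' x) (at x)"
proof -
  obtain c where u: "u = trig_poly {- int N + 1..int N} c" using assms F_space_trig_poly by blast
  show ?thesis
    by (rule that[of "trig_poly {- int N + 1..int N} (\<lambda>k. c k * (2 * of_real pi * \<i> * of_int k))"])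
       (auto simp: u F_space_trig_poly trig_poly_deriv)
qed

lemma F_realD:
  assumes "f \<in> F_real N"
  shows "cplx f \<in> F_space N" "periodic f" "continuous_on UNIV f" "integrable circ f"
proof -
  show *: "cplx f \<in> F_space N" using assms by (simp add: F_real_def)
  show "periodic f" using F_spaceD(1)[OF *] by (simp add: periodic_def)
  have "continuous_on UNIV (\<lambda>x. Re (cplx f x))" using F_spaceD(2)[OF *] by (rule continuous_on_Re)
  then show "continuous_on UNIV f" by (simp only: Re_complex_of_real)
  then show "integrable circ f" by (rule integrable_circ_continuous)
qed

lemma F_space_add: "u \<in> F_space N \<Longrightarrow> v \<in> F_space N \<Longrightarrow> (\<lambda>x. u x + v x) \<in> F_space N"
proof -
  assume "u \<in> F_space N" "v \<in> F_space N"
  then obtain c c' where "u = trig_poly {- int N + 1..int N} c" "v = trig_poly {- int N + 1..int N} c'"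
    unfolding F_space_trig_poly by blast
  then have "(\<lambda>x. u x + v x) = trig_poly {- int N + 1..int N} (\<lambda>k. c k + c' k)"
    by (simp add: trig_poly_def fun_eq_iff sum.distrib distrib_right)
  then show ?thesis unfolding F_space_trig_poly by blast
qed

lemma F_space_mult: "u \<in> F_space N \<Longrightarrow> (\<lambda>x. a * u x) \<in> F_space N"
proof -
  assume "u \<in> F_space N"
  then obtain c where "u = trig_poly {- int N + 1..int N} c"
    unfolding F_space_trig_poly by blast
  then have "(\<lambda>x. a * u x) = trig_poly {- int N + 1..int N} (\<lambda>k. a * c k)"
    by (simp add: trig_poly_def fun_eq_iff sum_distrib_left mult.assoc)
  then show ?thesis unfolding F_space_trig_poly by blast
qed

abbreviation fejer_weight :: "nat \<Rightarrow> int \<Rightarrow> complex" where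
  "fejer_weight N k \<equiv> of_real (1 - real_of_int \<bar>k\<bar> / real N)"

abbreviation fejer_freqs :: "nat \<Rightarrow> int set" where
  "fejer_freqs N \<equiv> {k. \<bar>k\<bar> \<le> int N - 1}"

lemma norm_fejer_weight: "k \<in> fejer_freqs N \<Longrightarrow> norm (fejer_weight N k) \<le> 1"
proof -
  assume "k \<in> fejer_freqs N"
  then have "real_of_int \<bar>k\<bar> < real_of_int (int N)" unfolding of_int_less_iff by simp
  then have "\<bar>real_of_int k\<bar> / real N \<le> 1" by (auto simp: divide_le_eq_1)
  then show ?thesis unfolding norm_of_real by (simp add: abs_le_iff)
qed

lemma Pi_op_trig_poly:
  assumes "integrable circ u"
  shows "Pi_op N u = trig_poly (fejer_freqs N) (\<lambda>k. fejer_weight N k * fcoef u k)"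
proof
  fix x
  have i: "integrable circ (\<lambda>y. character k y * u y)" for k
  proof (rule Bochner_Integration.integrable_bound[OF assms])
    show "(\<lambda>y. character k y * u y) \<in> borel_measurable circ"
      using assms by (intro borel_measurable_times measurable_circ_continuous[of "character k"] continuous_character) auto
  qed (simp add: norm_mult norm_character)
  have "fejer N (x - y) * u y =
    (\<Sum>k\<in>fejer_freqs N. (fejer_weight N k * character k x) * (character (- k) y * u y))" for y
  proof -
    have "character k (x - y) = character k x * character (- k) y" for k
      by (simp add: character_cis cis_mult algebra_simps)
    then show ?thesis unfolding fejer_def sum_distrib_right by (simp add: mult_ac)
  qed
  then have "Pi_op N u x =
    (\<Sum>k\<in>fejer_freqs N. (fejer_weight N k * character k x) * fcoef u k)"
    unfolding Pi_op_def cint_circ fcoef_def using i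
    by (simp add: Bochner_Integration.integral_sum)
  then show "Pi_op N u x = trig_poly (fejer_freqs N) (\<lambda>k. fejer_weight N k * fcoef u k) x"
    by (simp add: trig_poly_def mult_ac)
qed

lemma trig_poly_in_F_space: "trig_poly (fejer_freqs N) c \<in> F_space N"
proof -
  have "trig_poly (fejer_freqs N) c = trig_poly {- int N + 1..int N} (\<lambda>k. if k \<in> fejer_freqs N then c k else 0)"
    unfolding trig_poly_def fun_eq_iff
    by (intro allI sum.mono_neutral_cong_left) auto
  then show ?thesis unfolding F_space_trig_poly by blast
qed

section \<open>The coupling operator\<close>

lemma Ck2_continuous: "Ck2 k \<gamma> \<Longrightarrow> continuous_on UNIV (\<lambda>(x, y). \<gamma> x y)"
  by (cases k) auto

lemma continuous_on_curried:
  assumes "continuous_on UNIV (\<lambda>(x, y). \<gamma> x y)"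
  shows "continuous_on UNIV (\<gamma> x)"
proof -
  have "continuous_on UNIV (\<lambda>y. case (x, y) of (x, y) \<Rightarrow> \<gamma> x y)"
    by (rule continuous_on_compose2[OF assms]) (auto intro!: continuous_intros)
  then show ?thesis by simp
qed

lemma pd1_deriv:
  assumes "Ck2 (Suc k) \<gamma>" shows "((\<lambda>s. \<gamma> s y) has_real_derivative pd1 \<gamma> x y) (at x)"
  using assms by (simp add: pd1_def DERIV_deriv_iff_real_differentiable)

definition biperiodic :: "(real \<Rightarrow> real \<Rightarrow> real) \<Rightarrow> bool" where
  "biperiodic \<gamma> \<longleftrightarrow> (\<forall>x y. \<gamma> (x + 1) y = \<gamma> x y \<and> \<gamma> x (y + 1) = \<gamma> x y)"

lemma biperiodic_pd1:
  assumes "Ck2 (Suc k) \<gamma>" "biperiodic \<gamma>" shows "biperiodic (pd1 \<gamma>)"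
proof -
  have "pd1 \<gamma> x (y + 1) = pd1 \<gamma> x y" for x y
    using assms(2) by (simp add: pd1_def biperiodic_def)
  moreover have "pd1 \<gamma> (x + 1) y = pd1 \<gamma> x y" for x y
  proof -
    have "((\<lambda>s. \<gamma> (s + 1) y) has_real_derivative pd1 \<gamma> (x + 1) y) (at x)"
      by (rule DERIV_shift[THEN iffD1, OF pd1_deriv[OF assms(1)]])
    then have "((\<lambda>s. \<gamma> s y) has_real_derivative pd1 \<gamma> (x + 1) y) (at x)"
      using assms(2) by (simp add: biperiodic_def)
    then show ?thesis using pd1_deriv[OF assms(1)] DERIV_unique by blast
  qed
  ultimately show ?thesis by (simp add: biperiodic_def)
qed

lemma biperiodic_bounded:
  assumes c: "continuous_on UNIV (\<lambda>(x, y). \<gamma> x y)" and p: "biperiodic \<gamma>"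
  obtains M where "0 < M" "\<And>x y. \<bar>\<gamma> x y\<bar> \<le> M"
proof -
  have "compact ((\<lambda>(x, y). \<gamma> x y) ` ({0..1} \<times> {0..1}))"
    by (intro compact_continuous_image continuous_on_subset[OF c] compact_Times) auto
  then obtain M where M: "M > 0" "\<forall>z\<in>(\<lambda>(x, y). \<gamma> x y) ` ({0..1} \<times> {0..1}). norm z \<le> M"
    using bounded_pos compact_imp_bounded by blast
  have "\<bar>\<gamma> x y\<bar> \<le> M" for x y
  proof -
    have f: "frac t \<in> {0..1}" for t :: real by (simp add: less_imp_le frac_lt_1)
    have "periodic (\<lambda>x. \<gamma> x y)" "periodic (\<gamma> (frac x))"
      using p by (auto simp: periodic_def biperiodic_def)
    then have "\<gamma> (frac x) (frac y) = \<gamma> x y"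
      using periodic_frac[of "\<lambda>x. \<gamma> x y" x] periodic_frac[of "\<gamma> (frac x)" y] by simp
    moreover have "\<bar>\<gamma> (frac x) (frac y)\<bar> \<le> M" using M(2) f by fastforce
    ultimately show ?thesis by simp
  qed
  with M(1) that show ?thesis by blast
qed

lemma G_op_bound:
  fixes e :: "real \<Rightarrow> 'a::{banach, second_countable_topology}"
  assumes M: "\<And>x y. \<bar>\<gamma> x y\<bar> \<le> M" and e: "integrable circ e"
  shows "norm (G_op \<gamma> e x) \<le> M * L1_norm e"
proof -
  have "norm (G_op \<gamma> e x) \<le> integral\<^sup>L circ (\<lambda>y. norm (\<gamma> x y *\<^sub>R e y))"
    unfolding G_op_def cint_circ by (rule integral_norm_bound)
  also have "\<dots> \<le> integral\<^sup>L circ (\<lambda>y. M * norm (e y))"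
  proof (rule integral_mono')
    show "integrable circ (\<lambda>y. M * norm (e y))" using e by simp
    have "0 \<le> M" using M[of 0 0] by linarith
    then show "0 \<le> M * norm (e y)" for y by simp
    show "norm (\<gamma> x y *\<^sub>R e y) \<le> M * norm (e y)" for y
      using M[of x y] by (simp add: mult_right_mono)
  qed
  finally show ?thesis by (simp add: L1_norm_def cint_circ)
qed

lemma G_op_periodic: "biperiodic \<gamma> \<Longrightarrow> periodic (G_op \<gamma> e)"
  by (simp add: periodic_def G_op_def biperiodic_def)

lemma G_op_deriv:
  fixes e :: "real \<Rightarrow> 'a::euclidean_space"
  assumes \<gamma>: "Ck2 (Suc k) \<gamma>" and e: "continuous_on UNIV e"
  shows "(G_op \<gamma> e has_vector_derivative G_op (pd1 \<gamma>) e x) (at x)"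
proof -
  have c: "continuous_on UNIV (\<lambda>(x, y). pd1 \<gamma> x y)" "continuous_on UNIV (\<lambda>(x, y). \<gamma> x y)"
    using Ck2_continuous[of k "pd1 \<gamma>"] Ck2_continuous[OF \<gamma>] \<gamma> by auto
  have eq: "G_op \<beta> e = (\<lambda>x. integral (cbox 0 1) (\<lambda>y. \<beta> x y *\<^sub>R e y))"
    if "continuous_on UNIV (\<lambda>(x, y). \<beta> x y)" for \<beta>
    unfolding G_op_def
    using continuous_on_curried[OF that] e by (auto intro!: cint_integral continuous_intros)
  have "((\<lambda>x. integral (cbox 0 1) (\<lambda>y. \<gamma> x y *\<^sub>R e y)) has_vector_derivative
      integral (cbox 0 1) (\<lambda>y. pd1 \<gamma> x y *\<^sub>R e y)) (at x within UNIV)"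
  proof (rule leibniz_rule_vector_derivative)
    fix x y
    show "((\<lambda>x. \<gamma> x y *\<^sub>R e y) has_vector_derivative pd1 \<gamma> x y *\<^sub>R e y) (at x within UNIV)"
      using has_vector_derivative_scaleR[OF pd1_deriv[OF \<gamma>, of y x] has_vector_derivative_const[of "e y"]] by simp
    show "(\<lambda>y. \<gamma> x y *\<^sub>R e y) integrable_on cbox 0 1"
      by (intro integrable_continuous continuous_intros
          continuous_on_subset[OF continuous_on_curried[OF c(2)]] continuous_on_subset[OF e]) auto
  next
    have "continuous_on UNIV (\<lambda>z::real\<times>real. (case z of (x, y) \<Rightarrow> pd1 \<gamma> x y) *\<^sub>R e (snd z))"
      by (intro continuous_intros c(1) continuous_on_compose2[OF e]) auto
    then show "continuous_on (UNIV \<times> cbox 0 1) (\<lambda>(x, y). pd1 \<gamma> x y *\<^sub>R e y)"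
      by (rule continuous_on_eq[OF continuous_on_subset]) auto
  qed auto
  then show ?thesis using eq[OF c(1)] eq[OF c(2)] by simp
qed

lemma G_op_cplx: "G_op \<gamma> (cplx e) x = of_real (G_op \<gamma> e x)"
  unfolding G_op_def cint_of_real[symmetric] by (simp add: scaleR_conv_of_real)

lemma G_op_add_scaled:
  fixes f e :: "real \<Rightarrow> 'a::euclidean_space"
  assumes \<gamma>: "continuous_on UNIV (\<lambda>(x, y). \<gamma> x y)" and f: "continuous_on UNIV f" and e: "continuous_on UNIV e"
  shows "G_op \<gamma> (\<lambda>x. f x + t *\<^sub>R e x) x = G_op \<gamma> f x + t *\<^sub>R G_op \<gamma> e x"
proof -
  have "integrable circ (\<lambda>y. \<gamma> x y *\<^sub>R f y)" "integrable circ (\<lambda>y. \<gamma> x y *\<^sub>R e y)"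
    using continuous_on_curried[OF \<gamma>] f e by (auto intro!: integrable_circ_continuous continuous_intros)
  moreover have "(\<lambda>y. \<gamma> x y *\<^sub>R (f y + t *\<^sub>R e y)) = (\<lambda>y. \<gamma> x y *\<^sub>R f y + t *\<^sub>R (\<gamma> x y *\<^sub>R e y))"
    by (simp add: scaleR_right_distrib mult.commute)
  ultimately show ?thesis
    by (simp only: G_op_def cint_circ Bochner_Integration.integral_add integrable_scaleR_right integral_scaleR_right)
qed

lemma pd1_le_Ck2_norm:
  assumes g: "Ck2 (Suc k) g" and p: "biperiodic g"
  shows "\<bar>pd1 g x y\<bar> \<le> Ck2_norm 1 g"
proof -
  have c: "continuous_on UNIV (\<lambda>(x, y). pd1 g x y)"
    using g by (intro Ck2_continuous[of k]) simp
  obtain M where "0 < M" and M: "\<And>x y. \<bar>pd1 g x y\<bar> \<le> M"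
    using biperiodic_bounded[OF c biperiodic_pd1[OF g p]] by metis
  have "\<bar>pd1 g x y\<bar> \<le> (SUP (x, y). \<bar>pd1 g x y\<bar>)"
  proof -
    have "bdd_above (range (\<lambda>(x, y). \<bar>pd1 g x y\<bar>))"
    proof (rule bdd_aboveI2)
      fix z :: "real \<times> real"
      show "(case z of (x, y) \<Rightarrow> \<bar>pd1 g x y\<bar>) \<le> M" by (cases z) (simp only: prod.case M)
    qed
    from cSUP_upper[OF UNIV_I this, of "(x, y)"] show ?thesis by (simp only: prod.case)
  qed
  also have "\<dots> = (\<lambda>(a, b). SUP (x, y). \<bar>(pd1 ^^ a) ((pd2 ^^ b) g) x y\<bar>) (1, 0)"
    by (simp only: prod.case funpow.simps One_nat_def o_def id_apply)
  also have "\<dots> \<le> Ck2_norm 1 g"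
    unfolding Ck2_norm_def
  proof (intro Max_ge finite_imageI imageI)
    show "finite {(a, b). a + b \<le> (1::nat)}"
      by (rule finite_subset[of _ "{..1} \<times> {..1}"]) auto
  qed auto
  finally show ?thesis .
qed

lemma L1_norm_density:
  assumes "f \<in> densities" shows "L1_norm f = 1"
proof -
  have "AE x in circ. norm (f x) = f x"
    using assms by (intro AE_circI) (auto simp: densities_def)
  then have "L1_norm f = cint f"
    unfolding L1_norm_def using assms by (intro cint_cong_AE) (auto simp: densities_def L1_circ)
  then show ?thesis using assms by (simp add: densities_def)
qed

lemma L1_norm_add_scaled:
  fixes f e :: "real \<Rightarrow> real"
  assumes "integrable circ f" "integrable circ e"
  shows "L1_norm (\<lambda>x. f x + t * e x) \<le> L1_norm f + \<bar>t\<bar> * L1_norm e"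
proof -
  have "L1_norm (\<lambda>x. f x + t * e x) \<le> integral\<^sup>L circ (\<lambda>x. norm (f x) + \<bar>t\<bar> * norm (e x))"
    unfolding L1_norm_def cint_circ
    by (intro integral_mono) (use assms in \<open>auto simp: abs_mult intro!: order_trans[OF abs_triangle_ineq]\<close>)
  also have "\<dots> = L1_norm f + \<bar>t\<bar> * L1_norm e"
    using assms by (simp add: L1_norm_def cint_circ)
  finally show ?thesis .
qed

section \<open>Coupled maps and the densities they transport\<close>

text \<open>
  A derivative without zeros keeps its sign, so the weight \<open>1 / \<bar>S1\<bar>\<close> is as smooth as \<open>1 / S1\<close>.
\<close>

lemma (in circle_cover) deriv_sign: "\<bar>S1 x\<bar> = sgn (S1 0) * S1 x"
proof -
  have "connected (range S1)" by (intro connected_continuous_image cont_deriv) simp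
  then have no_root: "\<not> (S1 a \<le> 0 \<and> 0 \<le> S1 b)" for a b
    using connected_contains_Icc[of "range S1" "S1 a" "S1 b"] deriv_nz by (metis atLeastAtMost_iff rangeE rangeI subsetD)
  show ?thesis using no_root[of 0 x] no_root[of x 0] by (auto simp: sgn_if abs_if not_le)
qed

lemma circle_cover_comp:
  assumes "circle_cover A A1 a c" "circle_cover B B1 b c'"
  shows "circle_cover (A \<circ> B) (\<lambda>x. A1 (B x) * B1 x) (b * a) (c * c')"
proof -
  interpret A: circle_cover A A1 a c by fact
  interpret B: circle_cover B B1 b c' by fact
  show ?thesis
  proof
    fix x
    show "(A \<circ> B) (x + 1) = (A \<circ> B) x + of_int (b * a)" by (simp add: B.lift A.lift_int)
    show "((A \<circ> B) has_real_derivative A1 (B x) * B1 x) (at x)"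
      unfolding o_def by (rule DERIV_chain2[OF A.S_deriv B.S_deriv])
    show "continuous_on UNIV (\<lambda>x. A1 (B x) * B1 x)"
      by (intro continuous_intros continuous_on_compose2[OF A.cont_deriv B.continuous_S] B.cont_deriv) auto
    show "0 < c * c'" using A.c_pos B.c_pos by simp
    show "c * c' \<le> \<bar>A1 (B x) * B1 x\<bar>"
      unfolding abs_mult using A.c_le[of "B x"] B.c_le[of x] A.c_pos B.c_pos by (intro mult_mono) auto
  qed
qed

locale degree_one_cover = circle_cover S S1 1 c for S S1 c
begin

lemma branch_sum_degree_one: "branch_sum k y = k (\<tau> y)"
  by (simp add: branch_sum_def)

lemma \<tau>_plus_int: "\<tau> (y + of_int n) = \<tau> y + of_int n"
  by (rule \<tau>_eqI) (simp add: lift_int)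

end

text \<open>
  The inverse of a lift of degree one commutes with integer translations. The preimages under \<open>A \<circ> B\<close> are
  therefore the preimages under \<open>B\<close> of one single point, and they share the weight contributed by \<open>A\<close>.
\<close>

lemma branch_sum_comp:
  assumes A: "degree_one_cover A A1 c" and B: "circle_cover B B1 b c'"
  shows "circle_cover.branch_sum (A \<circ> B) b (\<lambda>x. (1 / \<bar>A1 (B x) * B1 x\<bar>) *\<^sub>R \<psi> x) y =
    (1 / \<bar>A1 (circle_cover.\<tau> A y)\<bar>) *\<^sub>R
      circle_cover.branch_sum B b (\<lambda>x. (1 / \<bar>B1 x\<bar>) *\<^sub>R \<psi> x) (circle_cover.\<tau> A y)"
proof -
  interpret A: degree_one_cover A A1 c by fact
  interpret B: circle_cover B B1 b c' by fact
  interpret AB: circle_cover "A \<circ> B" "\<lambda>x. A1 (B x) * B1 x" b "c * c'"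
    using circle_cover_comp[OF A.circle_cover_axioms B] by simp
  have "AB.\<tau> z = B.\<tau> (A.\<tau> z)" for z by (rule AB.\<tau>_eqI) simp
  moreover have "A1 (A.\<tau> y + of_int n) = A1 (A.\<tau> y)" for n
    by (rule periodic_shift_int[OF A.deriv_periodic])
  from this[of "int j" for j] have "A1 (A.\<tau> y + real j) = A1 (A.\<tau> y)" for j by simp
  moreover have "A.\<tau> (y + real j) = A.\<tau> y + real j" for j
    using A.\<tau>_plus_int[of y "int j"] by simp
  ultimately show ?thesis
    by (simp add: AB.branch_sum_def B.branch_sum_def abs_mult scaleR_sum_right)
qed

text \<open>
  Three derivatives of \<open>T\<close> make \<open>\<L>\<^sub>T h\<close> twice continuously differentiable for smooth \<open>h\<close>, and four of \<open>g\<close> make \<open>I\<^sub>f\<close> three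
  times so; this smoothness is used for the derivative in the norm of \<open>W\<^bsup>1,1\<^esup>\<close>.
\<close>

locale coupled_map =
  fixes T T1 T2 T3 :: "real \<Rightarrow> real" and d :: int and \<sigma> :: real
    and g :: "real \<Rightarrow> real \<Rightarrow> real" and \<epsilon> :: real
  assumes T_cover: "circle_cover T T1 d \<sigma>"
    and T1_deriv: "(T1 has_real_derivative T2 x) (at x)"
    and T2_deriv: "(T2 has_real_derivative T3 x) (at x)"
    and T3_cont: "continuous_on UNIV T3"
    and g_C4: "Ck2 4 g" and g_per: "biperiodic g"
    and \<epsilon>_nonneg: "0 \<le> \<epsilon>" and \<epsilon>_lt: "\<epsilon> * Ck2_norm 1 g < 1"
begin

sublocale T: circle_cover T T1 d \<sigma> by (rule T_cover)

lemma g_Ck: "Ck2 (Suc 3) g" "Ck2 (Suc 2) (pd1 g)" "Ck2 (Suc 1) (pd1 (pd1 g))" "Ck2 (Suc 0) (pd1 (pd1 (pd1 g)))"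
  using g_C4 by (simp_all add: eval_nat_numeral)

lemma g_cont: "continuous_on UNIV (\<lambda>(x, y). g x y)" "continuous_on UNIV (\<lambda>(x, y). pd1 g x y)"
  using Ck2_continuous[OF g_Ck(1)] Ck2_continuous[OF g_Ck(2)] .

text \<open>
  For a density \<open>f\<close> this bounds \<open>\<bar>I\<^sub>f' - 1\<bar>\<close>.
\<close>

definition q :: real where "q = \<epsilon> * Ck2_norm 1 g"

lemma q: "0 \<le> q" "q < 1"
proof -
  have "0 \<le> Ck2_norm 1 g" using pd1_le_Ck2_norm[OF g_Ck(1) g_per, of 0 0] by linarith
  then show "0 \<le> q" using \<epsilon>_nonneg by (simp add: q_def)
  show "q < 1" using \<epsilon>_lt by (simp add: q_def)
qed

definition I1 :: "(real \<Rightarrow> real) \<Rightarrow> real \<Rightarrow> real" where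
  "I1 f x = 1 + \<epsilon> * G_op (pd1 g) f x"

text \<open>
  The functions \<open>f\<close> for which the estimate on \<open>I\<^sub>f'\<close> shows that \<open>I\<^sub>f\<close> is a diffeomorphism. Perturbations
  \<open>f + e\<close> of a density are in general not densities, but they are admissible for small \<open>e\<close>.
\<close>

definition admissible :: "(real \<Rightarrow> real) \<Rightarrow> bool" where
  "admissible f \<longleftrightarrow> continuous_on UNIV f \<and> q * L1_norm f < 1"

lemma I1_lower:
  assumes "admissible f" shows "1 - q * L1_norm f \<le> I1 f x"
proof -
  have "norm (G_op (pd1 g) f x) \<le> Ck2_norm 1 g * L1_norm f"
    using assms by (intro G_op_bound pd1_le_Ck2_norm[OF g_Ck(1) g_per] integrable_circ_continuous)
      (simp add: admissible_def)
  then have "\<bar>\<epsilon> * G_op (pd1 g) f x\<bar> \<le> q * L1_norm f"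
    using \<epsilon>_nonneg by (simp add: abs_mult q_def mult.assoc mult_left_mono)
  then show ?thesis unfolding I1_def by linarith
qed

lemma I_cover:
  assumes f: "admissible f"
  shows "degree_one_cover (I_map g \<epsilon> f) (I1 f) (1 - q * L1_norm f)"
proof
  fix x
  have cf: "continuous_on UNIV f" using f by (simp add: admissible_def)
  show "I_map g \<epsilon> f (x + 1) = I_map g \<epsilon> f x + of_int 1"
    using G_op_periodic[OF g_per, of f] by (simp add: I_map_def periodic_def)
  have "(G_op g f has_real_derivative G_op (pd1 g) f x) (at x)"
    using G_op_deriv[OF g_Ck(1) cf] by (simp add: has_real_derivative_iff_has_vector_derivative)
  then show "(I_map g \<epsilon> f has_real_derivative I1 f x) (at x)"
    unfolding I_map_def[abs_def] I1_def by (auto intro!: derivative_eq_intros)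
  show "continuous_on UNIV (I1 f)"
    unfolding I1_def[abs_def]
    by (intro continuous_intros continuous_on_UNIV_deriv[OF G_op_deriv[OF g_Ck(2) cf]])
  show "0 < 1 - q * L1_norm f" using f by (simp add: admissible_def)
  show "1 - q * L1_norm f \<le> \<bar>I1 f x\<bar>" using I1_lower[OF f, of x] by linarith
qed

lemma T_map_cover:
  assumes "admissible f"
  shows "circle_cover (T_map T g \<epsilon> f) (\<lambda>x. I1 f (T x) * T1 x) d ((1 - q * L1_norm f) * \<sigma>)"
  using circle_cover_comp[OF degree_one_cover.axioms[OF I_cover[OF assms]] T_cover]
  by (simp add: T_map_def)

lemma transfer_T_map:
  fixes \<psi> :: "real \<Rightarrow> 'a::euclidean_space"
  assumes f: "admissible f" and \<psi>: "periodic \<psi>" "continuous_on UNIV \<psi>"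
  shows "is_transfer (T_map T g \<epsilon> f) \<psi> (transfer (T_map T g \<epsilon> f) \<psi>)"
  using transfer_is_transfer(1)[OF circle_cover.is_transfer_branch_sum[OF T_map_cover[OF f] \<psi>]] .

lemma fcoef_is_transfer:
  assumes f: "admissible f" and \<psi>: "continuous_on UNIV \<psi>" and tr: "is_transfer (T_map T g \<epsilon> f) \<psi> w"
  shows "fcoef w k = cint (\<lambda>x. character (- k) (T_map T g \<epsilon> f x) * \<psi> x)"
  unfolding fcoef_def
  by (rule transfer_duality[OF tr, symmetric])
     (auto intro: integrable_circ_continuous[OF \<psi>] circle_cover.continuous_S[OF T_map_cover[OF f]]
       periodic_character continuous_character)

lemma self_op_transfer:
  assumes "admissible f" "periodic f"
  shows "is_transfer (T_map T g \<epsilon> f) (cplx f) (cplx (self_op T g \<epsilon> f))"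
  unfolding self_op_def using assms
  by (intro is_transfer_cplx transfer_T_map) (auto simp: admissible_def)

text \<open>
  The representative of \<open>\<L>\<^sub>T h\<close> given by the sum over the preimages.
\<close>

definition pushed :: "(real \<Rightarrow> complex) \<Rightarrow> real \<Rightarrow> complex" where
  "pushed h = T.branch_sum (\<lambda>x. (1 / \<bar>T1 x\<bar>) *\<^sub>R h x)"

lemma is_transfer_pushed:
  "periodic h \<Longrightarrow> continuous_on UNIV h \<Longrightarrow> is_transfer T h (pushed h)"
  unfolding pushed_def by (rule T.is_transfer_branch_sum)

lemma periodic_pushed: "periodic h \<Longrightarrow> periodic (pushed h)"
  unfolding pushed_def using T.deriv_periodic by (intro T.periodic_branch_sum) (simp add: periodic_def)

text \<open>
  The derivative of a sum over preimages is again one: the chain rule through \<open>\<tau>\<close> multiplies the summand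
  by \<open>1 / T'\<close>. This is applied twice.
\<close>

lemma pushed_C2:
  assumes h: "\<And>x. (h has_vector_derivative h1 x) (at x)" "\<And>x. (h1 has_vector_derivative h2 x) (at x)"
    and h2: "continuous_on UNIV h2"
  obtains w1 w2 where "\<And>x. (pushed h has_vector_derivative w1 x) (at x)"
    "\<And>x. (w1 has_vector_derivative w2 x) (at x)" "continuous_on UNIV w2"
proof -
  define s where "s = sgn (T1 0)"
  have s: "1 / \<bar>T1 x\<bar> = s / T1 x" for x
    using T.deriv_sign[of x] T.deriv_nz[of x] by (auto simp: s_def sgn_if)
  define k where "k x = (s / T1 x) *\<^sub>R h1 x + (- s * T2 x / (T1 x)\<^sup>2) *\<^sub>R h x" for x
  define l where "l x = (1 / T1 x) *\<^sub>R k x" for x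
  define l' where "l' x = (s / (T1 x)\<^sup>2) *\<^sub>R h2 x + (- 2 * s * T2 x / (T1 x)^3) *\<^sub>R h1 x
     + ((- s * T2 x / (T1 x)^3) *\<^sub>R h1 x + (- s * T3 x / (T1 x)^3 + 3 * s * (T2 x)\<^sup>2 / (T1 x)^4) *\<^sub>R h x)" for x
  have "((\<lambda>x. (1 / \<bar>T1 x\<bar>) *\<^sub>R h x) has_vector_derivative k x) (at x)" for x
    unfolding s k_def
    by (rule has_vector_derivative_scaleR[OF _ h(1)])
       (auto intro!: derivative_eq_intros T1_deriv simp: power2_eq_square)
  then have 1: "(pushed h has_vector_derivative T.branch_sum l y) (at y)" for y
    unfolding pushed_def l_def by (rule T.deriv_branch_sum)
  have l_eq: "l = (\<lambda>x. (s / (T1 x)\<^sup>2) *\<^sub>R h1 x + (- s * T2 x / (T1 x)^3) *\<^sub>R h x)"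
    by (simp add: fun_eq_iff l_def k_def algebra_simps power2_eq_square power3_eq_cube)
  have "(l has_vector_derivative l' x) (at x)" for x
    unfolding l_eq l'_def
  proof (intro has_vector_derivative_add has_vector_derivative_scaleR h)
    have nz: "T1 x \<noteq> 0" by simp
    show "((\<lambda>x. s / (T1 x)\<^sup>2) has_real_derivative - 2 * s * T2 x / (T1 x)^3) (at x)"
      by (rule derivative_eq_intros T1_deriv refl | simp add: nz)+
         (simp add: nz field_simps eval_nat_numeral)
    show "((\<lambda>x. - s * T2 x / (T1 x)^3) has_real_derivative
        - s * T3 x / (T1 x)^3 + 3 * s * (T2 x)\<^sup>2 / (T1 x)^4) (at x)"
      by (rule derivative_eq_intros T1_deriv T2_deriv refl | simp add: nz)+
         (simp add: nz field_simps eval_nat_numeral)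
  qed
  then have 2: "(T.branch_sum l has_vector_derivative T.branch_sum (\<lambda>x. (1 / T1 x) *\<^sub>R l' x) y) (at y)" for y
    by (rule T.deriv_branch_sum)
  have c: "continuous_on UNIV T1" "continuous_on UNIV T2" "continuous_on UNIV h" "continuous_on UNIV h1"
    using T1_deriv T2_deriv continuous_on_UNIV_deriv h
    by (meson DERIV_isCont continuous_at_imp_continuous_on)+
  have 3: "continuous_on UNIV (T.branch_sum (\<lambda>x. (1 / T1 x) *\<^sub>R l' x))"
    unfolding l'_def
    by (intro T.continuous_branch_sum continuous_intros c h2 T3_cont) auto
  show ?thesis by (rule that[OF 1 2 3])
qed

lemma pushed_F_space_C2:
  assumes "h \<in> F_space N"
  obtains w1 w2 where "\<And>x. (pushed h has_vector_derivative w1 x) (at x)"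
    "\<And>x. (w1 has_vector_derivative w2 x) (at x)" "continuous_on UNIV w2"
proof -
  obtain h1 where h1: "h1 \<in> F_space N" "\<And>x. (h has_vector_derivative h1 x) (at x)"
    using F_space_deriv[OF assms] by metis
  obtain h2 where h2: "h2 \<in> F_space N" "\<And>x. (h1 has_vector_derivative h2 x) (at x)"
    using F_space_deriv[OF h1(1)] by metis
  show ?thesis by (rule pushed_C2[OF h1(2) h2(2) F_spaceD(2)[OF h2(1)]]) (rule that)
qed

end

section \<open>Fourier coefficients of the linear response\<close>

lemma integrable_circ_continuous_mult:
  fixes u \<kappa> :: "real \<Rightarrow> complex"
  assumes u: "integrable circ u" and c: "continuous_on UNIV \<kappa>"
  shows "integrable circ (\<lambda>x. \<kappa> x * u x)"
proof -
  have "compact (\<kappa> ` {0..1})"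
    by (intro compact_continuous_image continuous_on_subset[OF c]) auto
  then obtain C where C: "\<forall>z\<in>\<kappa> ` {0..1}. norm z \<le> C"
    using bounded_pos compact_imp_bounded by blast
  show ?thesis
  proof (rule Bochner_Integration.integrable_bound)
    show "integrable circ (\<lambda>x. C * norm (u x))" using u by simp
    show "(\<lambda>x. \<kappa> x * u x) \<in> borel_measurable circ"
      using u by (intro borel_measurable_times measurable_circ_continuous[OF c]) auto
    show "AE x in circ. norm (\<kappa> x * u x) \<le> norm (C * norm (u x))"
    proof (rule AE_I2)
      fix x assume "x \<in> space circ"
      then have "norm (\<kappa> x) \<le> C" using C by (simp add: space_circ)
      then have "norm (\<kappa> x) * norm (u x) \<le> C * norm (u x)" by (rule mult_right_mono) simp
      then show "norm (\<kappa> x * u x) \<le> norm (C * norm (u x))" by (simp add: norm_mult)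
    qed
  qed
qed

text \<open>
  Taylor's formula of order zero and one for the exponential function on the imaginary axis.
\<close>

lemma character_lipschitz: "norm (character k (x + t) - character k x) \<le> 2 * pi * \<bar>real_of_int k\<bar> * \<bar>t\<bar>"
  and character_taylor: "norm (character k (x + t) - character k x - of_real t * (2 * of_real pi * \<i> * of_int k * character k x))
    \<le> (2 * pi * \<bar>real_of_int k\<bar>)\<^sup>2 * t\<^sup>2"
proof -
  define z where "z = 2 * of_real pi * \<i> * of_int k * of_real t"
  have z: "Re z = 0" "norm z = 2 * pi * \<bar>real_of_int k\<bar> * \<bar>t\<bar>" "character k t = exp z"
    by (auto simp: z_def norm_mult character_def)
  have "norm (exp z - 1) \<le> norm z" using Taylor_exp[of z 0] z(1) by simp
  moreover have "character k (x + t) - character k x = character k x * (exp z - 1)"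
    by (simp add: character_add z algebra_simps)
  ultimately show "norm (character k (x + t) - character k x) \<le> 2 * pi * \<bar>real_of_int k\<bar> * \<bar>t\<bar>"
    by (simp add: norm_mult norm_character z)
  have "norm (exp z - (1 + z)) \<le> (norm z)\<^sup>2"
    using Taylor_exp[of z 1] z(1) by (simp add: numeral_2_eq_2)
  moreover have "character k (x + t) - character k x - of_real t * (2 * of_real pi * \<i> * of_int k * character k x)
      = character k x * (exp z - (1 + z))"
    unfolding character_add z(3) by (simp add: z_def algebra_simps)
  ultimately show "norm (character k (x + t) - character k x - of_real t * (2 * of_real pi * \<i> * of_int k * character k x))
    \<le> (2 * pi * \<bar>real_of_int k\<bar>)\<^sup>2 * t\<^sup>2"
    by (simp add: norm_mult norm_character z power_mult_distrib)
qed

context coupled_map begin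

lemma I1_pos: "admissible f \<Longrightarrow> 0 < I1 f x"
  using I1_lower[of f x] by (simp add: admissible_def)

text \<open>
  For admissible \<open>f\<close>, where \<open>I\<^sub>f' > 0\<close>, this represents the function \<open>\<L>\<^sub>T(h) G(e) / \<bar>I\<^sub>f'\<bar>\<close> whose weak derivative
  enters \<open>\<J>(h)(e)\<close>.
\<close>

definition J_inner :: "(real \<Rightarrow> real) \<Rightarrow> (real \<Rightarrow> complex) \<Rightarrow> (real \<Rightarrow> complex) \<Rightarrow> real \<Rightarrow> complex" where
  "J_inner f h e y = (1 / I1 f y) *\<^sub>R (pushed h y * G_op g e y)"

context
  fixes f :: "real \<Rightarrow> real" and h e v' :: "real \<Rightarrow> complex"
  assumes f: "admissible f"
    and h: "periodic h" "continuous_on UNIV h"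
    and e: "continuous_on UNIV e"
    and v': "\<And>y. (J_inner f h e has_vector_derivative v' y) (at y)" "continuous_on UNIV v'"
begin

interpretation I: degree_one_cover "I_map g \<epsilon> f" "I1 f" "1 - q * L1_norm f"
  by (rule I_cover[OF f])

lemma continuous_G_op: "continuous_on UNIV (G_op g e)"
  by (rule continuous_on_UNIV_deriv[OF G_op_deriv[OF g_Ck(1) e]])

lemma J_inner_periodic: "periodic (J_inner f h e)"
  using periodic_pushed[OF h(1)] G_op_periodic[OF g_per, of e] I.deriv_periodic
  by (simp add: J_inner_def periodic_def)

lemma weak_deriv_J_argument:
  defines "u \<equiv> \<lambda>y. transfer T h y * G_op g e y / of_real \<bar>deriv (I_map g \<epsilon> f) y\<bar>"
  shows "AE x in circ. weak_deriv u x = v' x" "weak_deriv u \<in> L1"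
proof -
  have d: "deriv (I_map g \<epsilon> f) y = I1 f y" for y by (rule DERIV_imp_deriv[OF I.S_deriv])
  have u: "u y = (G_op g e y / of_real (I1 f y)) * transfer T h y" for y
    using I1_pos[OF f, of y] by (simp add: u_def d)
  note tr = transfer_is_transfer[OF is_transfer_pushed[OF h]]
  have "continuous_on UNIV (\<lambda>y. G_op g e y / of_real (I1 f y))"
    by (intro continuous_intros continuous_G_op I.cont_deriv) simp
  then have "integrable circ u"
    unfolding u using tr(3) by (intro integrable_circ_continuous_mult) (auto simp: L1_circ)
  moreover have "periodic u"
    using tr(3) G_op_periodic[OF g_per, of e] I.deriv_periodic by (simp add: u periodic_def L1_circ)
  ultimately have uL: "u \<in> L1" by (simp add: L1_circ)
  have ae: "AE x in circ. u x = J_inner f h e x"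
    using tr(2) by eventually_elim (simp add: u J_inner_def scaleR_conv_of_real field_simps)
  show "AE x in circ. weak_deriv u x = v' x" "weak_deriv u \<in> L1"
    using weak_deriv_C1[OF uL ae J_inner_periodic v'] by auto
qed

lemma J_op_transfer:
  obtains w where "J_op T g \<epsilon> f h e = (\<lambda>x. - of_real \<epsilon> * w x)"
    "is_transfer (I_map g \<epsilon> f) v' w"
proof -
  let ?u = "weak_deriv (\<lambda>y. transfer T h y * G_op g e y / of_real \<bar>deriv (I_map g \<epsilon> f) y\<bar>)"
  have v'p: "periodic v'" by (rule periodic_vector_derivative[OF J_inner_periodic v'(1)])
  have m: "v' \<in> borel_measurable circ" "?u \<in> borel_measurable circ"
    using weak_deriv_J_argument(2) measurable_circ_continuous[OF v'(2)] by (auto simp: L1_circ)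
  have "is_transfer (I_map g \<epsilon> f) ?u (I.branch_sum (\<lambda>x. (1 / \<bar>I1 f x\<bar>) *\<^sub>R v' x))"
    using weak_deriv_J_argument(1) by (intro is_transfer_cong_AE[OF I.is_transfer_branch_sum[OF v'p v'(2)] _ m I.continuous_S]) auto
  from transfer_is_transfer(1)[OF this] have "is_transfer (I_map g \<epsilon> f) ?u (transfer (I_map g \<epsilon> f) ?u)" .
  then have "is_transfer (I_map g \<epsilon> f) v' (transfer (I_map g \<epsilon> f) ?u)"
    using weak_deriv_J_argument(1) by (intro is_transfer_cong_AE[OF _ _ m(2,1) I.continuous_S]) auto
  then show ?thesis by (intro that) (auto simp: J_op_def)
qed

lemma J_op_AE:
  "AE x in circ. J_op T g \<epsilon> f h e x = - of_real \<epsilon> * ((1 / I1 f (I.\<tau> x)) *\<^sub>R v' (I.\<tau> x))"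
  "J_op T g \<epsilon> f h e \<in> L1"
proof -
  obtain w where J: "J_op T g \<epsilon> f h e = (\<lambda>x. - of_real \<epsilon> * w x)"
    and w: "is_transfer (I_map g \<epsilon> f) v' w" by (rule J_op_transfer)
  have v'p: "periodic v'" by (rule periodic_vector_derivative[OF J_inner_periodic v'(1)])
  have "AE x in circ. w x = I.branch_sum (\<lambda>x. (1 / \<bar>I1 f x\<bar>) *\<^sub>R v' x) x"
    by (rule transfer_unique_AE[OF w I.is_transfer_branch_sum[OF v'p v'(2)]])
  then show "AE x in circ. J_op T g \<epsilon> f h e x = - of_real \<epsilon> * ((1 / I1 f (I.\<tau> x)) *\<^sub>R v' (I.\<tau> x))"
    by eventually_elim (simp add: J I.branch_sum_degree_one abs_of_pos[OF I1_pos[OF f]])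
  show "J_op T g \<epsilon> f h e \<in> L1"
    using w unfolding J by (auto simp: is_transfer_def L1_circ periodic_def)
qed

text \<open>
  Duality for \<open>I\<^sub>f\<close> moves the map onto the character and integration by parts removes the weak derivative.
  The factor \<open>I\<^sub>f'\<close> that the chain rule produces cancels the denominator \<open>I\<^sub>f'\<close>, and duality for \<open>T\<close> finally
  replaces \<open>\<L>\<^sub>T h\<close> by \<open>h\<close>.
\<close>

lemma fcoef_J_op:
  "fcoef (J_op T g \<epsilon> f h e) k = of_real \<epsilon> *
     cint (\<lambda>x. 2 * of_real pi * \<i> * of_int (- k) * character (- k) (T_map T g \<epsilon> f x) * G_op g e (T x) * h x)"
proof -
  obtain w where J: "J_op T g \<epsilon> f h e = (\<lambda>x. - of_real \<epsilon> * w x)"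
    and w: "is_transfer (I_map g \<epsilon> f) v' w" by (rule J_op_transfer)
  let ?c = "2 * of_real pi * \<i> * of_int (- k) :: complex"
  let ?v = "J_inner f h e"
  let ?X = "\<lambda>y. character (- k) (I_map g \<epsilon> f y)"
  have X: "(?X has_vector_derivative I1 f y *\<^sub>R (?c * ?X y)) (at y)" for y
    using vector_diff_chain_at[OF I.S_deriv[unfolded has_real_derivative_iff_has_vector_derivative] character_deriv[of "- k"]]
    unfolding o_def .
  have Xc: "continuous_on UNIV ?X" by (rule continuous_on_UNIV_deriv[OF X])
  have vc: "continuous_on UNIV ?v" by (rule continuous_on_UNIV_deriv[OF v'(1)])
  have "((\<lambda>y. ?X y * ?v y) has_vector_derivative ?X y * v' y + I1 f y *\<^sub>R (?c * ?X y) * ?v y) (at y)" for y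
    by (rule has_vector_derivative_mult[OF X v'(1)])
  then have "cint (\<lambda>y. ?X y * v' y + I1 f y *\<^sub>R (?c * ?X y) * ?v y) = ?X 1 * ?v 1 - ?X 0 * ?v 0"
    by (rule cint_FTC) (intro continuous_intros Xc vc v'(2) I.cont_deriv)
  also have "\<dots> = 0"
  proof -
    have "?v (0 + 1) = ?v 0" using J_inner_periodic unfolding periodic_def by blast
    then show ?thesis
      using I.lift[of 0] character_shift[of "-k" "I_map g \<epsilon> f 0" 1] by simp
  qed
  finally have parts: "cint (\<lambda>y. ?X y * v' y) = - cint (\<lambda>y. I1 f y *\<^sub>R (?c * ?X y) * ?v y)"
    using integrable_circ_continuous[of "\<lambda>y. ?X y * v' y"] integrable_circ_continuous[of "\<lambda>y. I1 f y *\<^sub>R (?c * ?X y) * ?v y"]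
    by (simp add: cint_circ continuous_intros Xc vc v'(2) I.cont_deriv add_eq_0_iff2)
  have inner: "I1 f y *\<^sub>R (?c * ?X y) * ?v y = ?c * ?X y * G_op g e y * pushed h y" for y
    using I1_pos[OF f, of y] by (simp add: J_inner_def scaleR_conv_of_real)
  let ?K = "\<lambda>y. ?c * ?X y * G_op g e y"
  have "fcoef (J_op T g \<epsilon> f h e) k = - of_real \<epsilon> * cint (\<lambda>y. character (- k) y * w y)"
    unfolding fcoef_def J cint_circ by (simp add: mult.left_commute)
  also have "cint (\<lambda>y. character (- k) y * w y) = cint (\<lambda>y. ?X y * v' y)"
    by (rule transfer_duality[OF w, symmetric])
       (auto intro: integrable_circ_continuous v' I.continuous_S periodic_character continuous_character)
  also have "\<dots> = - cint (\<lambda>y. ?K y * pushed h y)" unfolding parts inner ..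
  also have "cint (\<lambda>y. ?K y * pushed h y) = cint (\<lambda>x. ?K (T x) * h x)"
  proof (rule transfer_duality[OF is_transfer_pushed[OF h], symmetric])
    show "periodic ?K"
      using character_shift[of "-k" _ 1] I.lift G_op_periodic[OF g_per, of e] by (simp add: periodic_def)
    show "continuous_on UNIV ?K" by (intro continuous_intros Xc continuous_G_op)
  qed (auto intro: integrable_circ_continuous h T.continuous_S)
  finally show ?thesis by (simp add: T_map_def)
qed

end

definition I2 :: "(real \<Rightarrow> real) \<Rightarrow> real \<Rightarrow> real" where
  "I2 f x = \<epsilon> * G_op (pd1 (pd1 g)) f x"

lemma I1_deriv:
  assumes "continuous_on UNIV f" shows "(I1 f has_real_derivative I2 f x) (at x)"
proof -
  have "(G_op (pd1 g) f has_real_derivative G_op (pd1 (pd1 g)) f x) (at x)"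
    using G_op_deriv[OF g_Ck(2) assms] by (simp add: has_real_derivative_iff_has_vector_derivative)
  then show ?thesis unfolding I1_def[abs_def] I2_def by (auto intro!: derivative_eq_intros)
qed

lemma I2_cont: "continuous_on UNIV f \<Longrightarrow> continuous_on UNIV (I2 f)"
  unfolding I2_def[abs_def]
  by (intro continuous_intros continuous_on_UNIV_deriv[OF G_op_deriv[OF g_Ck(3)]])

lemma J_inner_deriv:
  assumes f: "admissible f" and e: "continuous_on UNIV e"
    and w: "\<And>y. (pushed h has_vector_derivative w1 y) (at y)"
  shows "(J_inner f h e has_vector_derivative
    (1 / I1 f y) *\<^sub>R (pushed h y * G_op (pd1 g) e y + w1 y * G_op g e y)
     + (- I2 f y / (I1 f y)\<^sup>2) *\<^sub>R (pushed h y * G_op g e y)) (at y)"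
  unfolding J_inner_def[abs_def]
proof (rule has_vector_derivative_scaleR)
  show "((\<lambda>y. 1 / I1 f y) has_real_derivative - I2 f y / (I1 f y)\<^sup>2) (at y)"
    using I1_pos[OF f, of y] f
    by (auto intro!: derivative_eq_intros I1_deriv simp: power2_eq_square admissible_def)
  show "((\<lambda>y. pushed h y * G_op g e y) has_vector_derivative
      pushed h y * G_op (pd1 g) e y + w1 y * G_op g e y) (at y)"
    by (rule has_vector_derivative_mult[OF w G_op_deriv[OF g_Ck(1) e]])
qed

lemma J_inner_C1:
  assumes f: "admissible f" and e: "continuous_on UNIV e" and h: "h \<in> F_space N"
  obtains v' where "\<And>y. (J_inner f h e has_vector_derivative v' y) (at y)" "continuous_on UNIV v'"
proof -
  obtain w1 w2 where w: "\<And>x. (pushed h has_vector_derivative w1 x) (at x)"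
    "\<And>x. (w1 has_vector_derivative w2 x) (at x)" "continuous_on UNIV w2"
    using pushed_F_space_C2[OF h] by metis
  have cf: "continuous_on UNIV f" using f by (simp add: admissible_def)
  have c: "continuous_on UNIV (I1 f)" using degree_one_cover.axioms[OF I_cover[OF f]] by (rule circle_cover.cont_deriv)
  have nz: "\<forall>x\<in>UNIV. I1 f x \<noteq> 0" using I1_pos[OF f] by (metis less_irrefl)
  show ?thesis
    by (rule that[OF J_inner_deriv[OF f e w(1)]])
       (intro continuous_intros c nz I2_cont cf continuous_on_UNIV_deriv[OF w(1)] continuous_on_UNIV_deriv[OF w(2)]
         continuous_on_UNIV_deriv[OF G_op_deriv[OF g_Ck(1) e]] continuous_on_UNIV_deriv[OF G_op_deriv[OF g_Ck(2) e]];
        use nz in simp)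
qed

lemma J_op_F_space:
  assumes f: "admissible f" and e: "continuous_on UNIV e" and h: "h \<in> F_space N"
  shows "J_op T g \<epsilon> f h e \<in> L1"
    "fcoef (J_op T g \<epsilon> f h e) k = of_real \<epsilon> *
     cint (\<lambda>x. 2 * of_real pi * \<i> * of_int (- k) * character (- k) (T_map T g \<epsilon> f x) * G_op g e (T x) * h x)"
proof -
  obtain v' where v': "\<And>y. (J_inner f h e has_vector_derivative v' y) (at y)" "continuous_on UNIV v'"
    using J_inner_C1[OF assms] by metis
  show "J_op T g \<epsilon> f h e \<in> L1"
    by (rule J_op_AE(2)[OF f F_spaceD(1,2)[OF h] e v'])
  show "fcoef (J_op T g \<epsilon> f h e) k = of_real \<epsilon> *
     cint (\<lambda>x. 2 * of_real pi * \<i> * of_int (- k) * character (- k) (T_map T g \<epsilon> f x) * G_op g e (T x) * h x)"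
    by (rule fcoef_J_op[OF f F_spaceD(1,2)[OF h] e v'])
qed

section \<open>The derivative and the quadratic remainder\<close>

definition D_op :: "nat \<Rightarrow> (real \<Rightarrow> real) \<Rightarrow> (real \<Rightarrow> complex) \<Rightarrow> real \<Rightarrow> complex" where
  "D_op N f e = (\<lambda>x. Pi_op N (transfer (T_map T g \<epsilon> f) e) x + Pi_op N (J_op T g \<epsilon> f (cplx f) e) x)"

text \<open>
  The \<open>k\<close>-th Fourier coefficient of \<open>\<L>\<^bsub>\<epsilon>,f\<^esub> e + \<J>(f)(e)\<close>, written without the choices hidden in these
  functions; in this form it is visibly linear in \<open>e\<close>.
\<close>

definition dcoef :: "(real \<Rightarrow> real) \<Rightarrow> (real \<Rightarrow> complex) \<Rightarrow> int \<Rightarrow> complex" where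
  "dcoef f e k = cint (\<lambda>x. character (- k) (T_map T g \<epsilon> f x) * e x) + of_real \<epsilon> *
     cint (\<lambda>x. 2 * of_real pi * \<i> * of_int (- k) * character (- k) (T_map T g \<epsilon> f x) * G_op g e (T x) * cplx f x)"

lemma D_op_trig_poly:
  assumes f: "admissible f" "f \<in> F_real N" and e: "e \<in> F_space N"
  shows "D_op N f e = trig_poly (fejer_freqs N) (\<lambda>k. fejer_weight N k * dcoef f e k)"
proof -
  note tr = transfer_T_map[OF f(1) F_spaceD(1,2)[OF e]]
  have i: "integrable circ (transfer (T_map T g \<epsilon> f) e)" "integrable circ (J_op T g \<epsilon> f (cplx f) e)"
    using tr J_op_F_space(1)[OF f(1) F_spaceD(2)[OF e] F_realD(1)[OF f(2)]]
    by (auto simp: is_transfer_def L1_circ)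
  show ?thesis
    unfolding D_op_def Pi_op_trig_poly[OF i(1)] Pi_op_trig_poly[OF i(2)] dcoef_def
      fcoef_is_transfer[OF f(1) F_spaceD(2)[OF e] tr] J_op_F_space(2)[OF f(1) F_spaceD(2)[OF e] F_realD(1)[OF f(2)]]
    by (simp add: trig_poly_def fun_eq_iff sum.distrib[symmetric] algebra_simps)
qed

lemma continuous_character_T_map: "admissible f \<Longrightarrow> continuous_on UNIV (\<lambda>x. character k (T_map T g \<epsilon> f x))"
  by (rule continuous_on_compose2[OF continuous_character[of UNIV] circle_cover.continuous_S[OF T_map_cover]]) auto

lemma continuous_G_op_T:
  fixes e :: "real \<Rightarrow> 'a::euclidean_space"
  assumes "continuous_on UNIV e" shows "continuous_on UNIV (\<lambda>x. G_op g e (T x))"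
  by (rule continuous_on_compose2[OF continuous_on_UNIV_deriv[OF G_op_deriv[OF g_Ck(1) assms]] T.continuous_S]) auto

lemma dcoef_linear:
  assumes f: "admissible f" and u: "continuous_on UNIV u" and v: "continuous_on UNIV v"
  shows "dcoef f (\<lambda>x. u x + v x) k = dcoef f u k + dcoef f v k"
    "dcoef f (\<lambda>x. a * u x) k = a * dcoef f u k"
proof -
  have cf: "continuous_on UNIV (\<lambda>x. cplx f x)" using f by (auto simp: admissible_def intro!: continuous_intros)
  let ?A = "\<lambda>e x. character (- k) (T_map T g \<epsilon> f x) * e x"
  let ?B = "\<lambda>e x. 2 * of_real pi * \<i> * of_int (- k) * character (- k) (T_map T g \<epsilon> f x) * G_op g e (T x) * cplx f x"
  have i: "integrable circ (?A e)" "integrable circ (?B e)" if "continuous_on UNIV e" for e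
    by (intro integrable_circ_continuous continuous_intros continuous_character_T_map f cf continuous_G_op_T that)+
  have G: "G_op g (\<lambda>x. u x + v x) x = G_op g u x + G_op g v x" for x
    using G_op_add_scaled[OF g_cont(1) u v, of 1 x] by simp
  have Ga: "G_op g (\<lambda>x. a * u x) x = a * G_op g u x" for x
    unfolding G_op_def cint_circ by (simp add: scaleR_conv_of_real mult.left_commute)
  have "?A (\<lambda>x. u x + v x) = (\<lambda>x. ?A u x + ?A v x)" "?B (\<lambda>x. u x + v x) = (\<lambda>x. ?B u x + ?B v x)"
    by (simp_all add: fun_eq_iff G algebra_simps)
  then show "dcoef f (\<lambda>x. u x + v x) k = dcoef f u k + dcoef f v k"
    unfolding dcoef_def using i[OF u] i[OF v]
    by (simp only: cint_circ Bochner_Integration.integral_add distrib_left) simp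
  have "?A (\<lambda>x. a * u x) = (\<lambda>x. a * ?A u x)" "?B (\<lambda>x. a * u x) = (\<lambda>x. a * ?B u x)"
    by (simp_all add: fun_eq_iff Ga algebra_simps)
  then show "dcoef f (\<lambda>x. a * u x) k = a * dcoef f u k"
    unfolding dcoef_def by (simp only: cint_circ integral_mult_right_zero) (simp add: algebra_simps)
qed

lemma D_op_lin_F:
  assumes f: "admissible f" "f \<in> F_real N"
  shows "D_op N f \<in> lin_F N"
  unfolding lin_F_def mem_Collect_eq
proof (intro conjI ballI allI)
  fix u v :: "real \<Rightarrow> complex" and a :: complex
  assume u: "u \<in> F_space N"
  show "D_op N f u \<in> F_space N"
    unfolding D_op_trig_poly[OF f u] by (rule trig_poly_in_F_space)
  show "D_op N f (\<lambda>x. a * u x) = (\<lambda>x. a * D_op N f u x)"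
    unfolding D_op_trig_poly[OF f u] D_op_trig_poly[OF f F_space_mult[OF u]]
      dcoef_linear(2)[OF f(1) F_spaceD(2)[OF u] F_spaceD(2)[OF u]]
    by (simp add: fun_eq_iff trig_poly_def sum_distrib_left mult_ac)
  assume v: "v \<in> F_space N"
  show "D_op N f (\<lambda>x. u x + v x) = (\<lambda>x. D_op N f u x + D_op N f v x)"
    unfolding D_op_trig_poly[OF f u] D_op_trig_poly[OF f v] D_op_trig_poly[OF f F_space_add[OF u v]]
      dcoef_linear(1)[OF f(1) F_spaceD(2)[OF u] F_spaceD(2)[OF v]]
    by (simp add: fun_eq_iff trig_poly_def sum.distrib[symmetric] algebra_simps)
qed

lemma self_op_N_trig_poly:
  assumes "admissible f" "periodic f"
  shows "self_op_N T g \<epsilon> N f = trig_poly (fejer_freqs N)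
    (\<lambda>k. fejer_weight N k * cint (\<lambda>x. character (- k) (T_map T g \<epsilon> f x) * cplx f x))"
proof -
  note tr = self_op_transfer[OF assms]
  have "integrable circ (cplx (self_op T g \<epsilon> f))" using tr by (simp add: is_transfer_def L1_circ)
  moreover have "continuous_on UNIV (cplx f)" using assms(1) by (auto simp: admissible_def intro!: continuous_intros)
  ultimately show ?thesis
    unfolding self_op_N_def by (simp add: Pi_op_trig_poly fcoef_is_transfer[OF assms(1) _ tr])
qed

text \<open>
  With \<open>\<delta> = \<epsilon> G(e) \<circ> T\<close> and \<open>y = T\<^bsub>\<epsilon>,f\<^esub>\<close>, the difference is the integral of the second-order Taylor remainder of
  the character at \<open>y\<close> times \<open>f\<close>, plus its increment from \<open>y\<close> to \<open>y + \<delta>\<close> times \<open>e\<close>. Both are quadratic, because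
  \<open>\<delta>\<close> is bounded by \<open>\<epsilon> M \<parallel>e\<parallel>\<close>.
\<close>

lemma remainder_coef:
  assumes f: "admissible f" and e: "continuous_on UNIV e" and fe: "admissible (\<lambda>x. f x + e x)"
    and M: "\<And>x y. \<bar>g x y\<bar> \<le> M"
  shows "norm (cint (\<lambda>x. character (- k) (T_map T g \<epsilon> (\<lambda>x. f x + e x) x) * cplx (\<lambda>x. f x + e x) x)
      - cint (\<lambda>x. character (- k) (T_map T g \<epsilon> f x) * cplx f x) - dcoef f (cplx e) k)
    \<le> ((2 * pi * \<bar>real_of_int k\<bar> * \<epsilon> * M)\<^sup>2 * L1_norm f + 2 * pi * \<bar>real_of_int k\<bar> * \<epsilon> * M) * (L1_norm e)\<^sup>2"
proof -
  have cf: "continuous_on UNIV f" using f by (simp add: admissible_def)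
  define \<delta> where "\<delta> x = \<epsilon> * G_op g e (T x)" for x
  define c where "c = 2 * pi * \<bar>real_of_int k\<bar>"
  have M0: "0 \<le> M" using M[of 0 0] by linarith
  have \<delta>: "\<bar>\<delta> x\<bar> \<le> \<epsilon> * M * L1_norm e" for x
    using G_op_bound[of g M e, OF M integrable_circ_continuous[OF e], of "T x"] \<epsilon>_nonneg
    by (simp add: \<delta>_def abs_mult mult.assoc mult_left_mono)
  have Te: "T_map T g \<epsilon> (\<lambda>x. f x + e x) x = T_map T g \<epsilon> f x + \<delta> x" for x
    using G_op_add_scaled[OF g_cont(1) cf e, of 1 "T x"]
    by (simp add: T_map_def I_map_def \<delta>_def algebra_simps)
  let ?y = "\<lambda>x. T_map T g \<epsilon> f x" and ?X = "character (- k)"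
  let ?c = "2 * of_real pi * \<i> * of_int (- k) :: complex"
  let ?p = "\<lambda>x. (?X (?y x + \<delta> x) - ?X (?y x) - of_real (\<delta> x) * (?c * ?X (?y x))) * cplx f x"
  let ?r = "\<lambda>x. (?X (?y x + \<delta> x) - ?X (?y x)) * cplx e x"
  have cc: "continuous_on UNIV (\<lambda>x. ?X (?y x))" "continuous_on UNIV (\<lambda>x. ?X (?y x + \<delta> x))"
    "continuous_on UNIV \<delta>" "continuous_on UNIV (\<lambda>x. G_op g (cplx e) (T x))"
    "continuous_on UNIV (cplx f)" "continuous_on UNIV (cplx e)"
    using continuous_character_T_map[OF f] continuous_character_T_map[OF fe] unfolding Te \<delta>_def[abs_def]
    by (auto intro!: continuous_intros continuous_G_op_T cf e)
  have "integrable circ (\<lambda>x. ?X (?y x + \<delta> x) * cplx (\<lambda>x. f x + e x) x)"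
    "integrable circ (\<lambda>x. ?X (?y x) * cplx f x)" "integrable circ (\<lambda>x. ?X (?y x) * cplx e x)"
    "integrable circ (\<lambda>x. ?c * ?X (?y x) * G_op g (cplx e) (T x) * cplx f x)"
    by (intro integrable_circ_continuous continuous_intros cc cf e)+
  note i = this
  have fun_eq: "(\<lambda>x. ?X (?y x + \<delta> x) * cplx (\<lambda>x. f x + e x) x - ?X (?y x) * cplx f x
      - (?X (?y x) * cplx e x + of_real \<epsilon> * (?c * ?X (?y x) * G_op g (cplx e) (T x) * cplx f x)))
      = (\<lambda>x. ?p x + ?r x)"
    by (simp add: fun_eq_iff \<delta>_def G_op_cplx algebra_simps)
  have pr: "integrable circ ?p" "integrable circ ?r"
    by (intro integrable_circ_continuous continuous_intros cc)+
  have lin: "integral\<^sup>L circ a - integral\<^sup>L circ b - (integral\<^sup>L circ a' + z * integral\<^sup>L circ b')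
      = integral\<^sup>L circ (\<lambda>x. a x - b x - (a' x + z * b' x))"
    if "integrable circ a" "integrable circ b" "integrable circ a'" "integrable circ b'"
    for a b a' b' :: "real \<Rightarrow> complex" and z
    using that by simp
  have eq: "cint (\<lambda>x. ?X (?y x + \<delta> x) * cplx (\<lambda>x. f x + e x) x)
      - cint (\<lambda>x. ?X (?y x) * cplx f x) - dcoef f (cplx e) k = cint (\<lambda>x. ?p x + ?r x)"
    unfolding dcoef_def cint_circ lin[OF i] fun_eq ..
  have "norm (cint (\<lambda>x. ?p x + ?r x)) \<le> integral\<^sup>L circ (\<lambda>x. norm (?p x + ?r x))"
    unfolding cint_circ by (rule integral_norm_bound)
  also have "\<dots> \<le> integral\<^sup>L circ (\<lambda>x. (c * (\<epsilon> * M * L1_norm e))\<^sup>2 * norm (f x) + c * (\<epsilon> * M * L1_norm e) * norm (e x))"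
  proof (rule integral_mono)
    show "integrable circ (\<lambda>x. norm (?p x + ?r x))" using pr by simp
    show "integrable circ (\<lambda>x. (c * (\<epsilon> * M * L1_norm e))\<^sup>2 * norm (f x) + c * (\<epsilon> * M * L1_norm e) * norm (e x))"
      using integrable_circ_continuous[OF cf] integrable_circ_continuous[OF e] by simp
    fix x
    have c0: "0 \<le> c" by (simp add: c_def)
    have "norm (?p x) \<le> (c * \<bar>\<delta> x\<bar>)\<^sup>2 * norm (f x)"
      unfolding norm_mult norm_of_real
      using character_taylor[of "-k" "?y x" "\<delta> x"]
      by (intro mult_mono) (auto simp: c_def power_mult_distrib)
    also have "\<dots> \<le> (c * (\<epsilon> * M * L1_norm e))\<^sup>2 * norm (f x)"
      using \<delta>[of x] c0 by (intro mult_right_mono power_mono mult_left_mono) auto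
    finally have 1: "norm (?p x) \<le> \<dots>" .
    have "norm (?r x) \<le> (c * \<bar>\<delta> x\<bar>) * norm (e x)"
      unfolding norm_mult norm_of_real
      using character_lipschitz[of "-k" "?y x" "\<delta> x"]
      by (intro mult_mono) (auto simp: c_def)
    also have "\<dots> \<le> (c * (\<epsilon> * M * L1_norm e)) * norm (e x)"
      using \<delta>[of x] c0 by (intro mult_right_mono mult_left_mono) auto
    finally have 2: "norm (?r x) \<le> \<dots>" .
    show "norm (?p x + ?r x) \<le> (c * (\<epsilon> * M * L1_norm e))\<^sup>2 * norm (f x) + c * (\<epsilon> * M * L1_norm e) * norm (e x)"
      using norm_triangle_ineq[of "?p x" "?r x"] 1 2 by linarith
  qed
  also have "\<dots> = (c * (\<epsilon> * M * L1_norm e))\<^sup>2 * L1_norm f + c * (\<epsilon> * M * L1_norm e) * L1_norm e"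
    using integrable_circ_continuous[OF cf] integrable_circ_continuous[OF e] by (simp add: L1_norm_def cint_circ)
  also have "\<dots> = ((c * \<epsilon> * M)\<^sup>2 * L1_norm f + c * \<epsilon> * M) * (L1_norm e)\<^sup>2"
    by (simp add: power2_eq_square algebra_simps)
  finally show ?thesis unfolding Te eq c_def .
qed

lemma admissible_perturbed:
  assumes f: "f \<in> densities" "continuous_on UNIV f" and e: "continuous_on UNIV e"
    and small: "\<bar>t\<bar> * L1_norm e < 1 - q"
  shows "admissible (\<lambda>x. f x + t * e x)"
proof -
  have "L1_norm (\<lambda>x. f x + t * e x) \<le> 1 + \<bar>t\<bar> * L1_norm e"
    using L1_norm_add_scaled[OF integrable_circ_continuous[OF f(2)] integrable_circ_continuous[OF e]]
      L1_norm_density[OF f(1)] by metis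
  also have "\<dots> \<le> 2 - q" using small by simp
  finally have "q * L1_norm (\<lambda>x. f x + t * e x) \<le> q * (2 - q)" using q by (intro mult_left_mono) auto
  also have "q * (2 - q) = 1 - (1 - q)\<^sup>2" by (simp add: power2_eq_square algebra_simps)
  also have "\<dots> < 1" using q by simp
  finally show ?thesis using f e by (auto simp: admissible_def intro!: continuous_intros)
qed

lemma admissible_density: "f \<in> densities \<Longrightarrow> continuous_on UNIV f \<Longrightarrow> admissible f"
  using q by (simp add: admissible_def L1_norm_density)

text \<open>
  On trigonometric polynomials of bounded degree, the norm of \<open>W\<^bsup>1,1\<^esup>\<close> is controlled by the coefficients.
\<close>

lemma quadratic_remainder:
  "\<exists>C\<ge>0. \<forall>f\<in>densities \<inter> F_real N. \<forall>e\<in>F_real N. sobolev_norm 1 e < 1 - q \<longrightarrow>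
      self_op_N T g \<epsilon> N (\<lambda>x. f x + e x) \<in> F_space N \<and>
      sobolev_norm 1 (\<lambda>x. self_op_N T g \<epsilon> N (\<lambda>x. f x + e x) x - self_op_N T g \<epsilon> N f x - D_op N f (cplx e) x)
        \<le> C * (sobolev_norm 1 e)\<^sup>2"
proof -
  obtain M where M0: "0 < M" and M: "\<And>x y. \<bar>g x y\<bar> \<le> M"
    using biperiodic_bounded[OF g_cont(1) g_per] by metis
  define C where "C k = (2 * pi * \<bar>real_of_int k\<bar> * \<epsilon> * M)\<^sup>2 + 2 * pi * \<bar>real_of_int k\<bar> * \<epsilon> * M" for k
  define W where "W k = 1 + 2 * pi * \<bar>real_of_int k\<bar>" for k
  have C0: "0 \<le> C k" and W0: "0 \<le> W k" for k
    using \<epsilon>_nonneg M0 by (auto simp: C_def W_def intro!: add_nonneg_nonneg)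
  show ?thesis
  proof (intro exI[of _ "\<Sum>k\<in>fejer_freqs N. W k * C k"] conjI ballI impI)
    show "0 \<le> (\<Sum>k\<in>fejer_freqs N. W k * C k)" using C0 W0 by (intro sum_nonneg) simp
    fix f e :: "real \<Rightarrow> real"
    assume "f \<in> densities \<inter> F_real N" and e: "e \<in> F_real N" and small: "sobolev_norm 1 e < 1 - q"
    then have f: "f \<in> densities" "f \<in> F_real N" by auto
    have L: "L1_norm e \<le> sobolev_norm 1 e" by (rule L1_norm_le_sobolev)
    have af: "admissible f" by (rule admissible_density[OF f(1) F_realD(3)[OF f(2)]])
    have afe: "admissible (\<lambda>x. f x + e x)"
      using admissible_perturbed[OF f(1) F_realD(3)[OF f(2)] F_realD(3)[OF e], of 1] L small by simp
    have per: "periodic (\<lambda>x. f x + e x)"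
      using F_realD(2)[OF f(2)] F_realD(2)[OF e] by (simp add: periodic_def)
    let ?\<Phi> = "\<lambda>f k. cint (\<lambda>x. character (- k) (T_map T g \<epsilon> f x) * cplx f x)"
    let ?r = "\<lambda>k. fejer_weight N k * (?\<Phi> (\<lambda>x. f x + e x) k - ?\<Phi> f k - dcoef f (cplx e) k)"
    have eq: "(\<lambda>x. self_op_N T g \<epsilon> N (\<lambda>x. f x + e x) x - self_op_N T g \<epsilon> N f x - D_op N f (cplx e) x)
        = trig_poly (fejer_freqs N) ?r"
      unfolding self_op_N_trig_poly[OF afe per] self_op_N_trig_poly[OF af F_realD(2)[OF f(2)]]
        D_op_trig_poly[OF af f(2) F_realD(1)[OF e]]
      by (simp only: trig_poly_def fun_eq_iff sum_subtractf[symmetric] left_diff_distrib right_diff_distrib) simp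
    have r: "norm (?r k) \<le> C k * (sobolev_norm 1 e)\<^sup>2" if "k \<in> fejer_freqs N" for k
    proof -
      have "norm (?r k) \<le> 1 * (C k * (L1_norm e)\<^sup>2)"
        unfolding norm_mult
      proof (intro mult_mono norm_fejer_weight that)
        show "norm (?\<Phi> (\<lambda>x. f x + e x) k - ?\<Phi> f k - dcoef f (cplx e) k) \<le> C k * (L1_norm e)\<^sup>2"
          using remainder_coef[OF af F_realD(3)[OF e] afe M, of k] by (simp add: L1_norm_density[OF f(1)] C_def)
      qed auto
      also have "\<dots> \<le> C k * (sobolev_norm 1 e)\<^sup>2"
        using L C0 by (simp add: mult_left_mono power_mono L1_norm_nonneg)
      finally show ?thesis .
    qed
    have "sobolev_norm 1 (trig_poly (fejer_freqs N) ?r) \<le> (\<Sum>k\<in>fejer_freqs N. W k * norm (?r k))"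
      unfolding W_def by (rule sobolev_norm_trig_poly)
    also have "\<dots> \<le> (\<Sum>k\<in>fejer_freqs N. W k * (C k * (sobolev_norm 1 e)\<^sup>2))"
      using r W0 by (intro sum_mono mult_left_mono) auto
    also have "\<dots> = (\<Sum>k\<in>fejer_freqs N. W k * C k) * (sobolev_norm 1 e)\<^sup>2"
      by (simp add: sum_distrib_right mult.assoc)
    finally have bound: "sobolev_norm 1 (trig_poly (fejer_freqs N) ?r) \<le> \<dots>" .
    show "self_op_N T g \<epsilon> N (\<lambda>x. f x + e x) \<in> F_space N"
      unfolding self_op_N_trig_poly[OF afe per] by (rule trig_poly_in_F_space)
    show "sobolev_norm 1 (\<lambda>x. self_op_N T g \<epsilon> N (\<lambda>x. f x + e x) x - self_op_N T g \<epsilon> N f x - D_op N f (cplx e) x)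
        \<le> (\<Sum>k\<in>fejer_freqs N. W k * C k) * (sobolev_norm 1 e)\<^sup>2"
      unfolding eq by (rule bound)
  qed
qed

end

section \<open>Transport of a density along a line of diffeomorphisms\<close>

text \<open>
  By the mean value inequality the bound on \<open>H\<close> dominates the difference quotients, so their pointwise
  convergence implies convergence in \<open>L\<^sup>1\<close>.
\<close>

lemma L1_diff_quotient:
  fixes U H :: "real \<Rightarrow> real \<Rightarrow> 'a::{banach, second_countable_topology}"
  assumes t0: "0 < t0"
    and d: "\<And>t y. \<bar>t\<bar> < t0 \<Longrightarrow> ((\<lambda>s. U s y) has_vector_derivative H t y) (at t)"
    and bd: "\<And>t y. \<bar>t\<bar> < t0 \<Longrightarrow> y \<in> {0..1} \<Longrightarrow> norm (H t y) \<le> M"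
    and cU: "\<And>t. \<bar>t\<bar> < t0 \<Longrightarrow> continuous_on UNIV (U t)" and cH: "continuous_on UNIV (H 0)"
  shows "((\<lambda>t. L1_norm (\<lambda>y. (U t y - U 0 y) /\<^sub>R t - H 0 y)) \<longlongrightarrow> 0) (at 0)"
proof -
  let ?S = "{- t0<..<t0}"
  let ?R = "\<lambda>t y. (U t y - U 0 y) /\<^sub>R t - H 0 y"
  have at: "at 0 = at 0 within ?S" using t0 by (intro at_within_open[symmetric]) auto
  have eqR: "norm (?R t y) = norm (U t y - U 0 y - t *\<^sub>R H 0 y) / \<bar>t\<bar>" if "t \<noteq> 0" for t y
  proof -
    have "?R t y = (1 / t) *\<^sub>R (U t y - U 0 y - t *\<^sub>R H 0 y)"
      using that by (simp add: scaleR_right_diff_distrib divide_inverse)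
    then show ?thesis by simp
  qed
  show ?thesis unfolding at tendsto_at_iff_sequentially
  proof (intro allI impI)
    fix X :: "nat \<Rightarrow> real" assume X: "\<forall>i. X i \<in> ?S - {0}" "X \<longlonglongrightarrow> 0"
    have Xi: "X i \<noteq> 0" "\<bar>X i\<bar> < t0" for i using X(1)[rule_format, of i] by auto
    have "(\<lambda>i. integral\<^sup>L circ (\<lambda>y. norm (?R (X i) y))) \<longlonglongrightarrow> integral\<^sup>L circ (\<lambda>y. 0::real)"
    proof (rule integral_dominated_convergence[where w="\<lambda>y. 2 * M"])
      show "\<And>i. (\<lambda>y. norm (?R (X i) y)) \<in> borel_measurable circ"
        using cU[of 0] cU[OF Xi(2)] cH t0
        by (intro measurable_circ_continuous continuous_intros) auto
      show "integrable circ (\<lambda>y. 2 * M)" by (rule integrable_circ_continuous) auto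
      show "AE y in circ. (\<lambda>i. norm (?R (X i) y)) \<longlonglongrightarrow> 0"
      proof (rule AE_I2)
        fix y
        have "((\<lambda>h. norm (U (0 + h) y - U 0 y - h *\<^sub>R H 0 y) / norm h) \<longlongrightarrow> 0) (at 0)"
          using d[of 0 y] t0 unfolding has_vector_derivative_def has_derivative_at by simp
        then have "(\<lambda>i. norm (U (0 + X i) y - U 0 y - X i *\<^sub>R H 0 y) / norm (X i)) \<longlonglongrightarrow> 0"
          using X Xi unfolding tendsto_at_iff_sequentially o_def by auto
        then show "(\<lambda>i. norm (?R (X i) y)) \<longlonglongrightarrow> 0" using Xi by (simp add: eqR)
      qed
      fix i
      show "AE y in circ. norm (norm (?R (X i) y)) \<le> 2 * M"
      proof (rule AE_I2)
        fix y assume "y \<in> space circ"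
        then have y: "y \<in> {0..1}" by (simp add: space_circ)
        have "norm (U (X i) y - U 0 y - (X i - 0) *\<^sub>R H 0 y) \<le> norm (X i - 0) * (2 * M)"
        proof (rule vector_differentiable_bound_linearization[where S="?S" and f="\<lambda>s. U s y" and f'="\<lambda>t. H t y" and ?x0.0=0])
          show "((\<lambda>s. U s y) has_vector_derivative H t y) (at t within ?S)" if "t \<in> ?S" for t
            using that d[of t y] by (auto intro: has_vector_derivative_at_within)
          show "closed_segment 0 (X i) \<subseteq> ?S" using Xi[of i] t0 by (auto simp: closed_segment_eq_real_ivl)
          show "0 \<in> ?S" using t0 by simp
          show "norm (H t y - H 0 y) \<le> 2 * M" if "t \<in> ?S" for t
          proof -
            have "\<bar>t\<bar> < t0" using that by auto
            then show ?thesis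
              using norm_triangle_ineq4[of "H t y" "H 0 y"] bd[of t y] bd[of 0 y] y t0 by simp
          qed
        qed
        then show "norm (norm (?R (X i) y)) \<le> 2 * M"
          using Xi[of i] by (simp add: eqR divide_le_eq mult.commute)
      qed
    qed simp_all
    then show "((\<lambda>t. L1_norm (?R t)) \<circ> X) \<longlonglongrightarrow> 0"
      by (simp add: o_def L1_norm_def cint_circ)
  qed
qed

text \<open>
  A segment \<open>P + t B\<close> of lifts of circle diffeomorphisms, with the derivatives of \<open>P\<close> and \<open>B\<close>. It will be
  used with \<open>P = I\<^sub>f\<close> and \<open>B = \<epsilon> G(e)\<close>.
\<close>

locale diffeo_line =
  fixes P P1 P2 P3 B B1 B2 B3 :: "real \<Rightarrow> real" and t0 c :: real
  assumes t0: "0 < t0" and c: "0 < c"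
    and P_lift: "P (x + 1) = P x + 1" and B_per: "periodic B"
    and dP: "(P has_real_derivative P1 x) (at x)" "(P1 has_real_derivative P2 x) (at x)"
      "(P2 has_real_derivative P3 x) (at x)" "continuous_on UNIV P3"
    and dB: "(B has_real_derivative B1 x) (at x)" "(B1 has_real_derivative B2 x) (at x)"
      "(B2 has_real_derivative B3 x) (at x)" "continuous_on UNIV B3"
    and lower: "\<bar>t\<bar> < t0 \<Longrightarrow> c \<le> P1 x + t * B1 x"
begin

lemma cont: "continuous_on UNIV P" "continuous_on UNIV P1" "continuous_on UNIV P2"
  "continuous_on UNIV B" "continuous_on UNIV B1" "continuous_on UNIV B2"
  using dP dB by (meson DERIV_isCont continuous_at_imp_continuous_on)+

definition S :: "real \<Rightarrow> real \<Rightarrow> real" where "S t x = P x + t * B x"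
definition Q :: "real \<Rightarrow> real \<Rightarrow> real" where "Q t x = P1 x + t * B1 x"
definition Q2 :: "real \<Rightarrow> real \<Rightarrow> real" where "Q2 t x = P2 x + t * B2 x"
definition Q3 :: "real \<Rightarrow> real \<Rightarrow> real" where "Q3 t x = P3 x + t * B3 x"

lemma cover: "\<bar>t\<bar> < t0 \<Longrightarrow> degree_one_cover (S t) (Q t) c"
proof
  fix x assume t: "\<bar>t\<bar> < t0"
  show "S t (x + 1) = S t x + of_int 1"
    using P_lift B_per by (simp add: S_def periodic_def)
  show "(S t has_real_derivative Q t x) (at x)"
    unfolding S_def[abs_def] Q_def by (auto intro!: derivative_eq_intros dP dB)
  show "continuous_on UNIV (Q t)"
    unfolding Q_def[abs_def] by (intro continuous_intros cont)
  show "0 < c" by (rule c)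
  show "c \<le> \<bar>Q t x\<bar>" using lower[OF t, of x] by (simp add: Q_def)
qed

lemma Q_pos: "\<bar>t\<bar> < t0 \<Longrightarrow> 0 < Q t x"
  using lower[of t x] c by (simp add: Q_def)

lemma Q_deriv: "(Q t has_real_derivative Q2 t x) (at x)"
  unfolding Q_def[abs_def] Q2_def by (auto intro!: derivative_eq_intros dP dB)

lemma Q2_deriv: "(Q2 t has_real_derivative Q3 t x) (at x)"
  unfolding Q2_def[abs_def] Q3_def by (auto intro!: derivative_eq_intros dP dB)

definition \<psi> :: "real \<Rightarrow> real \<Rightarrow> real" where "\<psi> t = circle_cover.\<tau> (S t)"

text \<open>
  The speed of \<open>s \<mapsto> \<psi> s y\<close> when it passes through \<open>x\<close> at time \<open>t\<close>.
\<close>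

definition velocity :: "real \<Rightarrow> real \<Rightarrow> real" where "velocity t x = - B x / Q t x"

lemma S_\<psi>: "\<bar>t\<bar> < t0 \<Longrightarrow> S t (\<psi> t y) = y"
  unfolding \<psi>_def by (rule circle_cover.S_\<tau>[OF degree_one_cover.axioms[OF cover]])

lemma \<psi>_y_deriv: "\<bar>t\<bar> < t0 \<Longrightarrow> (\<psi> t has_real_derivative 1 / Q t (\<psi> t y)) (at y)"
  unfolding \<psi>_def by (rule circle_cover.deriv_\<tau>[OF degree_one_cover.axioms[OF cover]])

lemma \<psi>_t_cont:
  assumes t: "\<bar>t\<bar> < t0" shows "isCont (\<lambda>s. \<psi> s y) t"
proof -
  let ?p = "\<psi> t y"
  have bound: "\<bar>\<psi> s y - ?p\<bar> \<le> \<bar>t - s\<bar> * (\<bar>B ?p\<bar> / c)" if "\<bar>s\<bar> < t0" for s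
  proof -
    have "c * \<bar>\<psi> s y - ?p\<bar> \<le> \<bar>S s (\<psi> s y) - S s ?p\<bar>"
      by (rule circle_cover.expand[OF degree_one_cover.axioms[OF cover[OF that]]])
    also have "\<dots> = \<bar>S t ?p - S s ?p\<bar>" using S_\<psi> t that by simp
    also have "\<dots> = \<bar>t - s\<bar> * \<bar>B ?p\<bar>" by (simp add: S_def left_diff_distrib[symmetric] abs_mult)
    finally show ?thesis using c by (simp add: field_simps)
  qed
  have "\<forall>\<^sub>F s in at t. s \<in> {- t0<..<t0}"
    using t by (intro eventually_at_in_open') auto
  then have ev: "\<forall>\<^sub>F s in at t. norm (\<psi> s y - ?p) \<le> \<bar>t - s\<bar> * (\<bar>B ?p\<bar> / c)"
    by eventually_elim (use bound in auto)
  have "((\<lambda>s. \<bar>t - s\<bar> * (\<bar>B ?p\<bar> / c)) \<longlongrightarrow> \<bar>t - t\<bar> * (\<bar>B ?p\<bar> / c)) (at t)"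
    by (intro tendsto_intros)
  then have "((\<lambda>s. \<bar>t - s\<bar> * (\<bar>B ?p\<bar> / c)) \<longlongrightarrow> 0) (at t)"
    by (simp only: diff_self abs_zero mult_zero_left)
  from Lim_null_comparison[OF ev this] have "((\<lambda>s. \<psi> s y - ?p) \<longlongrightarrow> 0) (at t)" .
  then show ?thesis unfolding isCont_def by (rule LIM_zero_cancel)
qed

text \<open>
  \<open>\<psi> s y\<close> is the image of the point \<open>y - (s - t) B(\<psi> s y)\<close> under the fixed diffeomorphism \<open>\<psi> t\<close>. Because of
  the factor \<open>s - t\<close>, this point is differentiable at \<open>s = t\<close> as soon as \<open>s \<mapsto> \<psi> s y\<close> is continuous.
\<close>

lemma \<psi>_t_deriv:
  assumes t: "\<bar>t\<bar> < t0"
  shows "((\<lambda>s. \<psi> s y) has_real_derivative velocity t (\<psi> t y)) (at t)"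
proof -
  let ?p = "\<psi> t y"
  have eq: "\<psi> t (y - (s - t) * B (\<psi> s y)) = \<psi> s y" if "s \<in> {- t0<..<t0}" for s
  proof -
    have "\<bar>s\<bar> < t0" using that by auto
    then have "S t (\<psi> s y) = y - (s - t) * B (\<psi> s y)"
      using S_\<psi>[of s y] by (simp add: S_def algebra_simps)
    then show ?thesis
      unfolding \<psi>_def[of t] by (rule circle_cover.\<tau>_eqI[OF degree_one_cover.axioms[OF cover[OF t]]])
  qed
  have "isCont B ?p" by (rule DERIV_isCont[OF dB(1)])
  with \<psi>_t_cont[OF t] have "isCont (\<lambda>s. - B (\<psi> s y)) t"
    by (intro continuous_intros isCont_o2[of t "\<lambda>s. \<psi> s y" B]) auto
  then have "((\<lambda>s. y - (s - t) * B (\<psi> s y)) has_real_derivative - B ?p) (at t)"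
    unfolding CARAT_DERIV by (intro exI[of _ "\<lambda>s. - B (\<psi> s y)"]) auto
  moreover have "(\<psi> t has_real_derivative 1 / Q t ?p) (at (y - (t - t) * B (\<psi> t y)))"
    using \<psi>_y_deriv[OF t, of y] by simp
  ultimately have "((\<lambda>s. \<psi> t (y - (s - t) * B (\<psi> s y))) has_real_derivative 1 / Q t ?p * (- B ?p)) (at t)"
    by (rule DERIV_chain2[rotated])
  then have "((\<lambda>s. \<psi> s y) has_real_derivative 1 / Q t ?p * (- B ?p)) (at t)"
    by (rule has_field_derivative_transform_within_open[of _ _ _ "{- t0<..<t0}"]) (use t eq in auto)
  then show ?thesis by (simp add: velocity_def)
qed

lemma \<psi>_bounded:
  obtains R where "\<And>t y. \<bar>t\<bar> < t0 \<Longrightarrow> y \<in> {0..1} \<Longrightarrow> \<psi> t y \<in> {- R..R}"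
proof -
  have "periodic (\<lambda>x. P x - x)" using P_lift by (simp add: periodic_def)
  then obtain M where M: "\<And>x. norm (P x - x) \<le> M"
    using periodic_bounded[of "\<lambda>x. P x - x"] cont(1) continuous_on_diff continuous_on_id by metis
  obtain M' where M': "\<And>x. norm (B x) \<le> M'" using periodic_bounded[OF B_per cont(4)] by metis
  have "\<psi> t y \<in> {- (1 + M + t0 * M')..1 + M + t0 * M'}" if t: "\<bar>t\<bar> < t0" and y: "y \<in> {0..1}" for t y
  proof -
    have "\<bar>t * B (\<psi> t y)\<bar> \<le> t0 * M'"
      unfolding abs_mult using M'[of "\<psi> t y"] t by (intro mult_mono) auto
    moreover have "y = P (\<psi> t y) + t * B (\<psi> t y)" using S_\<psi>[OF t, of y] by (simp add: S_def)
    ultimately show ?thesis using M[of "\<psi> t y"] y by (simp add: abs_le_iff)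
  qed
  then show ?thesis by (rule that)
qed

text \<open>The derivatives of \<open>Q\<close> and \<open>Q2\<close> along the curve \<open>s \<mapsto> (s, \<psi> s y)\<close>.\<close>

definition Q' :: "real \<Rightarrow> real \<Rightarrow> real" where "Q' t x = B1 x + Q2 t x * velocity t x"
definition Q2' :: "real \<Rightarrow> real \<Rightarrow> real" where "Q2' t x = B2 x + Q3 t x * velocity t x"

lemma Q_along: "\<bar>t\<bar> < t0 \<Longrightarrow> ((\<lambda>s. Q s (\<psi> s y)) has_real_derivative Q' t (\<psi> t y)) (at t)"
  unfolding Q_def Q'_def Q2_def
  by (auto intro!: derivative_eq_intros DERIV_chain2[OF dP(2)] DERIV_chain2[OF dB(2)] \<psi>_t_deriv simp: algebra_simps)

lemma Q2_along: "\<bar>t\<bar> < t0 \<Longrightarrow> ((\<lambda>s. Q2 s (\<psi> s y)) has_real_derivative Q2' t (\<psi> t y)) (at t)"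
  unfolding Q2_def Q2'_def Q3_def
  by (auto intro!: derivative_eq_intros DERIV_chain2[OF dP(3)] DERIV_chain2[OF dB(3)] \<psi>_t_deriv simp: algebra_simps)

context
  fixes w w1 w2 :: "real \<Rightarrow> 'a::euclidean_space"
  assumes w_per: "periodic w"
    and dw: "\<And>x. (w has_vector_derivative w1 x) (at x)" "\<And>x. (w1 has_vector_derivative w2 x) (at x)"
    and w2_cont: "continuous_on UNIV w2"
begin

lemma continuous_w: "continuous_on UNIV w" "continuous_on UNIV w1"
  by (rule continuous_on_UNIV_deriv[OF dw(1)] continuous_on_UNIV_deriv[OF dw(2)])+

text \<open>
  \<open>U t\<close> is the image of the density \<open>w\<close> under \<open>S t\<close> and \<open>Uy\<close> its derivative in \<open>y\<close>. The derivatives of \<open>U\<close> and \<open>Uy\<close>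
  in \<open>t\<close> are \<open>H\<close> and \<open>Hy\<close>; these are written as functions of \<open>t\<close> and of the preimage \<open>x = \<psi> t y\<close>, in which they
  are continuous without reference to \<open>\<psi>\<close>.
\<close>

definition U where "U t y = (1 / Q t (\<psi> t y)) *\<^sub>R w (\<psi> t y)"

definition Uy where "Uy t y = (1 / (Q t (\<psi> t y))\<^sup>2) *\<^sub>R w1 (\<psi> t y) + (- Q2 t (\<psi> t y) / (Q t (\<psi> t y))^3) *\<^sub>R w (\<psi> t y)"

definition H where "H t x = (velocity t x / Q t x) *\<^sub>R w1 x + (- Q' t x / (Q t x)\<^sup>2) *\<^sub>R w x"

definition Hy where "Hy t x = (velocity t x / (Q t x)\<^sup>2) *\<^sub>R w2 x
   + (- 2 * Q' t x / (Q t x)^3 - Q2 t x * velocity t x / (Q t x)^3) *\<^sub>R w1 x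
   + (- (Q2' t x / (Q t x)^3) + 3 * Q2 t x * Q' t x / (Q t x)^4) *\<^sub>R w x"

lemma along:
  assumes "\<bar>t\<bar> < t0" "\<And>x. (k has_vector_derivative k1 x) (at x)"
  shows "((\<lambda>s. k (\<psi> s y)) has_vector_derivative velocity t (\<psi> t y) *\<^sub>R k1 (\<psi> t y)) (at t)"
  using vector_diff_chain_at[OF \<psi>_t_deriv[OF assms(1), unfolded has_real_derivative_iff_has_vector_derivative] assms(2)]
  by (simp add: o_def)

lemma across:
  assumes "\<bar>t\<bar> < t0" "\<And>x. (k has_vector_derivative k1 x) (at x)"
  shows "((\<lambda>y. k (\<psi> t y)) has_vector_derivative (1 / Q t (\<psi> t y)) *\<^sub>R k1 (\<psi> t y)) (at y)"
  using vector_diff_chain_at[OF \<psi>_y_deriv[OF assms(1), unfolded has_real_derivative_iff_has_vector_derivative] assms(2)]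
  by (simp add: o_def)

lemma U_t_deriv:
  assumes t: "\<bar>t\<bar> < t0" shows "((\<lambda>s. U s y) has_vector_derivative H t (\<psi> t y)) (at t)"
proof -
  have nz: "Q t (\<psi> t y) \<noteq> 0" using Q_pos[OF t] by (metis less_irrefl)
  have "((\<lambda>s. U s y) has_vector_derivative (1 / Q t (\<psi> t y)) *\<^sub>R (velocity t (\<psi> t y) *\<^sub>R w1 (\<psi> t y))
    + (- Q' t (\<psi> t y) / (Q t (\<psi> t y))\<^sup>2) *\<^sub>R w (\<psi> t y)) (at t)"
    unfolding U_def
  proof (rule has_vector_derivative_scaleR[OF _ along[OF t dw(1)]])
    show "((\<lambda>s. 1 / Q s (\<psi> s y)) has_real_derivative - Q' t (\<psi> t y) / (Q t (\<psi> t y))\<^sup>2) (at t)"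
      using nz by (auto intro!: derivative_eq_intros Q_along t simp: power2_eq_square)
  qed
  then show ?thesis by (simp add: H_def)
qed

lemma Uy_t_deriv:
  assumes t: "\<bar>t\<bar> < t0" shows "((\<lambda>s. Uy s y) has_vector_derivative Hy t (\<psi> t y)) (at t)"
proof -
  let ?p = "\<psi> t y"
  have nz: "Q t ?p \<noteq> 0" using Q_pos[OF t] by (metis less_irrefl)
  have 1: "((\<lambda>s. 1 / (Q s (\<psi> s y))\<^sup>2) has_real_derivative - 2 * Q' t ?p / (Q t ?p)^3) (at t)"
    by (rule derivative_eq_intros Q_along[OF t] refl | simp add: nz)+
       (simp add: nz field_simps eval_nat_numeral)
  have 2: "((\<lambda>s. - Q2 s (\<psi> s y) / (Q s (\<psi> s y))^3) has_real_derivative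
      - (Q2' t ?p / (Q t ?p)^3) + 3 * Q2 t ?p * Q' t ?p / (Q t ?p)^4) (at t)"
    by (rule derivative_eq_intros Q_along[OF t] Q2_along[OF t] refl | simp add: nz)+
       (simp add: nz field_simps eval_nat_numeral)
  have "((\<lambda>s. Uy s y) has_vector_derivative
      ((1 / (Q t ?p)\<^sup>2) *\<^sub>R (velocity t ?p *\<^sub>R w2 ?p) + (- 2 * Q' t ?p / (Q t ?p)^3) *\<^sub>R w1 ?p)
    + ((- Q2 t ?p / (Q t ?p)^3) *\<^sub>R (velocity t ?p *\<^sub>R w1 ?p)
       + (- (Q2' t ?p / (Q t ?p)^3) + 3 * Q2 t ?p * Q' t ?p / (Q t ?p)^4) *\<^sub>R w ?p)) (at t)"
    unfolding Uy_def
    by (intro has_vector_derivative_add has_vector_derivative_scaleR 1 2 along[OF t dw(1)] along[OF t dw(2)])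
  then show ?thesis by (simp add: Hy_def scaleR_left_distrib scaleR_left_diff_distrib algebra_simps)
qed

lemma U_y_deriv:
  assumes t: "\<bar>t\<bar> < t0" shows "(U t has_vector_derivative Uy t y) (at y)"
proof -
  let ?K = "\<lambda>x. (1 / Q t x) *\<^sub>R w x"
  have nz: "Q t x \<noteq> 0" for x using Q_pos[OF t] by (metis less_irrefl)
  have "(?K has_vector_derivative (1 / Q t x) *\<^sub>R w1 x + (- Q2 t x / (Q t x)\<^sup>2) *\<^sub>R w x) (at x)" for x
    by (rule has_vector_derivative_scaleR[OF _ dw(1)])
       (auto intro!: derivative_eq_intros Q_deriv simp: nz power2_eq_square)
  from across[OF t this, of y]
  have "(U t has_vector_derivative (1 / Q t (\<psi> t y)) *\<^sub>R ((1 / Q t (\<psi> t y)) *\<^sub>R w1 (\<psi> t y)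
      + (- Q2 t (\<psi> t y) / (Q t (\<psi> t y))\<^sup>2) *\<^sub>R w (\<psi> t y))) (at y)"
    by (simp only: U_def[abs_def])
  moreover have "(1 / b) *\<^sub>R ((1 / b) *\<^sub>R u + (- a / b\<^sup>2) *\<^sub>R v) = (1 / b\<^sup>2) *\<^sub>R u + (- a / b^3) *\<^sub>R v"
    for a b :: real and u v :: 'a
    by (simp add: scaleR_right_diff_distrib power2_eq_square power3_eq_cube mult.assoc)
  ultimately show ?thesis by (simp only: Uy_def)
qed

text \<open>
  The mixed derivatives of \<open>U\<close> agree. Differentiability of \<open>H\<close> across \<open>y\<close> is needed to know the weak derivative
  of the candidate for the limit.
\<close>

lemma H_y_deriv: "((\<lambda>y. H 0 (\<psi> 0 y)) has_vector_derivative Hy 0 (\<psi> 0 y)) (at y)"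
proof -
  have t: "\<bar>0\<bar> < t0" using t0 by simp
  have nz: "Q 0 x \<noteq> 0" for x using Q_pos[OF t] by (metis less_irrefl)
  have d1: "((\<lambda>x. velocity 0 x / Q 0 x) has_real_derivative - B1 x / (Q 0 x)\<^sup>2 + 2 * B x * Q2 0 x / (Q 0 x)^3) (at x)" for x
    unfolding velocity_def
    by (rule derivative_eq_intros Q_deriv dB refl | simp add: nz)+
       (simp add: nz field_simps eval_nat_numeral)
  have Q'0: "Q' 0 x = B1 x - Q2 0 x * B x / Q 0 x" for x by (simp add: Q'_def velocity_def)
  have d0: "((\<lambda>x. - Q' 0 x / (Q 0 x)\<^sup>2) has_real_derivative
     - B2 x / (Q 0 x)\<^sup>2 + 2 * B1 x * Q2 0 x / (Q 0 x)^3 + (Q3 0 x * B x + Q2 0 x * B1 x) / (Q 0 x)^3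
     - 3 * (Q2 0 x)\<^sup>2 * B x / (Q 0 x)^4) (at x)" for x
    unfolding Q'0
    by (rule derivative_eq_intros Q_deriv Q2_deriv dB refl | simp add: nz)+
       (simp add: nz field_simps eval_nat_numeral)
  have "(H 0 has_vector_derivative Q 0 x *\<^sub>R Hy 0 x) (at x)" for x
  proof -
    \<comment> \<open>after clearing the denominator, the coefficients of \<open>w2\<close>, \<open>w1\<close> and \<open>w\<close> are compared\<close>
    define \<beta> where "\<beta> = Q 0 x"
    have \<beta>: "\<beta> \<noteq> 0" using nz by (simp add: \<beta>_def)
    have "(H 0 has_vector_derivative
        ((velocity 0 x / Q 0 x) *\<^sub>R w2 x + (- B1 x / (Q 0 x)\<^sup>2 + 2 * B x * Q2 0 x / (Q 0 x)^3) *\<^sub>R w1 x)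
      + ((- Q' 0 x / (Q 0 x)\<^sup>2) *\<^sub>R w1 x +
        (- B2 x / (Q 0 x)\<^sup>2 + 2 * B1 x * Q2 0 x / (Q 0 x)^3 + (Q3 0 x * B x + Q2 0 x * B1 x) / (Q 0 x)^3
     - 3 * (Q2 0 x)\<^sup>2 * B x / (Q 0 x)^4) *\<^sub>R w x)) (at x)"
      unfolding H_def[abs_def]
      by (intro has_vector_derivative_add has_vector_derivative_scaleR d0 d1 dw)
    moreover have "Q 0 x *\<^sub>R Hy 0 x = (Q 0 x * (velocity 0 x / (Q 0 x)\<^sup>2)) *\<^sub>R w2 x
      + (Q 0 x * (- 2 * Q' 0 x / (Q 0 x)^3 - Q2 0 x * velocity 0 x / (Q 0 x)^3)) *\<^sub>R w1 x
      + (Q 0 x * (- (Q2' 0 x / (Q 0 x)^3) + 3 * Q2 0 x * Q' 0 x / (Q 0 x)^4)) *\<^sub>R w x"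
      by (simp add: Hy_def scaleR_right_distrib)
    moreover have "Q 0 x * (velocity 0 x / (Q 0 x)\<^sup>2) = velocity 0 x / Q 0 x"
      using nz by (simp add: power2_eq_square)
    moreover have "Q 0 x * (- 2 * Q' 0 x / (Q 0 x)^3 - Q2 0 x * velocity 0 x / (Q 0 x)^3)
      = (- B1 x / (Q 0 x)\<^sup>2 + 2 * B x * Q2 0 x / (Q 0 x)^3) + (- Q' 0 x / (Q 0 x)\<^sup>2)"
      unfolding Q'0 velocity_def \<beta>_def[symmetric] using \<beta> by (simp add: field_simps eval_nat_numeral)
    moreover have "Q 0 x * (- (Q2' 0 x / (Q 0 x)^3) + 3 * Q2 0 x * Q' 0 x / (Q 0 x)^4)
      = - B2 x / (Q 0 x)\<^sup>2 + 2 * B1 x * Q2 0 x / (Q 0 x)^3 + (Q3 0 x * B x + Q2 0 x * B1 x) / (Q 0 x)^3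
     - 3 * (Q2 0 x)\<^sup>2 * B x / (Q 0 x)^4"
      unfolding Q2'_def Q'0 velocity_def \<beta>_def[symmetric] using \<beta> by (simp add: field_simps eval_nat_numeral)
    ultimately show ?thesis by (simp only: scaleR_left_distrib add_ac)
  qed
  from across[OF t this] show ?thesis using nz by simp
qed

text \<open>
  \<open>H\<close> and \<open>Hy\<close> are continuous in \<open>(t, x)\<close>, and \<open>\<psi> t y\<close> stays in a compact interval while \<open>y\<close> runs through a
  period. Halving \<open>t0\<close> leaves a range of \<open>t\<close> on whose closure \<open>Q\<close> has no zero.
\<close>

lemma H_bounded:
  obtains M where "\<And>t y. \<bar>t\<bar> < t0 / 2 \<Longrightarrow> y \<in> {0..1} \<Longrightarrow> norm (H t (\<psi> t y)) \<le> M \<and> norm (Hy t (\<psi> t y)) \<le> M"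
proof -
  obtain R where R: "\<And>t y. \<bar>t\<bar> < t0 \<Longrightarrow> y \<in> {0..1} \<Longrightarrow> \<psi> t y \<in> {- R..R}" using \<psi>_bounded by metis
  define K where "K = {- (t0/2)..t0/2} \<times> {- R..R}"
  have K: "compact K" by (simp add: K_def compact_Times)
  have nz: "\<forall>z\<in>K. Q (fst z) (snd z) \<noteq> 0"
  proof
    fix z assume "z \<in> K"
    then have "\<bar>fst z\<bar> < t0" using t0 by (auto simp: K_def)
    then show "Q (fst z) (snd z) \<noteq> 0" using Q_pos by (metis less_irrefl)
  qed
  have cs: "continuous_on K (\<lambda>z. k (snd z))" if "continuous_on UNIV k" for k :: "real \<Rightarrow> 'b::real_normed_vector"
    by (rule continuous_on_compose2[OF that]) (auto intro: continuous_intros)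
  have cQ: "continuous_on K (\<lambda>z. Q (fst z) (snd z))" "continuous_on K (\<lambda>z. Q2 (fst z) (snd z))"
    "continuous_on K (\<lambda>z. Q3 (fst z) (snd z))"
    unfolding Q_def Q2_def Q3_def
    by (intro continuous_intros cs[OF cont(2)] cs[OF cont(3)] cs[OF cont(5)] cs[OF cont(6)] cs[OF dP(4)] cs[OF dB(4)])+
  have cv: "continuous_on K (\<lambda>z. velocity (fst z) (snd z))"
    unfolding velocity_def by (intro continuous_intros cQ cs[OF cont(4)] nz)
  have cQ': "continuous_on K (\<lambda>z. Q' (fst z) (snd z))" "continuous_on K (\<lambda>z. Q2' (fst z) (snd z))"
    unfolding Q'_def Q2'_def by (intro continuous_intros cQ cv cs[OF cont(5)] cs[OF cont(6)])+
  have nzp: "\<forall>z\<in>K. (Q (fst z) (snd z)) ^ n \<noteq> 0" for n using nz by simp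
  have "continuous_on K (\<lambda>z. H (fst z) (snd z))" "continuous_on K (\<lambda>z. Hy (fst z) (snd z))"
    unfolding H_def Hy_def
    by (intro continuous_intros cQ cQ' cv nz nzp cs[OF continuous_w(1)] cs[OF continuous_w(2)] cs[OF w2_cont])+
  then have "bounded ((\<lambda>z. H (fst z) (snd z)) ` K)" "bounded ((\<lambda>z. Hy (fst z) (snd z)) ` K)"
    using K by (auto intro!: compact_imp_bounded compact_continuous_image)
  then obtain M M' where M: "\<forall>z\<in>K. norm (H (fst z) (snd z)) \<le> M" "\<forall>z\<in>K. norm (Hy (fst z) (snd z)) \<le> M'"
    unfolding bounded_iff by blast
  have "norm (H t (\<psi> t y)) \<le> max M M' \<and> norm (Hy t (\<psi> t y)) \<le> max M M'"
    if "\<bar>t\<bar> < t0 / 2" "y \<in> {0..1}" for t y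
  proof -
    have "(t, \<psi> t y) \<in> K" using that R[of t y] t0 by (auto simp: K_def)
    then show ?thesis using M by (auto simp: max.coboundedI1 max.coboundedI2)
  qed
  then show ?thesis by (rule that)
qed

lemma periodic_U: assumes t: "\<bar>t\<bar> < t0" shows "periodic (U t)"
proof -
  interpret I: degree_one_cover "S t" "Q t" c by (rule cover[OF t])
  show ?thesis
    using I.\<tau>_plus_int[of _ 1] I.deriv_periodic w_per
    by (simp add: periodic_def U_def \<psi>_def)
qed

lemma periodic_H0: "periodic (\<lambda>y. H 0 (\<psi> 0 y))"
proof -
  interpret I: degree_one_cover "S 0" "Q 0" c using cover[of 0] t0 by simp
  have "periodic w1" by (rule periodic_vector_derivative[OF w_per dw(1)])
  moreover have "periodic B1" "periodic (Q2 0)"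
    using periodic_vector_derivative[OF B_per] periodic_vector_derivative[OF I.deriv_periodic]
      dB(1) Q_deriv[of 0] by (auto simp: has_real_derivative_iff_has_vector_derivative)
  ultimately show ?thesis
    using I.\<tau>_plus_int[of _ 1] I.deriv_periodic w_per B_per
    by (simp add: periodic_def H_def Q'_def velocity_def \<psi>_def)
qed

text \<open>
  Both \<open>U\<close> and \<open>Uy\<close> have difference quotients that converge in \<open>L\<^sup>1\<close>, and the functions \<open>R t\<close>, given up to null
  sets only, have their \<open>W\<^bsup>1,1\<^esup>\<close> norm computed from these representatives.
\<close>

theorem W11_derivative:
  defines "r \<equiv> \<lambda>t y. (U t y - U 0 y) /\<^sub>R t - H 0 (\<psi> 0 y)"
  assumes R: "\<And>t. \<bar>t\<bar> < t0 \<Longrightarrow> R t \<in> L1 \<and> (AE y in circ. R t y = r t y)"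
  shows "\<forall>\<^sub>F t in at 0. R t \<in> sobolev 1" "((\<lambda>t. sobolev_norm 1 (R t)) \<longlongrightarrow> 0) (at 0)"
proof -
  define r' where "r' t y = (Uy t y - Uy 0 y) /\<^sub>R t - Hy 0 (\<psi> 0 y)" for t y
  have z: "\<bar>0\<bar> < t0" "0 < t0 / 2" using t0 by auto
  have nz: "Q t x \<noteq> 0" if "\<bar>t\<bar> < t0" for t x using Q_pos[OF that] by (metis less_irrefl)
  have c\<psi>: "continuous_on UNIV (\<psi> t)" if "\<bar>t\<bar> < t0" for t
    using \<psi>_y_deriv[OF that] by (meson DERIV_isCont continuous_at_imp_continuous_on)
  have cQ: "continuous_on UNIV (Q t)" "continuous_on UNIV (Q2 t)" "continuous_on UNIV (Q3 t)" for t
    unfolding Q_def[abs_def] Q2_def[abs_def] Q3_def[abs_def] by (intro continuous_intros cont dP(4) dB(4))+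
  have cHy: "continuous_on UNIV (Hy 0)"
    unfolding Hy_def[abs_def] Q'_def Q2'_def velocity_def
    by (intro continuous_intros cQ cont continuous_w w2_cont) (simp_all add: nz[OF z(1)])
  have cHy\<psi>: "continuous_on UNIV (\<lambda>y. Hy 0 (\<psi> 0 y))"
    by (rule continuous_on_compose2[OF cHy c\<psi>[OF z(1)]]) simp
  have cUy: "continuous_on UNIV (Uy t)" if t: "\<bar>t\<bar> < t0" for t
  proof -
    have "continuous_on UNIV (\<lambda>x. (1 / (Q t x)\<^sup>2) *\<^sub>R w1 x + (- Q2 t x / (Q t x)^3) *\<^sub>R w x)"
      by (intro continuous_intros cQ continuous_w) (simp_all add: nz[OF t])
    from continuous_on_compose2[OF this c\<psi>[OF t]] show ?thesis unfolding Uy_def[abs_def] by simp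
  qed
  have dr: "(r t has_vector_derivative r' t y) (at y)" if t: "\<bar>t\<bar> < t0" for t y
    unfolding r_def r'_def divide_inverse[symmetric]
    by (intro has_vector_derivative_diff H_y_deriv bounded_linear.has_vector_derivative[OF bounded_linear_scaleR_right]
        U_y_deriv t z(1))
  have cr': "continuous_on UNIV (r' t)" if t: "\<bar>t\<bar> < t0" for t
    unfolding r'_def[abs_def] by (intro continuous_intros cUy t z(1) cHy\<psi>)
  have pr: "periodic (r t)" if t: "\<bar>t\<bar> < t0" for t
    using periodic_U[OF t] periodic_U[OF z(1)] periodic_H0 by (simp add: r_def periodic_def)
  have sob: "R t \<in> sobolev 1" "sobolev_norm 1 (R t) = L1_norm (r t) + L1_norm (r' t)" if t: "\<bar>t\<bar> < t0" for t
    using sobolev_1_C1[OF conjunct1[OF R[OF t]] conjunct2[OF R[OF t]] pr[OF t] dr[OF t] cr'[OF t]] by blast+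
  have "\<forall>\<^sub>F t in at 0. t \<in> {- t0<..<t0}" using t0 by (intro eventually_at_in_open') auto
  then have ev: "\<forall>\<^sub>F t in at 0. \<bar>t\<bar> < t0" by eventually_elim auto
  show "\<forall>\<^sub>F t in at 0. R t \<in> sobolev 1" using ev by eventually_elim (rule sob)
  obtain M where M: "\<And>t y. \<bar>t\<bar> < t0 / 2 \<Longrightarrow> y \<in> {0..1} \<Longrightarrow> norm (H t (\<psi> t y)) \<le> M \<and> norm (Hy t (\<psi> t y)) \<le> M"
    using H_bounded by metis
  have "((\<lambda>t. L1_norm (r t)) \<longlongrightarrow> 0) (at 0)"
    unfolding r_def
  proof (rule L1_diff_quotient[OF z(2), where H="\<lambda>t y. H t (\<psi> t y)" and M=M])
    show "continuous_on UNIV (U t)" if "\<bar>t\<bar> < t0 / 2" for t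
      using that t0 by (intro continuous_on_UNIV_deriv[OF U_y_deriv]) simp
    show "continuous_on UNIV (\<lambda>y. H 0 (\<psi> 0 y))" by (rule continuous_on_UNIV_deriv[OF H_y_deriv])
  qed (use t0 M in \<open>auto intro!: U_t_deriv\<close>)
  moreover have "((\<lambda>t. L1_norm (r' t)) \<longlongrightarrow> 0) (at 0)"
    unfolding r'_def
  proof (rule L1_diff_quotient[OF z(2), where H="\<lambda>t y. Hy t (\<psi> t y)" and M=M])
    show "continuous_on UNIV (Uy t)" if "\<bar>t\<bar> < t0 / 2" for t
      using that t0 by (intro cUy) simp
  qed (use t0 M cHy\<psi> in \<open>auto intro!: Uy_t_deriv\<close>)
  ultimately have "((\<lambda>t. L1_norm (r t) + L1_norm (r' t)) \<longlongrightarrow> 0 + 0) (at 0)" by (rule tendsto_add)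
  moreover have "\<forall>\<^sub>F t in at 0. L1_norm (r t) + L1_norm (r' t) = sobolev_norm 1 (R t)"
    using ev by eventually_elim (simp only: sob(2))
  ultimately show "((\<lambda>t. sobolev_norm 1 (R t)) \<longlongrightarrow> 0) (at 0)"
    using tendsto_cong by force
qed

end
end

section \<open>The directional derivative and the theorem\<close>

context coupled_map begin

definition I3 :: "(real \<Rightarrow> real) \<Rightarrow> real \<Rightarrow> real" where
  "I3 f x = \<epsilon> * G_op (pd1 (pd1 (pd1 g))) f x"

lemma I2_deriv:
  assumes "continuous_on UNIV f" shows "(I2 f has_real_derivative I3 f x) (at x)"
proof -
  have "(G_op (pd1 (pd1 g)) f has_real_derivative G_op (pd1 (pd1 (pd1 g))) f x) (at x)"
    using G_op_deriv[OF g_Ck(3) assms] by (simp add: has_real_derivative_iff_has_vector_derivative)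
  then show ?thesis unfolding I2_def[abs_def] I3_def by (auto intro!: derivative_eq_intros)
qed

lemma I3_cont: "continuous_on UNIV f \<Longrightarrow> continuous_on UNIV (I3 f)"
  unfolding I3_def[abs_def]
  by (intro continuous_intros continuous_on_UNIV_deriv[OF G_op_deriv[OF g_Ck(4)]])

lemma I_map_add_scaled:
  assumes "continuous_on UNIV f" "continuous_on UNIV e"
  shows "I_map g \<epsilon> (\<lambda>x. f x + t * e x) x = I_map g \<epsilon> f x + t * (\<epsilon> * G_op g e x)"
    "I1 (\<lambda>x. f x + t * e x) x = I1 f x + t * (\<epsilon> * G_op (pd1 g) e x)"
  using G_op_add_scaled[OF g_cont(1) assms, of t x] G_op_add_scaled[OF g_cont(2) assms, of t x]
  by (simp_all add: I_map_def I1_def algebra_simps)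

lemma transfer_T_map_AE:
  assumes f: "admissible f" and h: "periodic h" "continuous_on UNIV h"
  shows "AE y in circ. transfer (T_map T g \<epsilon> f) h y =
    (1 / I1 f (circle_cover.\<tau> (I_map g \<epsilon> f) y)) *\<^sub>R pushed h (circle_cover.\<tau> (I_map g \<epsilon> f) y)"
    "transfer (T_map T g \<epsilon> f) h \<in> L1"
proof -
  interpret TM: circle_cover "T_map T g \<epsilon> f" "\<lambda>x. I1 f (T x) * T1 x" d "(1 - q * L1_norm f) * \<sigma>"
    by (rule T_map_cover[OF f])
  note tr = transfer_is_transfer[OF TM.is_transfer_branch_sum[OF h]]
  show "transfer (T_map T g \<epsilon> f) h \<in> L1" by (rule tr(3))
  have "TM.branch_sum (\<lambda>x. (1 / \<bar>I1 f (T x) * T1 x\<bar>) *\<^sub>R h x) y =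
    (1 / I1 f (circle_cover.\<tau> (I_map g \<epsilon> f) y)) *\<^sub>R pushed h (circle_cover.\<tau> (I_map g \<epsilon> f) y)" for y
    using branch_sum_comp[OF I_cover[OF f] T_cover, of h y] I1_pos[OF f]
    by (simp add: T_map_def pushed_def abs_of_pos)
  with tr(2) show "AE y in circ. transfer (T_map T g \<epsilon> f) h y =
    (1 / I1 f (circle_cover.\<tau> (I_map g \<epsilon> f) y)) *\<^sub>R pushed h (circle_cover.\<tau> (I_map g \<epsilon> f) y)"
    by simp
qed

text \<open>
  \<open>W11_derivative\<close> applies to the segment \<open>t \<mapsto> I\<^bsub>f+te\<^esub>\<close> and to \<open>w = \<L>\<^sub>T h\<close>. There \<open>U t\<close> represents \<open>\<L>\<^bsub>\<epsilon>,f+te\<^esub> h\<close>, and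
  the value at \<open>t = 0\<close> of its derivative represents \<open>\<J>(h)(e)\<close>.
\<close>

lemma has_dir_deriv_transfer:
  assumes f: "f \<in> densities" "f \<in> F_real N" and e: "e \<in> F_real M" and h: "h \<in> F_space L"
  shows "has_dir_deriv (\<lambda>f. transfer (T_map T g \<epsilon> f) h) f e (J_op T g \<epsilon> f h (cplx e))"
proof -
  note cf = F_realD(3)[OF f(2)] and ce = F_realD(3)[OF e]
  note hp = F_spaceD(1,2)[OF h]
  \<comment> \<open>for \<open>\<bar>t\<bar> < t0\<close> the norm of \<open>f + t e\<close> is below \<open>2 - q\<close>, and \<open>q (2 - q) = 1 - (1 - q)\<^sup>2 < 1\<close>\<close>
  define t0 where "t0 = (1 - q) / (L1_norm e + 1)"
  have e1: "0 < L1_norm e + 1" using L1_norm_nonneg[of e] by simp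
  have t0: "0 < t0" using q e1 by (simp add: t0_def)
  have small: "\<bar>t\<bar> * L1_norm e < 1 - q" if "\<bar>t\<bar> < t0" for t
  proof -
    have "\<bar>t\<bar> * L1_norm e \<le> \<bar>t\<bar> * (L1_norm e + 1)" by (intro mult_left_mono) auto
    also have "\<dots> < 1 - q" using that e1 by (simp add: t0_def pos_less_divide_eq)
    finally show ?thesis .
  qed
  let ?f = "\<lambda>t x. f x + t * e x"
  have adm: "admissible (?f t)" if "\<bar>t\<bar> < t0" for t
    by (rule admissible_perturbed[OF f(1) cf ce small[OF that]])
  have adm0: "admissible f" by (rule admissible_density[OF f(1) cf])
  let ?B = "\<lambda>x. \<epsilon> * G_op g e x" and ?B1 = "\<lambda>x. \<epsilon> * G_op (pd1 g) e x"
  have lower: "(1 - q)\<^sup>2 \<le> I1 f x + t * ?B1 x" if "\<bar>t\<bar> < t0" for t x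
  proof -
    have "L1_norm (?f t) \<le> 1 + \<bar>t\<bar> * L1_norm e"
      using L1_norm_add_scaled[OF F_realD(4)[OF f(2)] F_realD(4)[OF e]] L1_norm_density[OF f(1)] by metis
    also have "\<dots> \<le> 2 - q" using small[OF that] by simp
    finally have "q * L1_norm (?f t) \<le> q * (2 - q)" using q by (intro mult_left_mono) auto
    moreover have "(1 - q)\<^sup>2 = 1 - q * (2 - q)" by (simp add: power2_eq_square algebra_simps)
    ultimately show ?thesis
      using I1_lower[OF adm[OF that], of x] I_map_add_scaled(2)[OF cf ce, of t x] by linarith
  qed
  have dG: "(G_op g e has_real_derivative G_op (pd1 g) e x) (at x)"
    "(G_op (pd1 g) e has_real_derivative G_op (pd1 (pd1 g)) e x) (at x)" for x
    using G_op_deriv[OF g_Ck(1) ce] G_op_deriv[OF g_Ck(2) ce]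
    by (simp_all add: has_real_derivative_iff_has_vector_derivative)
  interpret I: degree_one_cover "I_map g \<epsilon> f" "I1 f" "1 - q * L1_norm f" by (rule I_cover[OF adm0])
  interpret L: diffeo_line "I_map g \<epsilon> f" "I1 f" "I2 f" "I3 f" ?B ?B1 "I2 e" "I3 e" t0 "(1 - q)\<^sup>2"
  proof
    show "periodic ?B" using G_op_periodic[OF g_per, of e] by (simp add: periodic_def)
    show "(?B has_real_derivative ?B1 x) (at x)" for x
      by (auto intro!: derivative_eq_intros dG)
    show "(?B1 has_real_derivative I2 e x) (at x)" for x
      unfolding I2_def by (auto intro!: derivative_eq_intros dG)
    show "I_map g \<epsilon> f (x + 1) = I_map g \<epsilon> f x + 1" for x using I.lift[of x] by simp
  qed (use t0 q lower I.S_deriv I1_deriv[OF cf] I2_deriv[OF cf] I3_cont[OF cf] I2_deriv[OF ce] I3_cont[OF ce] in auto)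
  have S: "L.S t = I_map g \<epsilon> (?f t)" for t
    unfolding fun_eq_iff L.S_def I_map_add_scaled(1)[OF cf ce] by simp
  have Q: "L.Q t = I1 (?f t)" for t
    unfolding fun_eq_iff L.Q_def I_map_add_scaled(2)[OF cf ce] by simp
  have f0: "?f 0 = f" by simp
  obtain w1 w2 where w: "\<And>x. (pushed h has_vector_derivative w1 x) (at x)"
    "\<And>x. (w1 has_vector_derivative w2 x) (at x)" "continuous_on UNIV w2"
    using pushed_F_space_C2[OF h] by metis
  note U_def = L.U_def[OF periodic_pushed[OF hp(1)] w] and H_def = L.H_def[OF periodic_pushed[OF hp(1)] w]
  let ?J = "J_op T g \<epsilon> f h (cplx e)"
  let ?R = "\<lambda>t x. (transfer (T_map T g \<epsilon> (?f t)) h x - transfer (T_map T g \<epsilon> f) h x) /\<^sub>R t - ?J x"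
  define v' where "v' y = (1 / I1 f y) *\<^sub>R (pushed h y * G_op (pd1 g) (cplx e) y + w1 y * G_op g (cplx e) y)
     + (- I2 f y / (I1 f y)\<^sup>2) *\<^sub>R (pushed h y * G_op g (cplx e) y)" for y
  have cce: "continuous_on UNIV (cplx e)" by (intro continuous_intros ce)
  have nz: "\<forall>y\<in>UNIV. I1 f y \<noteq> 0" using I1_pos[OF adm0] by (metis less_irrefl)
  have cv': "continuous_on UNIV v'"
    unfolding v'_def[abs_def]
    by (intro continuous_intros I.cont_deriv nz I2_cont cf continuous_on_UNIV_deriv[OF w(1)] continuous_on_UNIV_deriv[OF w(2)]
         continuous_on_UNIV_deriv[OF G_op_deriv[OF g_Ck(1) cce]] continuous_on_UNIV_deriv[OF G_op_deriv[OF g_Ck(2) cce]];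
        use nz in simp)
  have J: "AE x in circ. ?J x = - of_real \<epsilon> * ((1 / I1 f (I.\<tau> x)) *\<^sub>R v' (I.\<tau> x))" "?J \<in> L1"
    using J_op_AE[OF adm0 hp cce _ cv'] J_inner_deriv[OF adm0 cce w(1)] unfolding v'_def by blast+
  have H: "L.H (pushed h) w1 0 x = - of_real \<epsilon> * ((1 / I1 f x) *\<^sub>R v' x)" for x
  proof -
    define b a :: real where "b = I1 f x" and "a = G_op g e x"
    have b: "b \<noteq> 0" using nz by (simp add: b_def)
    have "L.Q 0 x = b" "L.Q2 0 x = I2 f x" by (simp_all add: L.Q_def L.Q2_def b_def)
    then have "L.H (pushed h) w1 0 x = (- (\<epsilon> * a) / b / b) *\<^sub>R w1 x
       + (- (\<epsilon> * G_op (pd1 g) e x + I2 f x * (- (\<epsilon> * a) / b)) / b\<^sup>2) *\<^sub>R pushed h x"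
      by (simp add: H_def L.velocity_def L.Q'_def a_def)
    also have "\<dots> = - of_real \<epsilon> * ((1 / b) *\<^sub>R ((1 / b) *\<^sub>R (pushed h x * of_real (G_op (pd1 g) e x) + w1 x * of_real a)
     + (- I2 f x / b\<^sup>2) *\<^sub>R (pushed h x * of_real a)))"
      using b by (simp add: scaleR_conv_of_real field_simps eval_nat_numeral)
    finally show ?thesis by (simp add: v'_def G_op_cplx a_def b_def)
  qed
  have R: "?R t \<in> L1 \<and> (AE y in circ. ?R t y =
      (L.U (pushed h) t y - L.U (pushed h) 0 y) /\<^sub>R t - L.H (pushed h) w1 0 (L.\<psi> 0 y))"
    if t: "\<bar>t\<bar> < t0" for t
  proof
    note tt = transfer_T_map_AE[OF adm[OF t] hp] and t0 = transfer_T_map_AE[OF adm0 hp]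
    show "?R t \<in> L1" using tt(2) t0(2) J(2) by (auto simp: L1_circ periodic_def)
    show "AE y in circ. ?R t y =
      (L.U (pushed h) t y - L.U (pushed h) 0 y) /\<^sub>R t - L.H (pushed h) w1 0 (L.\<psi> 0 y)"
      using tt(1) t0(1) J(1)
      by eventually_elim (simp add: U_def L.\<psi>_def S Q H f0)
  qed
  show ?thesis
    unfolding has_dir_deriv_def Let_def
    using L.W11_derivative[OF periodic_pushed[OF hp(1)] w, of ?R] R by blast
qed

end

lemma Ck2_Suc: "Ck2 (Suc k) \<gamma> \<Longrightarrow> Ck2 k \<gamma>"
proof (induction k arbitrary: \<gamma>)
  case (Suc k)
  have "Ck2 k (pd1 \<gamma>)" "Ck2 k (pd2 \<gamma>)"
    using Suc.prems by (auto intro!: Suc.IH simp only: Ck2.simps(2)[of "Suc k"])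
  then show ?case using Suc.prems unfolding Ck2.simps(2) by blast
qed simp

theorem proposition4p5:
  fixes T :: "real \<Rightarrow> real" and g :: "real \<Rightarrow> real \<Rightarrow> real"
    and \<epsilon>\<^sub>0 lam C\<^sub>0 C_LY K \<epsilon> :: real and N :: nat
  assumes T: "expanding_map T"
    and g_periodic: "\<And>x y. g (x + 1) y = g x y" "\<And>x y. g x (y + 1) = g x y"
    and g_C5: "Ck2 5 g"
    and constants: "0 < \<epsilon>\<^sub>0" "0 < lam" "lam < 1" "0 < C\<^sub>0" "0 < C_LY"
    and unif_expanding: "\<And>\<epsilon> f x. 0 \<le> \<epsilon> \<Longrightarrow> \<epsilon> \<le> \<epsilon>\<^sub>0 \<Longrightarrow> f \<in> densities \<Longrightarrow>
           deriv (T_map T g \<epsilon> f) x \<noteq> 0 \<and> 1 / \<bar>deriv (T_map T g \<epsilon> f) x\<bar> \<le> lam"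
    and unif_C5: "\<And>\<epsilon> f. 0 \<le> \<epsilon> \<Longrightarrow> \<epsilon> \<le> \<epsilon>\<^sub>0 \<Longrightarrow> f \<in> densities \<Longrightarrow>
           map_Ck_norm 5 (T_map T g \<epsilon> f) < C\<^sub>0"
    and Lasota_Yorke: "\<And>\<epsilon> fs i (h :: real \<Rightarrow> real).
           0 \<le> \<epsilon> \<Longrightarrow> \<epsilon> \<le> \<epsilon>\<^sub>0 \<Longrightarrow> set fs \<subseteq> densities \<Longrightarrow> i \<in> {1..4} \<Longrightarrow> h \<in> sobolev i \<Longrightarrow>
           transfer (T_seq T g \<epsilon> fs) h \<in> sobolev i \<and>
           sobolev_norm i (transfer (T_seq T g \<epsilon> fs) h)
             \<le> lam ^ (i * length fs) * sobolev_norm i h + C_LY * sobolev_norm (i - 1) h"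
    and K: "C_LY / (1 - lam\<^sup>2) \<le> K"
    and \<epsilon>: "0 \<le> \<epsilon>" "\<epsilon> \<le> \<epsilon>\<^sub>0"
    \<comment> \<open>\<open>\<epsilon> < 1 / \<parallel>g\<parallel>\<close> in the \<open>C\<^sup>1\<close> norm, with \<open>1/0 = \<infinity>\<close>\<close>
    and \<epsilon>_small: "\<epsilon> * Ck2_norm 1 g < 1"
  shows "\<exists>D :: (real \<Rightarrow> real) \<Rightarrow> (real \<Rightarrow> complex) \<Rightarrow> (real \<Rightarrow> complex).
    (\<forall>f \<in> B_K K \<inter> F_real N.
       has_frechet_F N (self_op_N T g \<epsilon> N) f (D f) \<and>
       (\<forall>e \<in> F_space N. D f e =
          (\<lambda>x. Pi_op N (transfer (T_map T g \<epsilon> f) e) x + Pi_op N (J_op T g \<epsilon> f (cplx f) e) x)) \<and>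
       (\<forall>h \<in> F_space N. \<forall>e \<in> F_real N.
          has_dir_deriv (\<lambda>f. transfer (T_map T g \<epsilon> f) h) f e (J_op T g \<epsilon> f h (cplx e)))) \<and>
    (\<exists>\<rho> :: real \<Rightarrow> real. \<exists>\<delta> > 0. \<rho> \<in> o[at_right 0](\<lambda>s. s) \<and>
       (\<forall>f \<in> B_K K \<inter> F_real N. \<forall>e \<in> F_real N. sobolev_norm 1 e < \<delta> \<longrightarrow>
          sobolev_norm 1 (\<lambda>x. self_op_N T g \<epsilon> N (\<lambda>x. f x + e x) x - self_op_N T g \<epsilon> N f x - D f (cplx e) x)
            \<le> (1 + sobolev_norm 3 f) * \<rho> (sobolev_norm 1 e)))"
proof -
  obtain d :: int and \<sigma> :: real where d: "\<And>x. T (x + 1) = T x + of_int d"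
    and \<sigma>: "1 < \<sigma>" "\<And>x. \<sigma> \<le> \<bar>deriv T x\<bar>" and ck: "Ck 5 T"
    using T unfolding expanding_map_def circle_map_def by blast
  have dT: "((deriv ^^ j) T has_real_derivative (deriv ^^ Suc j) T x) (at x)" if "j < 5" for j x
    using ck that by (simp add: Ck_def DERIV_deriv_iff_real_differentiable)
  have cT: "continuous_on UNIV ((deriv ^^ j) T)" if "j < 5" for j
    using dT[OF that] by (meson DERIV_isCont continuous_at_imp_continuous_on)
  have cover: "circle_cover T (deriv T) d \<sigma>"
    using dT[of 0] cT[of 1] d \<sigma> by unfold_locales auto
  interpret coupled_map T "deriv T" "(deriv ^^ 2) T" "(deriv ^^ 3) T" d \<sigma> g \<epsilon>
  proof (rule coupled_map.intro[OF cover])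
    show "(deriv T has_real_derivative (deriv ^^ 2) T x) (at x)"
      "((deriv ^^ 2) T has_real_derivative (deriv ^^ 3) T x) (at x)" for x
      using dT[of 1 x] dT[of 2 x] by (simp_all add: eval_nat_numeral)
    show "continuous_on UNIV ((deriv ^^ 3) T)" by (rule cT) simp
    show "Ck2 4 g" using Ck2_Suc[of 4 g] g_C5 by simp
    show "biperiodic g" using g_periodic by (simp add: biperiodic_def)
  qed (rule \<epsilon>(1) \<epsilon>_small)+
  obtain C where C: "0 \<le> C" and "\<forall>f\<in>densities \<inter> F_real N. \<forall>e\<in>F_real N. sobolev_norm 1 e < 1 - q \<longrightarrow>
      self_op_N T g \<epsilon> N (\<lambda>x. f x + e x) \<in> F_space N \<and>
      sobolev_norm 1 (\<lambda>x. self_op_N T g \<epsilon> N (\<lambda>x. f x + e x) x - self_op_N T g \<epsilon> N f x - D_op N f (cplx e) x)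
        \<le> C * (sobolev_norm 1 e)\<^sup>2"
    using quadratic_remainder[of N] by (elim exE conjE)
  then have rem: "self_op_N T g \<epsilon> N (\<lambda>x. f x + e x) \<in> F_space N"
      "sobolev_norm 1 (\<lambda>x. self_op_N T g \<epsilon> N (\<lambda>x. f x + e x) x - self_op_N T g \<epsilon> N f x - D_op N f (cplx e) x)
        \<le> C * (sobolev_norm 1 e)\<^sup>2"
    if "f \<in> densities" "f \<in> F_real N" "e \<in> F_real N" "sobolev_norm 1 e < 1 - q" for f e
    using that by blast+
  have frechet: "has_frechet_F N (self_op_N T g \<epsilon> N) f (D_op N f)" if f: "f \<in> densities" "f \<in> F_real N" for f
    unfolding has_frechet_F_def
  proof (intro conjI allI impI)
    show "D_op N f \<in> lin_F N"
      by (rule D_op_lin_F[OF admissible_density[OF f(1) F_realD(3)[OF f(2)]] f(2)])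
    fix \<eta> :: real assume \<eta>: "0 < \<eta>"
    show "\<exists>\<delta>>0. \<forall>e\<in>F_real N. sobolev_norm 1 e < \<delta> \<longrightarrow>
        self_op_N T g \<epsilon> N (\<lambda>x. f x + e x) \<in> F_space N \<and>
        sobolev_norm 1 (\<lambda>x. self_op_N T g \<epsilon> N (\<lambda>x. f x + e x) x - self_op_N T g \<epsilon> N f x - D_op N f (cplx e) x)
          \<le> \<eta> * sobolev_norm 1 e"
    proof (intro exI[of _ "min (1 - q) (\<eta> / (C + 1))"] conjI ballI impI)
      show "0 < min (1 - q) (\<eta> / (C + 1))" using q C \<eta> by simp
      fix e assume e: "e \<in> F_real N" "sobolev_norm 1 e < min (1 - q) (\<eta> / (C + 1))"
      have "sobolev_norm 1 e < 1 - q" using e(2) by simp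
      note r = rem[OF f e(1) this]
      show "self_op_N T g \<epsilon> N (\<lambda>x. f x + e x) \<in> F_space N" by (rule r(1))
      let ?s = "sobolev_norm 1 e"
      have s: "0 \<le> ?s" by (rule sobolev_norm_nonneg)
      have "C * ?s \<le> (C + 1) * ?s" using s by (intro mult_right_mono) auto
      also have "\<dots> \<le> \<eta>" using e(2) C by (simp add: pos_less_divide_eq mult.commute)
      finally have "C * ?s * ?s \<le> \<eta> * ?s" using s by (rule mult_right_mono)
      then show "sobolev_norm 1 (\<lambda>x. self_op_N T g \<epsilon> N (\<lambda>x. f x + e x) x - self_op_N T g \<epsilon> N f x - D_op N f (cplx e) x)
          \<le> \<eta> * ?s"
        using r(2) by (simp add: power2_eq_square mult.assoc)
    qed
  qed
  have little_o: "(\<lambda>s. C * s\<^sup>2) \<in> o[at_right 0](\<lambda>s. s)"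
  proof (rule smalloI_tendsto)
    have "((\<lambda>s::real. C * s) \<longlongrightarrow> C * 0) (at_right 0)" by (intro tendsto_intros)
    moreover have "C * s\<^sup>2 / s = C * s" for s :: real by (simp add: power2_eq_square)
    ultimately show "((\<lambda>s::real. C * s\<^sup>2 / s) \<longlongrightarrow> 0) (at_right 0)" by simp
    show "\<forall>\<^sub>F s in at_right 0. s \<noteq> (0::real)"
      by (rule eventually_mono[OF eventually_at_right_less]) simp
  qed
  have taylor: "sobolev_norm 1 (\<lambda>x. self_op_N T g \<epsilon> N (\<lambda>x. f x + e x) x - self_op_N T g \<epsilon> N f x - D_op N f (cplx e) x)
      \<le> (1 + sobolev_norm 3 f) * (C * (sobolev_norm 1 e)\<^sup>2)"
    if f: "f \<in> densities" "f \<in> F_real N" and e: "e \<in> F_real N" "sobolev_norm 1 e < 1 - q" for f e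
  proof -
    have "1 * (C * (sobolev_norm 1 e)\<^sup>2) \<le> (1 + sobolev_norm 3 f) * (C * (sobolev_norm 1 e)\<^sup>2)"
      using C sobolev_norm_nonneg[of 3 f] by (intro mult_right_mono) auto
    then show ?thesis using rem(2)[OF f e] by linarith
  qed
  have "B_K K \<subseteq> densities" by (auto simp: B_K_def)
  then have dens: "f \<in> densities" if "f \<in> B_K K \<inter> F_real N" for f using that by blast
  show ?thesis
  proof (intro exI[of _ "D_op N"] conjI ballI exI[of _ "\<lambda>s. C * s\<^sup>2"] exI[of _ "1 - q"] impI)
    show "0 < 1 - q" using q by simp
    show "(\<lambda>s. C * s\<^sup>2) \<in> o[at_right 0](\<lambda>s. s)" by (rule little_o)
    fix f assume f: "f \<in> B_K K \<inter> F_real N"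
    then have f': "f \<in> densities" "f \<in> F_real N" using dens by auto
    show "has_frechet_F N (self_op_N T g \<epsilon> N) f (D_op N f)" by (rule frechet[OF f'])
    show "D_op N f e = (\<lambda>x. Pi_op N (transfer (T_map T g \<epsilon> f) e) x + Pi_op N (J_op T g \<epsilon> f (cplx f) e) x)" for e
      by (rule D_op_def)
    show "has_dir_deriv (\<lambda>f. transfer (T_map T g \<epsilon> f) h) f e (J_op T g \<epsilon> f h (cplx e))"
      if "h \<in> F_space N" "e \<in> F_real N" for h e
      by (rule has_dir_deriv_transfer[OF f' that(2,1)])
    show "sobolev_norm 1 (\<lambda>x. self_op_N T g \<epsilon> N (\<lambda>x. f x + e x) x - self_op_N T g \<epsilon> N f x - D_op N f (cplx e) x)
        \<le> (1 + sobolev_norm 3 f) * (C * (sobolev_norm 1 e)\<^sup>2)"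
      if "e \<in> F_real N" "sobolev_norm 1 e < 1 - q" for e
      by (rule taylor[OF f' that])
  qed
qed

end
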